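(* Let $d\in\{1,2,3\}$ and $\varepsilon>0$. Let $m$ and $\mu_n$, $n\in\mathbb{N}$, be finite real-valued Radon measures on $\mathbb{R}^d$. Suppose that the sequence $(\mu_n)_{n\in\mathbb{N}}$ converges to $m$ weakly and that $\sup_{n\in\mathbb{N}}\|\mu_n\|<\infty$. Then the operators $-\Delta+\varepsilon^2\Delta^2+\mu_n$ converge to $-\Delta+\varepsilon^2\Delta^2+m$ in the norm resolvent sense in $L^2(\mathbb{R}^d,dx)$ as $n\to\infty$.
   Context: For a finite real-valued (signed) Radon measure $\mu$ on $\mathbb{R}^d$ with Hahn-Jordan decomposition $\mu=\mu^+-\mu^-$, put $|\mu|=\mu^++\mu^-$ and $\|\mu\|=\mu^+(\mathbb{R}^d)+\mu^-(\mathbb{R}^d)$. Weak convergence $\mu_n\to m$ means $\int f\,d\mu_n\to\int f\,dm$ for every bounded continuous function $f$ on $\mathbb{R}^d$. For $d\le 3$ every $f\in H^2(\mathbb{R}^d)$ has a unique continuous representative, denoted $\tilde f$, which is bounded. For $\varepsilon>0$ and a finite real-valued Radon measure $\mu$ on $\mathbb{R}^d$, $d\le 3$, the quadratic form $$\mathcal{E}_\varepsilon^\mu(f,f)=\varepsilon^2(\Delta f,\Delta f)+(\nabla f,\nabla f)+\int|\tilde f|^2\,d\mu,\qquad f\in D(\mathcal{E}_\varepsilon^\mu)=H^2(\mathbb{R}^d),$$ is lower semibounded and closed in $L^2(\mathbb{R}^d,dx)$ (scalar products are in $L^2(\mathbb{R}^d,dx)$); $-\Delta+\varepsilon^2\Delta^2+\mu$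 denotes the lower semibounded self-adjoint operator in $L^2(\mathbb{R}^d,dx)$ associated to this form. *)

theory Defs
  imports "HOL-Analysis.Analysis"
begin

section \<open>The complex Hilbert space of square-integrable functions\<close>

definition square_integrable :: "('a::euclidean_space \<Rightarrow> complex) \<Rightarrow> bool" where
  "square_integrable f \<longleftrightarrow>
     f \<in> borel_measurable lborel \<and> integrable lborel (\<lambda>x. (cmod (f x))\<^sup>2)"

definition l2_rel :: "('a::euclidean_space \<Rightarrow> complex) \<Rightarrow> ('a \<Rightarrow> complex) \<Rightarrow> bool" where
  "l2_rel f g \<longleftrightarrow> square_integrable f \<and> square_integrable g \<and> (AE x in lborel. f x = g x)"

lemma square_integrable_mult:
  assumes "square_integrable f" "square_integrable g"
  shows "integrable lborel (\<lambda>x. f x * cnj (g x))"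
proof (rule Bochner_Integration.integrable_bound)
  show "integrable lborel (\<lambda>x. (cmod (f x))\<^sup>2 + (cmod (g x))\<^sup>2)"
    using assms by (simp add: square_integrable_def)
  show "(\<lambda>x. f x * cnj (g x)) \<in> borel_measurable lborel"
    using assms
    by (auto simp: square_integrable_def
        intro!: borel_measurable_times borel_measurable_continuous_on[of cnj] continuous_intros)
  have "a * b \<le> a\<^sup>2 + b\<^sup>2" if "a \<ge> 0" "b \<ge> 0" for a b :: real
    using sum_squares_bound[of a b] mult_nonneg_nonneg[OF that] by linarith
  then show "AE x in lborel. norm (f x * cnj (g x)) \<le> norm ((cmod (f x))\<^sup>2 + (cmod (g x))\<^sup>2)"
    by (simp add: norm_mult)
qed

lemma square_integrable_zero: "square_integrable (\<lambda>_. 0)"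
  by (simp add: square_integrable_def)

lemma square_integrable_scale:
  assumes "square_integrable f"
  shows "square_integrable (\<lambda>x. c * f x)"
  using assms by (auto simp: square_integrable_def norm_mult power_mult_distrib)

lemma square_integrable_add:
  assumes "square_integrable f" "square_integrable g"
  shows "square_integrable (\<lambda>x. f x + g x)"
  unfolding square_integrable_def
proof
  show meas: "(\<lambda>x. f x + g x) \<in> borel_measurable lborel"
    using assms by (auto simp: square_integrable_def)
  show "integrable lborel (\<lambda>x. (cmod (f x + g x))\<^sup>2)"
  proof (rule Bochner_Integration.integrable_bound)
    show "integrable lborel (\<lambda>x. 2 * (cmod (f x))\<^sup>2 + 2 * (cmod (g x))\<^sup>2)"
      using assms by (simp add: square_integrable_def)
    show "(\<lambda>x. (cmod (f x + g x))\<^sup>2) \<in> borel_measurable lborel"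
      using meas by simp
    have "(cmod (a + b))\<^sup>2 \<le> 2 * (cmod a)\<^sup>2 + 2 * (cmod b)\<^sup>2" for a b
    proof -
      have "(cmod (a + b))\<^sup>2 \<le> (cmod a + cmod b)\<^sup>2"
        by (intro power_mono norm_triangle_ineq) simp
      also have "\<dots> \<le> 2 * (cmod a)\<^sup>2 + 2 * (cmod b)\<^sup>2"
        using sum_squares_bound[of "cmod a" "cmod b"] by (simp add: power2_sum)
      finally show ?thesis .
    qed
    then show "AE x in lborel. norm ((cmod (f x + g x))\<^sup>2)
        \<le> norm (2 * (cmod (f x))\<^sup>2 + 2 * (cmod (g x))\<^sup>2)"
      by simp
  qed
qed

quotient_type (overloaded) 'a l2 = "'a::euclidean_space \<Rightarrow> complex" / partial: l2_rel
proof (rule part_equivpI)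
  show "\<exists>x. l2_rel x x"
    using square_integrable_zero by (auto simp: l2_rel_def)
  show "symp l2_rel"
    by (auto simp: symp_def l2_rel_def elim: AE_mp)
  show "transp l2_rel"
    unfolding transp_def l2_rel_def by (auto elim: AE_mp)
qed

lift_definition cscale :: "complex \<Rightarrow> ('a::euclidean_space) l2 \<Rightarrow> 'a l2" is "\<lambda>c f x. c * f x"
  by (auto simp: l2_rel_def square_integrable_scale)

lift_definition cinner :: "('a::euclidean_space) l2 \<Rightarrow> 'a l2 \<Rightarrow> complex"
  is "\<lambda>f g. LINT x|lborel. f x * cnj (g x)"
proof -
  fix f f' g g' :: "'a \<Rightarrow> complex"
  assume "l2_rel f f'" "l2_rel g g'"
  then show "(LINT x|lborel. f x * cnj (g x)) = (LINT x|lborel. f' x * cnj (g' x))"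
    by (intro integral_cong_AE borel_measurable_integrable square_integrable_mult)
      (auto simp: l2_rel_def)
qed

instantiation l2 :: (euclidean_space) real_inner
begin

lift_definition zero_l2 :: "'a l2" is "\<lambda>_. 0"
  by (simp add: l2_rel_def square_integrable_zero)

lift_definition plus_l2 :: "'a l2 \<Rightarrow> 'a l2 \<Rightarrow> 'a l2" is "\<lambda>f g x. f x + g x"
  by (auto simp: l2_rel_def square_integrable_add)

definition uminus_l2 :: "'a l2 \<Rightarrow> 'a l2" where "uminus_l2 f = cscale (-1) f"
definition minus_l2 :: "'a l2 \<Rightarrow> 'a l2 \<Rightarrow> 'a l2" where "minus_l2 f g = f + cscale (-1) g"
definition scaleR_l2 :: "real \<Rightarrow> 'a l2 \<Rightarrow> 'a l2" where "scaleR_l2 r f = cscale (of_real r) f"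
definition inner_l2 :: "'a l2 \<Rightarrow> 'a l2 \<Rightarrow> real" where "inner_l2 f g = Re (cinner f g)"
definition norm_l2 :: "'a l2 \<Rightarrow> real" where "norm_l2 f = sqrt (inner f f)"
definition sgn_l2 :: "'a l2 \<Rightarrow> 'a l2" where "sgn_l2 f = scaleR (inverse (norm f)) f"
definition dist_l2 :: "'a l2 \<Rightarrow> 'a l2 \<Rightarrow> real" where "dist_l2 f g = norm (f - g)"
definition uniformity_l2 :: "('a l2 \<times> 'a l2) filter" where
  "uniformity_l2 = (INF e\<in>{0<..}. principal {(f, g). dist f g < e})"
definition open_l2 :: "'a l2 set \<Rightarrow> bool" where
  "open_l2 U \<longleftrightarrow> (\<forall>f\<in>U. eventually (\<lambda>(f', g). f' = f \<longrightarrow> g \<in> U) uniformity)"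

instance
proof
  fix f g h :: "'a l2" and r s :: real
  show "f + g + h = f + (g + h)"
    by transfer (auto simp: l2_rel_def algebra_simps intro!: square_integrable_add)
  show "f + g = g + f"
    by transfer (auto simp: l2_rel_def algebra_simps intro!: square_integrable_add)
  show "0 + f = f"
    by transfer (auto simp: l2_rel_def)
  show "- f + f = 0"
    unfolding uminus_l2_def
    by transfer (use square_integrable_scale[of _ "-1"] in
        \<open>auto simp: l2_rel_def square_integrable_zero\<close>)
  show "f - g = f + - g"
    by (simp add: minus_l2_def uminus_l2_def)
  show "r *\<^sub>R (f + g) = r *\<^sub>R f + r *\<^sub>R g"
    unfolding scaleR_l2_def
    by transfer (auto simp: l2_rel_def distrib_left distrib_right
        intro!: square_integrable_add square_integrable_scale)
  show "(r + s) *\<^sub>R f = r *\<^sub>R f + s *\<^sub>R f"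
    unfolding scaleR_l2_def
    by transfer (auto simp: l2_rel_def distrib_left distrib_right
        intro!: square_integrable_add square_integrable_scale)
  show "r *\<^sub>R s *\<^sub>R f = (r * s) *\<^sub>R f"
    unfolding scaleR_l2_def
    by transfer (auto simp: l2_rel_def mult.assoc intro!: square_integrable_scale)
  show "1 *\<^sub>R f = f"
    unfolding scaleR_l2_def by transfer (auto simp: l2_rel_def)
  show "sgn f = scaleR (inverse (norm f)) f" "dist f g = norm (f - g)" "norm f = sqrt (inner f f)"
    by (rule sgn_l2_def dist_l2_def norm_l2_def)+
  show "uniformity = (INF e\<in>{0<..}. principal {(f::'a l2, g). dist f g < e})"
    by (rule uniformity_l2_def)
  show "open U \<longleftrightarrow> (\<forall>f\<in>U. \<forall>\<^sub>F (f', g) in uniformity. f' = f \<longrightarrow> g \<in> U)" for U :: "'a l2 set"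
    by (rule open_l2_def)
  show "inner f g = inner g f"
    unfolding inner_l2_def
  proof transfer
    fix f g :: "'a \<Rightarrow> complex"
    have "(LINT x|lborel. f x * cnj (g x)) = (LINT x|lborel. cnj (g x * cnj (f x)))"
      by (simp add: mult.commute)
    also have "\<dots> = cnj (LINT x|lborel. g x * cnj (f x))"
      by (rule Bochner_Integration.integral_cnj)
    finally show "Re (LINT x|lborel. f x * cnj (g x)) = Re (LINT x|lborel. g x * cnj (f x))"
      by simp
  qed
  show "inner (f + g) h = inner f h + inner g h"
    unfolding inner_l2_def
    by transfer (simp add: l2_rel_def distrib_right square_integrable_mult)
  show "inner (r *\<^sub>R f) g = r * inner f g"
    unfolding inner_l2_def scaleR_l2_def by transfer (simp add: mult.assoc)
  have sq: "(\<lambda>x. k x * cnj (k x)) = (\<lambda>x. complex_of_real ((cmod (k x))\<^sup>2))" for k :: "'a \<Rightarrow> complex"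
    by (simp only: complex_norm_square)
  show "0 \<le> inner f f"
    unfolding inner_l2_def by transfer (simp add: sq del: of_real_power)
  show "inner f f = 0 \<longleftrightarrow> f = 0"
    unfolding inner_l2_def
    by transfer (auto simp: sq l2_rel_def square_integrable_def integral_nonneg_eq_0_iff_AE
        simp del: of_real_power)
qed

end


section \<open>The Sobolev space \<open>H\<^sup>2\<close>\<close>

primrec iterated_partial :: "'a list \<Rightarrow> ('a::euclidean_space \<Rightarrow> complex) \<Rightarrow> 'a \<Rightarrow> complex" where
  "iterated_partial [] f = f"
| "iterated_partial (b # bs) f = iterated_partial bs (\<lambda>x. frechet_derivative f (at x) b)"

text \<open>Membership in \<open>C\<^sub>c\<^sup>\<infinity>\<close>: if all iterated partial derivatives are differentiable, then they
  are all continuous.\<close>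

definition test_function :: "('a::euclidean_space \<Rightarrow> complex) \<Rightarrow> bool" where
  "test_function \<phi> \<longleftrightarrow>
     (\<forall>bs. set bs \<subseteq> Basis \<longrightarrow> iterated_partial bs \<phi> differentiable_on UNIV) \<and>
     compact (closure {x. \<phi> x \<noteq> 0})"

definition has_weak_partial :: "'a \<Rightarrow> ('a::euclidean_space) l2 \<Rightarrow> 'a l2 \<Rightarrow> bool" where
  "has_weak_partial b f g \<longleftrightarrow>
     (\<forall>\<phi>. test_function \<phi> \<longrightarrow>
        (LINT x|lborel. rep_l2 f x * frechet_derivative \<phi> (at x) b) =
        - (LINT x|lborel. rep_l2 g x * \<phi> x))"

definition weak_partial :: "'a \<Rightarrow> ('a::euclidean_space) l2 \<Rightarrow> 'a l2" where
  "weak_partial b f = (THE g. has_weak_partial b f g)"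

primrec sobolev :: "nat \<Rightarrow> ('a::euclidean_space) l2 set" where
  "sobolev 0 = UNIV"
| "sobolev (Suc k) = {f. \<forall>b\<in>Basis. \<exists>g\<in>sobolev k. has_weak_partial b f g}"

definition laplacian :: "('a::euclidean_space) l2 \<Rightarrow> 'a l2" where
  "laplacian f = (\<Sum>b\<in>Basis. weak_partial b (weak_partial b f))"

definition continuous_rep :: "('a::euclidean_space) l2 \<Rightarrow> 'a \<Rightarrow> complex" where
  "continuous_rep f = (THE g. continuous_on UNIV g \<and> (AE x in lborel. g x = rep_l2 f x))"


section \<open>Finite signed measures\<close>

text \<open>A signed measure is a countably additive real-valued function on the Borel sets; its values
  on other sets are irrelevant. On a Euclidean space all finite Borel measures are regular, hence
  finite signed Borel measures and finite signed Radon measures are the same thing.\<close>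

definition finite_signed_measure :: "('a::euclidean_space set \<Rightarrow> real) \<Rightarrow> bool" where
  "finite_signed_measure \<mu> \<longleftrightarrow> \<mu> {} = 0 \<and>
     (\<forall>A. range A \<subseteq> sets borel \<and> disjoint_family A \<longrightarrow> (\<lambda>i::nat. \<mu> (A i)) sums \<mu> (\<Union>i. A i))"

definition hahn_set :: "('a::euclidean_space set \<Rightarrow> real) \<Rightarrow> 'a set" where
  "hahn_set \<mu> = (SOME P. P \<in> sets borel \<and>
     (\<forall>A\<in>sets borel. A \<subseteq> P \<longrightarrow> \<mu> A \<ge> 0) \<and> (\<forall>A\<in>sets borel. A \<inter> P = {} \<longrightarrow> \<mu> A \<le> 0))"

definition pos_part :: "('a::euclidean_space set \<Rightarrow> real) \<Rightarrow> 'a measure" where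
  "pos_part \<mu> = measure_of UNIV (sets borel) (\<lambda>A. ennreal (\<mu> (A \<inter> hahn_set \<mu>)))"

definition neg_part :: "('a::euclidean_space set \<Rightarrow> real) \<Rightarrow> 'a measure" where
  "neg_part \<mu> = measure_of UNIV (sets borel) (\<lambda>A. ennreal (- \<mu> (A - hahn_set \<mu>)))"

definition total_variation :: "('a::euclidean_space set \<Rightarrow> real) \<Rightarrow> real" where
  "total_variation \<mu> = measure (pos_part \<mu>) UNIV + measure (neg_part \<mu>) UNIV"

definition signed_integral ::
    "('a::euclidean_space set \<Rightarrow> real) \<Rightarrow> ('a \<Rightarrow> 'b::{banach, second_countable_topology}) \<Rightarrow> 'b" where
  "signed_integral \<mu> f = integral\<^sup>L (pos_part \<mu>) f - integral\<^sup>L (neg_part \<mu>) f"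

definition weakly_converges ::
    "(nat \<Rightarrow> 'a::euclidean_space set \<Rightarrow> real) \<Rightarrow> ('a set \<Rightarrow> real) \<Rightarrow> bool" where
  "weakly_converges \<mu> m \<longleftrightarrow>
     (\<forall>f :: 'a \<Rightarrow> real. continuous_on UNIV f \<and> bounded (range f) \<longrightarrow>
        (\<lambda>n. signed_integral (\<mu> n) f) \<longlonglongrightarrow> signed_integral m f)"


section \<open>Operators and norm resolvent convergence\<close>

text \<open>An unbounded operator is represented by its graph.\<close>

type_synonym 'a l2_operator = "('a l2 \<times> 'a l2) set"

text \<open>The operator associated to a form (first representation theorem): \<open>f\<close> is in its domain and
  is mapped to \<open>g\<close> iff \<open>f \<in> D\<close> and \<open>E(f,h) = (g,h)\<close> for all \<open>h \<in> D\<close>.\<close>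

definition form_operator ::
    "('a::euclidean_space) l2 set \<Rightarrow> ('a l2 \<Rightarrow> 'a l2 \<Rightarrow> complex) \<Rightarrow> 'a l2_operator" where
  "form_operator D E = {(f, g). f \<in> D \<and> (\<forall>h\<in>D. E f h = cinner g h)}"

text \<open>The sesquilinear form obtained by polarisation from
  \<open>\<epsilon>\<^sup>2(\<Delta>f,\<Delta>f) + (\<nabla>f,\<nabla>f) + \<integral>|f|\<^sup>2 d\<mu>\<close>, where \<open>f\<close> in the last term is the
  continuous representative.\<close>

definition energy_form ::
    "real \<Rightarrow> ('a::euclidean_space set \<Rightarrow> real) \<Rightarrow> 'a l2 \<Rightarrow> 'a l2 \<Rightarrow> complex" where
  "energy_form \<epsilon> \<mu> f h =
     of_real (\<epsilon>\<^sup>2) * cinner (laplacian f) (laplacian h)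
     + (\<Sum>b\<in>Basis. cinner (weak_partial b f) (weak_partial b h))
     + signed_integral \<mu> (\<lambda>x. continuous_rep f x * cnj (continuous_rep h x))"

text \<open>\<open>-\<Delta> + \<epsilon>\<^sup>2\<Delta>\<^sup>2 + \<mu>\<close>\<close>

definition perturbed_operator ::
    "real \<Rightarrow> ('a::euclidean_space set \<Rightarrow> real) \<Rightarrow> 'a l2_operator" where
  "perturbed_operator \<epsilon> \<mu> = form_operator (sobolev 2) (energy_form \<epsilon> \<mu>)"

definition resolvent :: "('a::euclidean_space) l2_operator \<Rightarrow> complex \<Rightarrow> 'a l2 \<Rightarrow> 'a l2" where
  "resolvent A z f = (THE u. \<exists>v. (u, v) \<in> A \<and> v - cscale z u = f)"

definition resolvent_set :: "('a::euclidean_space) l2_operator \<Rightarrow> complex set" where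
  "resolvent_set A =
     {z. (\<forall>f. \<exists>!p. p \<in> A \<and> snd p - cscale z (fst p) = f) \<and> bounded_linear (resolvent A z)}"

definition norm_resolvent_converges ::
    "(nat \<Rightarrow> ('a::euclidean_space) l2_operator) \<Rightarrow> 'a l2_operator \<Rightarrow> bool" where
  "norm_resolvent_converges A B \<longleftrightarrow>
     (\<forall>z. Im z \<noteq> 0 \<longrightarrow>
        (\<forall>n. z \<in> resolvent_set (A n)) \<and> z \<in> resolvent_set B \<and>
        (\<lambda>n. onorm (\<lambda>f. resolvent (A n) z f - resolvent B z f)) \<longlonglongrightarrow> 0)"

end

theory Submission
  imports Defs "HOL-Probability.Probability"
begin

text \<open>In Fourier space \<open>H\<^sup>2\<close> consists of the functions \<open>u\<close> with Fourier transform
  \<open>\<phi> \<xi> / (1 + |\<xi>|\<^sup>2)\<close>, \<open>\<phi> \<in> L\<^sup>2\<close>. For \<open>d \<le> 3\<close> the weight \<open>1 / (1 + |\<xi>|\<^sup>2)\<close> is square-integrable, so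
  \<open>u\<close> is continuous and \<open>|u(x)| \<le> \<delta> \<parallel>\<phi>\<parallel> + C \<parallel>u\<parallel>\<close> with \<open>\<delta>\<close> arbitrarily small. Hence the form, shifted by
  a nonreal \<open>z\<close> and rotated, is coercive with respect to \<open>\<phi>\<close>, uniformly for measures of bounded total
  variation, and the Lax-Milgram lemma yields the resolvents. As a form in \<open>\<phi>\<close> and \<open>\<psi>\<close>, the integral of
  \<open>u\<close> times the conjugate of \<open>v\<close> with respect to \<open>m - \<mu>\<^sub>n\<close> has the kernel
  \<open>D\<^sub>n(\<xi> - \<eta>) / ((1 + |\<xi>|\<^sup>2) (1 + |\<eta>|\<^sup>2))\<close> where \<open>D\<^sub>n\<close> is the characteristic function of \<open>m - \<mu>\<^sub>n\<close>. It is
  bounded and tends to \<open>0\<close> pointwise, so the Hilbert-Schmidt norm of the kernel tends to \<open>0\<close> by dominated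
  convergence; in particular no tightness of the measures is needed.\<close>

section \<open>Hilbert spaces\<close>

text \<open>The unitary Fourier transform acts on classes of functions, and statements about it are
  reduced to modulated Gaussians. These and their transforms have equal Gram matrices and are both
  total, so mapping one family to the other extends to a unitary operator, and later identities are
  checked against Gaussians only. The obstacle is that \<open>sobolev\<close> rests on compactly
  supported test functions, which include no Gaussians and whose transforms are not explicit. In one
  direction Gaussians are truncated by smooth cutoffs; in the other the derivative of a test
  function is replaced by difference quotients, which transform into multiplication by bounded
  functions. Thus weak differentiation becomes multiplication by \<open>i\<close> times a coordinate
  without any decay estimate for transforms of test functions. The abstract Hilbert space results
  are real; complex scalars enter by admitting all complex multiples in a family or by replacing a
  test vector by \<open>i\<close> times it. Resolvents at all nonreal points come from coercivity
  alone, and the same coercivity constants reappear in the estimate of the difference of two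
  resolvents.\<close>

lemma hilbert_projection:
  fixes S :: "'h::{real_inner,complete_space} set"
  assumes S: "subspace S" "closed S"
  shows "\<exists>p\<in>S. \<forall>s\<in>S. inner (x - p) s = 0"
proof -
  define D where "D = (\<lambda>s. (norm (x - s))\<^sup>2) ` S"
  define d where "d = Inf D"
  have ne: "D \<noteq> {}" using subspace_0[OF S(1)] by (auto simp: D_def)
  have bdd: "bdd_below D" by (auto simp: D_def intro!: bdd_belowI[of _ 0])
  have dle: "d \<le> (norm (x - s))\<^sup>2" if "s \<in> S" for s
    unfolding d_def by (rule cInf_lower) (use that bdd in \<open>auto simp: D_def\<close>)
  have "\<exists>s\<in>S. (norm (x - s))\<^sup>2 < d + 1 / real (Suc n)" for n
  proof -
    have "Inf D < d + 1 / real (Suc n)" by (simp add: d_def)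
    from cInf_lessD[OF ne this] show ?thesis by (auto simp: D_def)
  qed
  then obtain s where s: "\<And>n. s n \<in> S" and sd: "\<And>n. (norm (x - s n))\<^sup>2 < d + 1 / real (Suc n)"
    by metis
  \<comment> \<open>The midpoint of \<open>s n\<close> and \<open>s k\<close> lies in
    \<open>S\<close>, so its squared distance from \<open>x\<close> is at least \<open>d\<close>.
    The parallelogram identity then bounds the mutual distance by the two excesses over
    \<open>d\<close>.\<close>
  have par: "(norm (s n - s k))\<^sup>2 \<le> 2 / real (Suc n) + 2 / real (Suc k)" for n k
  proof -
    have "(1/2) *\<^sub>R (s n + s k) \<in> S" using s S(1) by (intro subspace_scale subspace_add) auto
    then have "d \<le> (norm (x - (1/2) *\<^sub>R (s n + s k)))\<^sup>2" by (rule dle)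
    moreover have "(norm (s n - s k))\<^sup>2 + 4 * (norm (x - (1/2) *\<^sub>R (s n + s k)))\<^sup>2
        = 2 * (norm (x - s n))\<^sup>2 + 2 * (norm (x - s k))\<^sup>2"
      by (simp add: power2_norm_eq_inner inner_diff_left inner_diff_right inner_add_left
          inner_add_right inner_commute algebra_simps)
    ultimately show ?thesis using sd[of n] sd[of k] by simp
  qed
  have "Cauchy s"
  proof (rule metric_CauchyI)
    fix e :: real assume e: "e > 0"
    obtain N :: nat where N: "4 / e\<^sup>2 < real N" using reals_Archimedean2 by blast
    have N0: "N > 0" using N e by (cases N) (auto simp: field_simps)
    show "\<exists>M. \<forall>m\<ge>M. \<forall>n\<ge>M. dist (s m) (s n) < e"
    proof (intro exI allI impI)
      fix m n assume mn: "m \<ge> N" "n \<ge> N"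
      have "2 / real (Suc m) \<le> 2 / real (Suc N)" "2 / real (Suc n) \<le> 2 / real (Suc N)"
        using mn by (auto intro!: divide_left_mono)
      with par[of m n] have "(norm (s m - s n))\<^sup>2 \<le> 4 / real (Suc N)" by linarith
      also have "\<dots> < 4 / real N" using N0 by (intro divide_strict_left_mono) auto
      also have "\<dots> < e\<^sup>2" using N e N0 by (simp add: field_simps)
      finally show "dist (s m) (s n) < e" using e by (simp add: dist_norm power2_less_imp_less)
    qed
  qed
  then obtain p where p: "s \<longlonglongrightarrow> p" using Cauchy_convergent_iff convergent_def by blast
  have pS: "p \<in> S" using closed_sequentially[OF S(2)] s p by blast
  have lim1: "(\<lambda>n. (norm (x - s n))\<^sup>2) \<longlonglongrightarrow> (norm (x - p))\<^sup>2"
    by (intro tendsto_intros p)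
  have lim2: "(\<lambda>n. d + 1 / real (Suc n)) \<longlonglongrightarrow> d + 0"
    by (intro tendsto_intros LIMSEQ_Suc[OF lim_1_over_n])
  have pd: "(norm (x - p))\<^sup>2 \<le> d"
    using LIMSEQ_le[OF lim1 lim2] sd by (auto intro: less_imp_le)
  have "inner (x - p) r = 0" if r: "r \<in> S" for r
  proof (cases "r = 0")
    case False
    \<comment> \<open>The minimiser of the quadratic polynomial in \<open>t\<close> expanded below.
      Moving from \<open>p\<close> to \<open>p + t r\<close> would lower the distance strictly
      unless \<open>inner (x - p) r\<close> vanishes.\<close>
    define t where "t = inner (x - p) r / inner r r"
    have rr: "inner r r > 0" using False by simp
    have "p + t *\<^sub>R r \<in> S" using pS r S(1) by (intro subspace_add subspace_scale)
    then have "d \<le> (norm (x - (p + t *\<^sub>R r)))\<^sup>2" by (rule dle)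
    also have "\<dots> = (norm (x - p))\<^sup>2 - 2 * t * inner (x - p) r + t\<^sup>2 * inner r r"
      by (simp add: power2_norm_eq_inner inner_diff_left inner_diff_right inner_add_left
          inner_add_right inner_commute algebra_simps) (simp add: power2_eq_square)
    also have "\<dots> = (norm (x - p))\<^sup>2 - (inner (x - p) r)\<^sup>2 / inner r r"
      using rr by (simp add: t_def power2_eq_square)
    finally have "(inner (x - p) r)\<^sup>2 / inner r r \<le> 0" using pd by linarith
    then have "(inner (x - p) r)\<^sup>2 \<le> 0" using rr by (simp add: divide_le_0_iff)
    then show ?thesis by simp
  qed simp
  with pS show ?thesis by blast
qed

text \<open>The kernel of \<open>L\<close> is a closed subspace of codimension one. Projecting a
  point \<open>x0\<close> outside it leaves a residual \<open>w\<close> orthogonal to the kernel,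
  and \<open>L\<close> must be a multiple of the inner product with \<open>w\<close>.\<close>

lemma riesz_representation:
  fixes L :: "'h::{real_inner,complete_space} \<Rightarrow> real"
  assumes L: "bounded_linear L"
  shows "\<exists>v. \<forall>x. L x = inner v x"
proof (cases "\<forall>x. L x = 0")
  case True
  then show ?thesis by (intro exI[of _ 0]) simp
next
  case False
  then obtain x0 where x0: "L x0 \<noteq> 0" by blast
  interpret L: bounded_linear L by fact
  define S where "S = {x. L x = 0}"
  have "subspace S" by (auto simp: S_def subspace_def L.zero L.add L.scaleR)
  moreover have "closed S"
    unfolding S_def by (intro closed_Collect_eq continuous_intros L.continuous_on)
  ultimately obtain p where p: "p \<in> S" "\<forall>s\<in>S. inner (x0 - p) s = 0"
    using hilbert_projection by blast
  define w where "w = x0 - p"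
  have Lw: "L w \<noteq> 0" using x0 p by (simp add: w_def L.diff S_def)
  have w0: "inner w w > 0" using Lw by (auto simp: L.zero)
  have "L x = inner ((L w / inner w w) *\<^sub>R w) x" for x
  proof -
    have "x - (L x / L w) *\<^sub>R w \<in> S" using Lw by (simp add: S_def L.diff L.scaleR)
    then have "inner w (x - (L x / L w) *\<^sub>R w) = 0" using p by (simp add: w_def)
    then have "inner w x = (L x / L w) * inner w w" by (simp add: inner_diff_right)
    then show ?thesis using Lw w0 by simp
  qed
  then show ?thesis by blast
qed

text \<open>Without symmetry of \<open>B\<close> the Riesz theorem cannot be applied to
  \<open>B\<close> as an inner product. It is applied to each \<open>B u\<close> instead: the set
  \<open>S\<close> of all representing vectors is a closed subspace, and coercivity leaves no
  nonzero vector orthogonal to it.\<close>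

lemma lax_milgram:
  fixes B :: "'h::{real_inner,complete_space} \<Rightarrow> 'h \<Rightarrow> real"
  assumes B: "bounded_bilinear B" and c: "c > 0" "\<And>x. c * (norm x)\<^sup>2 \<le> B x x"
    and L: "bounded_linear L"
  shows "\<exists>u. \<forall>h. B u h = L h"
proof -
  interpret B: bounded_bilinear B by fact
  define S where "S = {v. \<exists>u. \<forall>h. B u h = inner v h}"
  have sub: "subspace S"
    unfolding subspace_def
  proof (intro conjI ballI allI)
    show "0 \<in> S" unfolding S_def by (auto intro!: exI[of _ 0] simp: B.zero_left)
    fix v w assume "v \<in> S" "w \<in> S"
    then obtain a b where "\<forall>h. B a h = inner v h" "\<forall>h. B b h = inner w h" by (auto simp: S_def)
    then show "v + w \<in> S" by (auto simp: S_def B.add_left inner_add_left intro!: exI[of _ "a + b"])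
  next
    fix r v assume "v \<in> S"
    then obtain a where "\<forall>h. B a h = inner v h" by (auto simp: S_def)
    then show "r *\<^sub>R v \<in> S" by (auto simp: S_def B.scaleR_left intro!: exI[of _ "r *\<^sub>R a"])
  qed
  have "closed S"
    unfolding closed_sequential_limits
  proof (intro allI impI, elim conjE)
    fix v :: "nat \<Rightarrow> 'h" and l assume v: "\<forall>n. v n \<in> S" and lim: "v \<longlonglongrightarrow> l"
    from v obtain u where u: "\<And>n h. B (u n) h = inner (v n) h" unfolding S_def by (auto; metis)
    \<comment> \<open>Coercivity and Cauchy-Schwarz make the solution depend on the right-hand side
      in a Lipschitz way. Convergence of \<open>v\<close> therefore forces \<open>u\<close> to be
      Cauchy, which gives closedness of \<open>S\<close>.\<close>
    have bd: "c * norm (u m - u n) \<le> norm (v m - v n)" for m n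
    proof -
      have "c * (norm (u m - u n))\<^sup>2 \<le> B (u m - u n) (u m - u n)" by (rule c)
      also have "\<dots> = inner (v m - v n) (u m - u n)" by (simp add: B.diff_left u inner_diff_left)
      also have "\<dots> \<le> norm (v m - v n) * norm (u m - u n)" by (rule norm_cauchy_schwarz)
      finally show ?thesis by (cases "norm (u m - u n) = 0") (auto simp: power2_eq_square)
    qed
    have "Cauchy u"
    proof (rule metric_CauchyI)
      fix e :: real assume "e > 0"
      then have ce: "c * e > 0" using c by simp
      from LIMSEQ_imp_Cauchy[OF lim] obtain M where
        M: "\<And>m n. m \<ge> M \<Longrightarrow> n \<ge> M \<Longrightarrow> dist (v m) (v n) < c * e" using metric_CauchyD[OF _ ce] by blast
      show "\<exists>M. \<forall>m\<ge>M. \<forall>n\<ge>M. dist (u m) (u n) < e"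
      proof (intro exI allI impI)
        fix m n assume "m \<ge> M" "n \<ge> M"
        from M[OF this] bd[of m n] have "c * norm (u m - u n) < c * e" by (simp add: dist_norm)
        then show "dist (u m) (u n) < e" using c by (simp add: dist_norm)
      qed
    qed
    then obtain a where a: "u \<longlonglongrightarrow> a" using Cauchy_convergent_iff convergent_def by blast
    have "B a h = inner l h" for h
    proof (rule LIMSEQ_unique)
      show "(\<lambda>n. B (u n) h) \<longlonglongrightarrow> B a h" by (intro B.tendsto a tendsto_const)
      show "(\<lambda>n. B (u n) h) \<longlonglongrightarrow> inner l h" unfolding u by (intro tendsto_intros lim)
    qed
    then show "l \<in> S" by (auto simp: S_def)
  qed
  note proj = hilbert_projection[OF sub this]
  from riesz_representation[OF L] obtain v where v: "\<And>x. L x = inner v x" by blast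
  from proj[of v] obtain p where p: "p \<in> S" "\<And>s. s \<in> S \<Longrightarrow> inner (v - p) s = 0" by blast
  define w where "w = v - p"
  \<comment> \<open>The vector representing \<open>B w\<close> is itself in \<open>S\<close>, hence
    orthogonal to \<open>w\<close>; this says \<open>B w w = 0\<close>, and coercivity gives
    \<open>w = 0\<close>.\<close>
  from riesz_representation[OF B.bounded_linear_right[of w]] obtain q
    where q: "\<And>h. B w h = inner q h" by blast
  then have "q \<in> S" by (auto simp: S_def)
  then have "inner w q = 0" using p by (simp add: w_def)
  then have "B w w = 0" using q[of w] by (simp add: inner_commute)
  with c(2)[of w] c(1) have "w = 0" by (simp add: mult_le_0_iff)
  then have "v \<in> S" using p by (simp add: w_def)
  then show ?thesis by (auto simp: S_def v)
qed

text \<open>The domain of \<open>R\<close> is a closed subspace, because along a convergent sequence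
  of arguments the isometry makes the partners Cauchy. A relation is used instead of a function so
  that the lemma applies to the converse relation as well, where it yields surjectivity.\<close>

lemma isometric_relation_total:
  fixes R :: "'h::{real_inner,complete_space} \<Rightarrow> 'k::{real_inner,complete_space} \<Rightarrow> bool"
  assumes zero: "R 0 0" and add: "\<And>x y x' y'. R x y \<Longrightarrow> R x' y' \<Longrightarrow> R (x + x') (y + y')"
    and scale: "\<And>r x y. R x y \<Longrightarrow> R (r *\<^sub>R x) (r *\<^sub>R y)"
    and iso: "\<And>x y. R x y \<Longrightarrow> norm x = norm y"
    and closed: "\<And>X Y x y. (\<And>n. R (X n) (Y n)) \<Longrightarrow> X \<longlonglongrightarrow> x \<Longrightarrow> Y \<longlonglongrightarrow> y \<Longrightarrow> R x y"
    and R: "\<And>i. R (\<phi> i) (\<psi> i)" and total: "\<And>x. (\<And>i. inner x (\<phi> i) = 0) \<Longrightarrow> x = 0"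
  shows "\<exists>y. R x y"
proof -
  define S where "S = {x. \<exists>y. R x y}"
  have sub: "subspace S" unfolding subspace_def S_def using zero add scale by blast
  have "closed S"
    unfolding closed_sequential_limits
  proof (intro allI impI, elim conjE)
    fix X :: "nat \<Rightarrow> 'h" and l assume X: "\<forall>n. X n \<in> S" and lim: "X \<longlonglongrightarrow> l"
    from X obtain Y where Y: "\<And>n. R (X n) (Y n)" unfolding S_def by (auto; metis)
    have "norm (Y m - Y n) = norm (X m - X n)" for m n
      using iso[OF add[OF Y[of m] scale[OF Y[of n], of "-1"]]] by simp
    with LIMSEQ_imp_Cauchy[OF lim] have "Cauchy Y" by (simp add: Cauchy_def dist_norm)
    then obtain a where a: "Y \<longlonglongrightarrow> a" using Cauchy_convergent_iff convergent_def by blast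
    from closed[OF Y lim a] show "l \<in> S" by (auto simp: S_def)
  qed
  from hilbert_projection[OF sub this, of x] obtain p
    where p: "p \<in> S" "\<And>s. s \<in> S \<Longrightarrow> inner (x - p) s = 0" by blast
  have "x - p = 0" by (rule total, rule p(2)) (use R in \<open>auto simp: S_def\<close>)
  with p(1) show ?thesis by (simp add: S_def)
qed

text \<open>The graph of the isometry is built directly as the closed span \<open>W\<close> of the
  pairs in the product space. Equality of the Gram matrices says that inner products of first and of
  second components agree on the span, so neither well-definedness on linear combinations nor a
  separate extension by continuity has to be treated.\<close>

lemma isometry_from_total_families:
  fixes \<phi> :: "'i \<Rightarrow> 'h::{real_inner,complete_space}" and \<psi> :: "'i \<Rightarrow> 'k::{real_inner,complete_space}"
  assumes gram: "\<And>i j. inner (\<phi> i) (\<phi> j) = inner (\<psi> i) (\<psi> j)"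
    and tot1: "\<And>x. (\<And>i. inner x (\<phi> i) = 0) \<Longrightarrow> x = 0"
    and tot2: "\<And>x. (\<And>i. inner x (\<psi> i) = 0) \<Longrightarrow> x = 0"
  shows "\<exists>U. linear U \<and> (\<forall>x. norm (U x) = norm x) \<and> surj U \<and> (\<forall>i. U (\<phi> i) = \<psi> i)"
proof -
  define V where "V = span (range (\<lambda>i. (\<phi> i, \<psi> i)))"
  define W where "W = closure V"
  have inn: "inner (fst p) (fst q) = inner (snd p) (snd q)" if "p \<in> V" "q \<in> V" for p q
  proof -
    have 1: "inner (fst p) (\<phi> j) = inner (snd p) (\<psi> j)" for j
      using \<open>p \<in> V\<close> unfolding V_def
      by (induction rule: span_induct_alt) (auto simp: inner_add_left gram)
    show ?thesis
      using \<open>q \<in> V\<close> unfolding V_def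
      by (induction rule: span_induct_alt) (auto simp: inner_add_right 1)
  qed
  have sV: "subspace V" by (simp add: V_def)
  have WX: "p \<in> W \<longleftrightarrow> (\<exists>X. (\<forall>n. X n \<in> V) \<and> X \<longlonglongrightarrow> p)" for p
    by (simp add: W_def closure_sequential)
  define R where "R = (\<lambda>x y. (x, y) \<in> W)"
  have Vcl: "V \<subseteq> W" by (simp add: W_def closure_subset)
  have zero: "R 0 0" using subspace_0[OF sV] Vcl by (auto simp: R_def zero_prod_def)
  have add: "R (x + x') (y + y')" if "R x y" "R x' y'" for x y x' y'
  proof -
    from that obtain X X' where "\<forall>n. X n \<in> V" "X \<longlonglongrightarrow> (x, y)" "\<forall>n. X' n \<in> V" "X' \<longlonglongrightarrow> (x', y')"
      unfolding R_def WX by blast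
    then have "(\<forall>n. X n + X' n \<in> V) \<and> (\<lambda>n. X n + X' n) \<longlonglongrightarrow> (x, y) + (x', y')"
      using sV by (auto intro: subspace_add simp del: add_Pair intro!: tendsto_add)
    then show ?thesis unfolding R_def WX by (auto intro!: exI[of _ "\<lambda>n. X n + X' n"])
  qed
  have scale: "R (r *\<^sub>R x) (r *\<^sub>R y)" if "R x y" for r x y
  proof -
    from that obtain X where "\<forall>n. X n \<in> V" "X \<longlonglongrightarrow> (x, y)"
      unfolding R_def WX by blast
    then have "(\<forall>n. r *\<^sub>R X n \<in> V) \<and> (\<lambda>n. r *\<^sub>R X n) \<longlonglongrightarrow> r *\<^sub>R (x, y)"
      using sV by (auto intro: subspace_scale simp del: scaleR_Pair intro!: tendsto_scaleR)
    then show ?thesis unfolding R_def WX by (auto intro!: exI[of _ "\<lambda>n. r *\<^sub>R X n"])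
  qed
  have "norm (fst p) = norm (snd p)" if "p \<in> V" for p
    using inn[OF that that] by (simp add: norm_eq_sqrt_inner)
  then have "W \<subseteq> {p. norm (fst p) = norm (snd p)}"
    unfolding W_def
    by (intro closure_minimal closed_Collect_eq continuous_intros) auto
  then have iso: "norm x = norm y" if "R x y" for x y using that by (auto simp: R_def)
  have closed: "R x y" if "\<And>n. R (X n) (Y n)" "X \<longlonglongrightarrow> x" "Y \<longlonglongrightarrow> y" for X Y x y
    unfolding R_def
    by (rule closed_sequentially[of W "\<lambda>n. (X n, Y n)"])
      (use that in \<open>auto simp: W_def R_def intro: tendsto_Pair\<close>)
  have base: "R (\<phi> i) (\<psi> i)" for i
    using Vcl span_superset[of "range (\<lambda>i. (\<phi> i, \<psi> i))"] by (auto simp: R_def V_def)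
  have ex: "\<exists>y. R x y" for x
    by (rule isometric_relation_total[where R=R and \<phi>=\<phi> and \<psi>=\<psi>]) (fact zero add scale iso closed base tot1)+
  have ex': "\<exists>x. R x y" for y
  proof (rule isometric_relation_total[where R="\<lambda>x y. R y x" and \<phi>=\<psi> and \<psi>=\<phi>])
    show "norm u = norm v" if "R v u" for u v using iso[OF that] by simp
    show "R v u" if "\<And>n. R (Y n) (X n)" "X \<longlonglongrightarrow> u" "Y \<longlonglongrightarrow> v" for X Y u v
      using closed[OF that(1) that(3,2)] .
  qed (fact zero add scale base tot2)+
  \<comment> \<open>The difference of the two pairs has first component 0 and belongs to
    \<open>R\<close>, so isometry annihilates its second component.\<close>
  have unique: "y = y'" if "R x y" "R x y'" for x y y'
    using iso[OF add[OF that(1) scale[OF that(2), of "-1"]]] by simp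
  obtain U where U: "\<And>x. R x (U x)" using ex by metis
  have "linear U"
    by (rule linearI) (use U add scale unique in blast)+
  moreover have "surj U" using ex' U unique by (metis surjI)
  ultimately show ?thesis using iso[OF U] unique[OF U base] by auto
qed

section \<open>Representatives of square-integrable functions\<close>

lemma square_integrable_rep [simp]: "square_integrable (rep_l2 f)"
  using Quotient3_rep_reflp[OF Quotient3_l2, of f] by (simp add: l2_rel_def)

lemma rep_l2_measurable [measurable]: "rep_l2 f \<in> borel_measurable borel"
  using square_integrable_rep[of f] by (simp add: square_integrable_def)

lemma square_integrable_measurable: "square_integrable f \<Longrightarrow> f \<in> borel_measurable borel"
  by (simp add: square_integrable_def)

lemma rep_abs_l2: "square_integrable f \<Longrightarrow> AE x in lborel. rep_l2 (abs_l2 f) x = f x"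
  using rep_abs_rsp_left[OF Quotient3_l2, of f f] by (simp add: l2_rel_def)

lemma abs_l2_cong:
  "square_integrable f \<Longrightarrow> square_integrable g \<Longrightarrow> AE x in lborel. f x = g x \<Longrightarrow> abs_l2 f = abs_l2 g"
  using Quotient3_rel_abs[OF Quotient3_l2, of f g] by (simp add: l2_rel_def)

lemma abs_rep_l2 [simp]: "abs_l2 (rep_l2 f) = f"
  by (rule Quotient3_abs_rep[OF Quotient3_l2])

lemma l2_eq_iff: "f = g \<longleftrightarrow> (AE x in lborel. rep_l2 f x = rep_l2 g x)"
  using abs_l2_cong[of "rep_l2 f" "rep_l2 g"] by auto

lemma abs_l2_eqI:
  "square_integrable f \<Longrightarrow> AE x in lborel. f x = rep_l2 g x \<Longrightarrow> abs_l2 f = g"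
  using abs_l2_cong[of f "rep_l2 g"] by simp

lemma abs_l2_add:
  "square_integrable f \<Longrightarrow> square_integrable g \<Longrightarrow> abs_l2 (\<lambda>x. f x + g x) = abs_l2 f + abs_l2 g"
  by (subst plus_l2.abs_eq) (auto simp: l2_rel_def)

lemma abs_l2_cscale: "square_integrable f \<Longrightarrow> abs_l2 (\<lambda>x. c * f x) = cscale c (abs_l2 f)"
  by (subst cscale.abs_eq) (auto simp: l2_rel_def)

lemma abs_l2_diff:
  assumes "square_integrable f" "square_integrable g"
  shows "abs_l2 (\<lambda>x. f x - g x) = abs_l2 f - abs_l2 g"
  using abs_l2_add[OF assms(1) square_integrable_scale[OF assms(2), of "-1"]]
    abs_l2_cscale[OF assms(2), of "-1"] by (simp add: minus_l2_def)

lemma abs_l2_zero: "abs_l2 (\<lambda>_. 0) = 0"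
  by (simp add: zero_l2_def)

lemma square_integrable_diff:
  "square_integrable f \<Longrightarrow> square_integrable g \<Longrightarrow> square_integrable (\<lambda>x. f x - g x)"
  using square_integrable_add[OF _ square_integrable_scale, of f g "-1"] by simp

lemma square_integrable_sum:
  "(\<And>i. i \<in> I \<Longrightarrow> square_integrable (f i)) \<Longrightarrow> square_integrable (\<lambda>x. \<Sum>i\<in>I. f i x)"
  by (induction I rule: infinite_finite_induct)
    (auto simp: square_integrable_zero square_integrable_add)

lemma abs_l2_sum:
  "(\<And>i. i \<in> I \<Longrightarrow> square_integrable (f i)) \<Longrightarrow> abs_l2 (\<lambda>x. \<Sum>i\<in>I. f i x) = (\<Sum>i\<in>I. abs_l2 (f i))"
  by (induction I rule: infinite_finite_induct)
    (auto simp: abs_l2_zero abs_l2_add square_integrable_sum)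

lemma rep_l2_add: "AE x in lborel. rep_l2 (f + g) x = rep_l2 f x + rep_l2 g x"
  using rep_abs_l2[OF square_integrable_add[OF square_integrable_rep[of f] square_integrable_rep[of g]]]
  by (simp add: abs_l2_add)

lemma rep_l2_diff: "AE x in lborel. rep_l2 (f - g) x = rep_l2 f x - rep_l2 g x"
  using rep_abs_l2[OF square_integrable_diff[OF square_integrable_rep[of f] square_integrable_rep[of g]]]
  by (simp add: abs_l2_diff)

lemma rep_l2_cscale: "AE x in lborel. rep_l2 (cscale c f) x = c * rep_l2 f x"
  using rep_abs_l2[OF square_integrable_scale[OF square_integrable_rep[of f], of c]]
  by (simp add: abs_l2_cscale)

lemma cinner_rep: "cinner f g = (LINT x|lborel. rep_l2 f x * cnj (rep_l2 g x))"
  by (simp add: cinner_def map_fun_def)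

lemma cinner_abs:
  "square_integrable f \<Longrightarrow> square_integrable g \<Longrightarrow>
    cinner (abs_l2 f) (abs_l2 g) = (LINT x|lborel. f x * cnj (g x))"
  by (subst cinner.abs_eq) (auto simp: l2_rel_def)

lemma cinner_rep_abs:
  "square_integrable g \<Longrightarrow> cinner f (abs_l2 g) = (LINT x|lborel. rep_l2 f x * cnj (g x))"
  using cinner_abs[of "rep_l2 f" g] by simp

lemma cinner_abs_rep:
  "square_integrable g \<Longrightarrow> cinner (abs_l2 g) f = (LINT x|lborel. g x * cnj (rep_l2 f x))"
  using cinner_abs[of g "rep_l2 f"] by simp

lemma cinner_add_left: "cinner (f + g) h = cinner f h + cinner g h"
  by transfer (simp add: l2_rel_def distrib_right square_integrable_mult)

lemma cinner_add_right: "cinner h (f + g) = cinner h f + cinner h g"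
  by transfer (simp add: l2_rel_def distrib_left square_integrable_mult)

lemma cinner_cscale_left: "cinner (cscale c f) g = c * cinner f g"
  by transfer (simp add: mult.assoc)

lemma cinner_cscale_right: "cinner f (cscale c g) = cnj c * cinner f g"
  by transfer (simp add: mult.left_commute[of _ "cnj _"])

lemma cinner_diff_left: "cinner (f - g) h = cinner f h - cinner g h"
  by (simp add: minus_l2_def cinner_add_left cinner_cscale_left)

lemma cinner_diff_right: "cinner h (f - g) = cinner h f - cinner h g"
  by (simp add: minus_l2_def cinner_add_right cinner_cscale_right)

lemma Re_cinner: "Re (cinner f g) = inner f g"
  by (simp add: inner_l2_def)

lemma Im_cinner: "Im (cinner f g) = inner f (cscale \<i> g)"
  by (simp add: inner_l2_def cinner_cscale_right)

lemma norm_abs_l2: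
  assumes "square_integrable f"
  shows "(norm (abs_l2 f))\<^sup>2 = (LINT x|lborel. (cmod (f x))\<^sup>2)"
proof -
  have "(norm (abs_l2 f))\<^sup>2 = Re (cinner (abs_l2 f) (abs_l2 f))"
    by (simp add: power2_norm_eq_inner inner_l2_def)
  also have "\<dots> = Re (LINT x|lborel. complex_of_real ((cmod (f x))\<^sup>2))"
    using assms by (simp add: cinner_abs complex_norm_square del: of_real_power)
  finally show ?thesis by (simp del: of_real_power)
qed

lemma norm_l2_rep: "(norm f)\<^sup>2 = (LINT x|lborel. (cmod (rep_l2 f x))\<^sup>2)"
  using norm_abs_l2[of "rep_l2 f"] by simp

lemma cinner_self: "cinner f f = of_real ((norm f)\<^sup>2)"
proof -
  have "cinner f f = (LINT x|lborel. complex_of_real ((cmod (rep_l2 f x))\<^sup>2))"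
    by (simp add: cinner_rep complex_norm_square del: of_real_power)
  then show ?thesis by (simp add: norm_l2_rep del: of_real_power)
qed

lemma norm_cscale: "norm (cscale c f) = cmod c * norm f"
proof -
  have "complex_of_real ((norm (cscale c f))\<^sup>2) = of_real ((cmod c * norm f)\<^sup>2)"
    unfolding cinner_self[symmetric]
    unfolding cinner_cscale_left cinner_cscale_right
    by (simp only: cinner_self power_mult_distrib of_real_mult complex_norm_square mult_ac)
  then show ?thesis by (simp only: of_real_eq_iff power2_eq_iff_nonneg norm_ge_zero mult_nonneg_nonneg)
qed

text \<open>A unimodular factor \<open>c\<close> rotates the complex inner product onto the positive
  real axis, where the real Cauchy-Schwarz inequality applies.\<close>

lemma cmod_cinner_le: "cmod (cinner f g) \<le> norm f * norm g"
proof (cases "cinner f g = 0")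
  case False
  define c where "c = cnj (sgn (cinner f g))"
  have c: "cmod c = 1" using False by (simp add: c_def norm_sgn)
  have "cnj z * z = complex_of_real (cmod z) * complex_of_real (cmod z)" for z
    using complex_norm_square[of z] by (simp add: power2_eq_square mult.commute)
  then have "c * cinner f g = of_real (cmod (cinner f g))"
    using False by (simp add: c_def sgn_div_norm scaleR_conv_of_real divide_simps)
  then have "cmod (cinner f g) = inner (cscale c f) g"
    by (simp add: inner_l2_def cinner_cscale_left)
  also have "\<dots> \<le> norm (cscale c f) * norm g" by (rule norm_cauchy_schwarz)
  finally show ?thesis by (simp add: norm_cscale c)
qed simp

lemma cscale_cscale: "cscale c (cscale d f) = cscale (c * d) f"
  by transfer (auto simp: l2_rel_def mult.assoc intro!: square_integrable_scale)

lemma cscale_of_real: "cscale (of_real r) f = r *\<^sub>R f"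
  by (simp add: scaleR_l2_def)

lemma cscale_1 [simp]: "cscale 1 f = f"
  using cscale_of_real[of 1 f] by simp

section \<open>Dominated convergence and completeness in the space of square-integrable
  functions\<close>

lemma l2_dominated_convergence:
  assumes f: "\<And>n. square_integrable (f n)" and F: "F \<in> borel_measurable borel"
    and lim: "AE x in lborel. (\<lambda>n. f n x) \<longlonglongrightarrow> F x"
    and dom: "\<And>n. AE x in lborel. cmod (f n x) \<le> H x"
    and H: "integrable lborel (\<lambda>x. (H x)\<^sup>2)"
  shows "square_integrable F" "(\<lambda>n. abs_l2 (f n)) \<longlonglongrightarrow> abs_l2 F"
proof -
  have dom': "AE x in lborel. \<forall>n. cmod (f n x) \<le> H x"
    using dom by (simp add: AE_all_countable)
  have FH: "AE x in lborel. cmod (F x) \<le> H x"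
    using lim dom'
  proof eventually_elim
    case (elim x)
    then show ?case by (intro LIMSEQ_le_const2[OF tendsto_norm[OF elim(1)]]) auto
  qed
  have [measurable]: "f n \<in> borel_measurable borel" for n
    using f by (rule square_integrable_measurable)
  note F [measurable]
  show sF: "square_integrable F"
    unfolding square_integrable_def
  proof
    show "integrable lborel (\<lambda>x. (cmod (F x))\<^sup>2)"
      by (rule Bochner_Integration.integrable_bound[OF H])
        (use FH in \<open>auto intro!: power_mono elim!: eventually_mono\<close>)
  qed simp
  have "(\<lambda>n. LINT x|lborel. (cmod (f n x - F x))\<^sup>2) \<longlonglongrightarrow> integral\<^sup>L lborel (\<lambda>_::'a. 0::real)"
  proof (rule Bochner_Integration.integral_dominated_convergence)
    show "integrable lborel (\<lambda>x. 4 * (H x)\<^sup>2)" using H by simp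
    show "AE x in lborel. (\<lambda>n. (cmod (f n x - F x))\<^sup>2) \<longlonglongrightarrow> 0"
      using lim
    proof eventually_elim
      case (elim x)
      have "(\<lambda>n. (cmod (f n x - F x))\<^sup>2) \<longlonglongrightarrow> (cmod (F x - F x))\<^sup>2"
        by (intro tendsto_intros elim)
      then show ?case by simp
    qed
    fix n
    show "AE x in lborel. norm ((cmod (f n x - F x))\<^sup>2) \<le> 4 * (H x)\<^sup>2"
      using dom[of n] FH
    proof eventually_elim
      case (elim x)
      have "cmod (f n x - F x) \<le> 2 * H x" using norm_triangle_ineq4[of "f n x" "F x"] elim by linarith
      then have "(cmod (f n x - F x))\<^sup>2 \<le> (2 * H x)\<^sup>2" by (intro power_mono) auto
      then show ?case by (simp add: power_mult_distrib)
    qed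
  qed simp_all
  also have "(\<lambda>n. LINT x|lborel. (cmod (f n x - F x))\<^sup>2) = (\<lambda>n. (norm (abs_l2 (f n) - abs_l2 F))\<^sup>2)"
    using norm_abs_l2[OF square_integrable_diff[OF f sF]] by (simp add: abs_l2_diff f sF)
  finally have "(\<lambda>n. sqrt ((norm (abs_l2 (f n) - abs_l2 F))\<^sup>2)) \<longlonglongrightarrow> sqrt 0"
    by (intro tendsto_real_sqrt) simp
  then have "(\<lambda>n. norm (abs_l2 (f n) - abs_l2 F)) \<longlonglongrightarrow> 0" by simp
  then show "(\<lambda>n. abs_l2 (f n)) \<longlonglongrightarrow> abs_l2 F"
    by (subst Lim_null) (simp add: tendsto_norm_zero_iff)
qed

text \<open>The Riesz-Fischer argument: monotone convergence shows that the pointwise sum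
  \<open>H\<close> of the moduli is square-integrable, and \<open>H\<close> then serves as the
  majorant for the partial sums of the series itself.\<close>

lemma l2_summable_series:
  fixes a :: "nat \<Rightarrow> 'a::euclidean_space l2"
  assumes "\<And>N. (\<Sum>k<N. norm (a k)) \<le> C"
  shows "\<exists>s. (\<lambda>N. \<Sum>k<N. a k) \<longlonglongrightarrow> s"
proof -
  define g where "g k = rep_l2 (a k)" for k
  have g [measurable]: "g k \<in> borel_measurable borel" for k by (simp add: g_def)
  have sg: "square_integrable (g k)" for k by (simp add: g_def)
  define G where "G N x = (\<Sum>k<N. cmod (g k x))" for N x
  have [measurable]: "G N \<in> borel_measurable borel" for N unfolding G_def by measurable
  have sq: "square_integrable (\<lambda>x. complex_of_real (cmod (g k x)))" for k
    using sg[of k] by (simp add: square_integrable_def)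
  have sG: "square_integrable (\<lambda>x. complex_of_real (G N x))" for N
    unfolding G_def of_real_sum by (intro square_integrable_sum sq)
  have nn: "(\<integral>\<^sup>+x. ennreal ((G N x)\<^sup>2) \<partial>lborel) \<le> ennreal (C\<^sup>2)" for N
  proof -
    have "norm (abs_l2 (\<lambda>x. complex_of_real (G N x))) = norm (\<Sum>k<N. abs_l2 (\<lambda>x. complex_of_real (cmod (g k x))))"
      unfolding G_def of_real_sum by (subst abs_l2_sum) (auto intro: sq)
    also have "\<dots> \<le> (\<Sum>k<N. norm (abs_l2 (\<lambda>x. complex_of_real (cmod (g k x)))))" by (rule norm_sum)
    also have "\<dots> = (\<Sum>k<N. norm (a k))"
    proof (rule sum.cong)
      fix k
      have "(norm (abs_l2 (\<lambda>x. complex_of_real (cmod (g k x)))))\<^sup>2 = (norm (a k))\<^sup>2"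
        by (subst norm_abs_l2[OF sq]) (simp add: norm_l2_rep g_def)
      then show "norm (abs_l2 (\<lambda>x. complex_of_real (cmod (g k x)))) = norm (a k)" by simp
    qed simp
    also have "\<dots> \<le> C" by (rule assms)
    finally have "(norm (abs_l2 (\<lambda>x. complex_of_real (G N x))))\<^sup>2 \<le> C\<^sup>2" by (intro power_mono) auto
    then have "(LINT x|lborel. (G N x)\<^sup>2) \<le> C\<^sup>2" by (simp add: norm_abs_l2 sG)
    moreover have "integrable lborel (\<lambda>x. (G N x)\<^sup>2)" using sG[of N] by (simp add: square_integrable_def)
    ultimately show ?thesis by (simp add: nn_integral_eq_integral ennreal_leI)
  qed
  have mono: "G N x \<le> G M x" if "N \<le> M" for N M x
    unfolding G_def using that by (intro sum_mono2) auto
  have G0: "0 \<le> G N x" for N x by (simp add: G_def sum_nonneg)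
  \<comment> \<open>The supremum is taken in the extended nonnegative reals, where it exists at
    every point; only afterwards is it seen to be finite almost everywhere.\<close>
  define T where "T x = (SUP N. ennreal ((G N x)\<^sup>2))" for x
  have T [measurable]: "T \<in> borel_measurable borel" unfolding T_def by measurable
  have "(\<integral>\<^sup>+x. T x \<partial>lborel) = (SUP N. \<integral>\<^sup>+x. ennreal ((G N x)\<^sup>2) \<partial>lborel)"
    unfolding T_def
    by (rule nn_integral_monotone_convergence_SUP)
      (auto simp: incseq_def le_fun_def intro!: ennreal_leI power_mono mono G0)
  also have "\<dots> \<le> ennreal (C\<^sup>2)" by (intro SUP_least nn)
  finally have Tfin: "(\<integral>\<^sup>+x. T x \<partial>lborel) \<le> ennreal (C\<^sup>2)" .
  then have "AE x in lborel. T x \<noteq> \<infinity>"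
    by (intro nn_integral_PInf_AE) (auto simp: top_unique)
  then have sm: "AE x in lborel. summable (\<lambda>k. cmod (g k x)) \<and> ennreal ((\<Sum>k. cmod (g k x))\<^sup>2) \<le> T x"
  proof eventually_elim
    case (elim x)
    then obtain B where B: "T x = ennreal B" "0 \<le> B" by (cases "T x") auto
    have le: "(G N x)\<^sup>2 \<le> B" for N
    proof -
      have "ennreal ((G N x)\<^sup>2) \<le> T x" unfolding T_def by (rule SUP_upper) simp
      then show ?thesis using B by simp
    qed
    have "G N x \<le> sqrt B" for N using le[of N] by (simp add: real_le_rsqrt)
    then have s: "summable (\<lambda>k. cmod (g k x))"
      by (intro summableI_nonneg_bounded[where x="sqrt B"]) (auto simp: G_def)
    have "(\<lambda>N. (G N x)\<^sup>2) \<longlonglongrightarrow> (\<Sum>k. cmod (g k x))\<^sup>2"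
      unfolding G_def by (intro tendsto_intros summable_LIMSEQ s)
    then have "(\<Sum>k. cmod (g k x))\<^sup>2 \<le> B" by (rule LIMSEQ_le_const2) (use le in auto)
    then show ?case using s B by (simp add: ennreal_leI)
  qed
  define H where "H x = (\<Sum>k. cmod (g k x))" for x
  have [measurable]: "H \<in> borel_measurable borel" unfolding H_def by measurable
  have "integrable lborel (\<lambda>x. (H x)\<^sup>2)"
  proof (rule integrableI_bounded)
    have "(\<integral>\<^sup>+x. ennreal (norm ((H x)\<^sup>2)) \<partial>lborel) \<le> (\<integral>\<^sup>+x. T x \<partial>lborel)"
      by (rule nn_integral_mono_AE) (use sm in \<open>auto simp: H_def elim!: eventually_mono\<close>)
    also have "\<dots> < \<infinity>" using Tfin by (rule le_less_trans) simp
    finally show "(\<integral>\<^sup>+x. ennreal (norm ((H x)\<^sup>2)) \<partial>lborel) < \<infinity>" .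
  qed measurable
  moreover have "AE x in lborel. (\<lambda>N. \<Sum>k<N. g k x) \<longlonglongrightarrow> (\<Sum>k. g k x)"
    using sm by eventually_elim (rule summable_LIMSEQ[OF summable_norm_cancel], simp)
  moreover have "AE x in lborel. cmod (\<Sum>k<N. g k x) \<le> H x" for N
    using sm
  proof eventually_elim
    case (elim x)
    have "cmod (\<Sum>k<N. g k x) \<le> (\<Sum>k<N. cmod (g k x))" by (rule norm_sum)
    also have "\<dots> \<le> H x" unfolding H_def by (rule sum_le_suminf) (use elim in auto)
    finally show ?case .
  qed
  ultimately have "(\<lambda>N. abs_l2 (\<lambda>x. \<Sum>k<N. g k x)) \<longlonglongrightarrow> abs_l2 (\<lambda>x. \<Sum>k. g k x)"
    by (intro l2_dominated_convergence(2)[where H=H] square_integrable_sum sg) auto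
  then show ?thesis by (auto simp: abs_l2_sum sg) (auto simp: g_def)
qed

instance l2 :: (euclidean_space) complete_space
proof
  fix X :: "nat \<Rightarrow> 'a l2" assume X: "Cauchy X"
  have "\<exists>M. \<forall>m\<ge>M. \<forall>n\<ge>M. dist (X m) (X n) < (1/2)^k" for k :: nat
    by (rule metric_CauchyD[OF X]) simp
  then obtain M where M: "\<And>k m n. m \<ge> M k \<Longrightarrow> n \<ge> M k \<Longrightarrow> dist (X m) (X n) < (1/2)^k" by metis
  \<comment> \<open>The sum puts \<open>r k\<close> above \<open>M k\<close>, the extra
    \<open>k\<close> makes \<open>r\<close> strictly increasing. As \<open>r (Suc k)\<close> also
    exceeds \<open>M k\<close>, consecutive members of the subsequence differ by less than a term of
    a geometric series.\<close>
  define r where "r k = (\<Sum>i\<le>k. M i) + k" for k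
  have rM: "r k \<ge> M k" "r (Suc k) \<ge> M k" "r k \<ge> k" for k
    using member_le_sum[of k "{..k}" M] by (auto simp: r_def)
  have smono: "strict_mono r" by (auto simp: strict_mono_Suc_iff r_def)
  define a where "a k = X (r (Suc k)) - X (r k)" for k
  have "(\<Sum>k<N. norm (a k)) \<le> 2" for N
  proof -
    have "(\<Sum>k<N. norm (a k)) \<le> (\<Sum>k<N. (1/2::real)^k)"
      using M[OF rM(2) rM(1)] by (intro sum_mono) (auto simp: a_def dist_norm intro: less_imp_le)
    also have "\<dots> \<le> (\<Sum>k. (1/2::real)^k)" by (intro sum_le_suminf) (auto intro: summable_geometric)
    also have "\<dots> = 2" by (subst suminf_geometric) auto
    finally show ?thesis .
  qed
  from l2_summable_series[OF this] obtain s where "(\<lambda>N. \<Sum>k<N. a k) \<longlonglongrightarrow> s" by blast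
  moreover have "(\<Sum>k<N. a k) = X (r N) - X (r 0)" for N
    unfolding a_def by (rule sum_lessThan_telescope)
  ultimately have "(\<lambda>N. X (r N) - X (r 0)) \<longlonglongrightarrow> s" by simp
  from tendsto_add[OF this tendsto_const[of "X (r 0)"]]
  have "(X \<circ> r) \<longlonglongrightarrow> s + X (r 0)" by (simp add: o_def)
  with Cauchy_converges_subseq[OF X smono] show "convergent X" by (auto simp: convergent_def)
qed

section \<open>Gaussians\<close>

lemma lborel_product_integral:
  fixes F :: "'a::euclidean_space \<Rightarrow> real \<Rightarrow> 'b::{real_normed_field,banach,second_countable_topology}"
  assumes F: "\<And>b. b \<in> Basis \<Longrightarrow> integrable lborel (F b)"
  shows "integrable lborel (\<lambda>x::'a. \<Prod>b\<in>Basis. F b (x \<bullet> b))"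
    and "(integral\<^sup>L lborel (\<lambda>x::'a. \<Prod>b\<in>Basis. F b (x \<bullet> b))) = (\<Prod>b\<in>Basis. LINT s|lborel. F b s)"
proof -
  interpret product_sigma_finite "\<lambda>_::'a. lborel :: real measure" by standard
  have [measurable]: "F b \<in> borel_measurable borel" if "b \<in> Basis" for b
    using F[OF that] by simp
  have m: "(\<lambda>x::'a. \<Prod>b\<in>Basis. F b (x \<bullet> b)) \<in> borel_measurable borel" by measurable
  have m': "(\<lambda>f. \<Sum>b\<in>Basis. f b *\<^sub>R b) \<in> (\<Pi>\<^sub>M b\<in>(Basis::'a set). lborel) \<rightarrow>\<^sub>M borel" by measurable
  have eq: "(\<Prod>b\<in>Basis. F b ((\<Sum>c\<in>Basis. f c *\<^sub>R c) \<bullet> b)) = (\<Prod>b\<in>Basis. F b (f b))" for f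
    by (intro prod.cong) auto
  show "integrable lborel (\<lambda>x::'a. \<Prod>b\<in>Basis. F b (x \<bullet> b))"
    by (subst lborel_eq, subst integrable_distr_eq[OF m' m])
      (use product_integrable_prod[of Basis F] F in \<open>simp add: eq\<close>)
  show "(integral\<^sup>L lborel (\<lambda>x::'a. \<Prod>b\<in>Basis. F b (x \<bullet> b))) = (\<Prod>b\<in>Basis. LINT s|lborel. F b s)"
    by (subst lborel_eq, subst integral_distr[OF m' m])
      (use product_integral_prod[of Basis F] F in \<open>simp add: eq\<close>)
qed

lemma lborel_integral_affine:
  fixes f :: "'a::euclidean_space \<Rightarrow> 'b::{banach,second_countable_topology}"
  assumes [measurable]: "f \<in> borel_measurable borel" and c: "c \<noteq> 0"
  shows "integrable lborel f \<longleftrightarrow> integrable lborel (\<lambda>x. f (t + c *\<^sub>R x))"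
    and "(LINT x|lborel. f x) = (\<bar>c\<bar> ^ DIM('a)) *\<^sub>R (LINT x|lborel. f (t + c *\<^sub>R x))"
proof -
  have L: "(lborel :: 'a measure) = density (distr lborel borel (\<lambda>x. t + c *\<^sub>R x)) (\<lambda>_. ennreal (\<bar>c\<bar> ^ DIM('a)))"
    using lborel_affine[OF c, of t] by (simp add: ennreal_power)
  show "integrable lborel f \<longleftrightarrow> integrable lborel (\<lambda>x. f (t + c *\<^sub>R x))"
  proof -
    have "integrable lborel f \<longleftrightarrow> integrable lborel (\<lambda>x. (\<bar>c\<bar> ^ DIM('a)) *\<^sub>R f (t + c *\<^sub>R x))"
      by (subst L) (simp add: integrable_density integrable_distr_eq)
    also have "\<dots> \<longleftrightarrow> integrable lborel (\<lambda>x. f (t + c *\<^sub>R x))"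
    proof
      assume "integrable lborel (\<lambda>x. (\<bar>c\<bar> ^ DIM('a)) *\<^sub>R f (t + c *\<^sub>R x))"
      then have "integrable lborel (\<lambda>x. (1 / \<bar>c\<bar> ^ DIM('a)) *\<^sub>R (\<bar>c\<bar> ^ DIM('a)) *\<^sub>R f (t + c *\<^sub>R x))"
        by (rule integrable_scaleR_right)
      then show "integrable lborel (\<lambda>x. f (t + c *\<^sub>R x))" using c by simp
    qed simp
    finally show ?thesis .
  qed
  show "(LINT x|lborel. f x) = (\<bar>c\<bar> ^ DIM('a)) *\<^sub>R (LINT x|lborel. f (t + c *\<^sub>R x))"
    using c by (subst L) (simp add: integral_density integral_distr)
qed

text \<open>The substitution that replaces \<open>s\<close> by \<open>a + s / sqrt t\<close> reduces
  the integral to the characteristic function of the standard normal distribution.\<close>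

lemma gaussian_integral_real:
  fixes t a \<eta> :: real
  assumes t: "t > 0"
  shows "integrable lborel (\<lambda>s. exp (of_real (- t * (s - a)\<^sup>2 / 2) + \<i> * of_real (\<eta> * s)) :: complex)"
    and "(LINT s|lborel. exp (of_real (- t * (s - a)\<^sup>2 / 2) + \<i> * of_real (\<eta> * s)) :: complex)
      = of_real (sqrt (2 * pi / t)) * exp (of_real (- \<eta>\<^sup>2 / (2 * t)) + \<i> * of_real (\<eta> * a))"
proof -
  define f :: "real \<Rightarrow> complex" where "f s = exp (of_real (- t * (s - a)\<^sup>2 / 2) + \<i> * of_real (\<eta> * s))" for s
  define r where "r = 1 / sqrt t"
  have r: "r \<noteq> 0" "r > 0" "r\<^sup>2 = 1 / t" using t by (auto simp: r_def power_divide)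
  define g :: "real \<Rightarrow> complex" where "g s = std_normal_density s *\<^sub>R iexp (\<eta> * r * s)" for s
  have gi: "integrable lborel g"
  proof (rule Bochner_Integration.integrable_bound)
    show "integrable lborel std_normal_density" by simp
    show "g \<in> borel_measurable lborel" unfolding g_def by measurable
    show "AE x in lborel. norm (g x) \<le> norm (std_normal_density x)"
      by (simp add: g_def)
  qed
  have "(LINT s|lborel. g s) = char std_normal_distribution (\<eta> * r)"
    unfolding char_def g_def by (subst integral_density) auto
  also have "\<dots> = of_real (exp (- (\<eta>\<^sup>2 / (2 * t))))"
    using r by (simp add: char_std_normal_distribution power_mult_distrib mult.commute)
  finally have gI: "(LINT s|lborel. g s) = of_real (exp (- (\<eta>\<^sup>2 / (2 * t))))" .
  have fg: "f (a + r * s) = (of_real (sqrt (2 * pi)) * iexp (\<eta> * a)) * g s" for s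
  proof -
    have "f (a + r * s) = of_real (exp (- s\<^sup>2 / 2)) * (iexp (\<eta> * a) * iexp (\<eta> * r * s))"
      using t by (simp add: f_def power_mult_distrib r exp_add[symmetric] exp_of_real[symmetric] algebra_simps
          del: exp_of_real)
    also have "exp (- s\<^sup>2 / 2) = sqrt (2 * pi) * std_normal_density s"
      by (simp add: std_normal_density_def)
    finally show ?thesis by (simp add: g_def scaleR_conv_of_real)
  qed
  have fi': "integrable lborel (\<lambda>s. f (a + r * s))"
    unfolding fg using gi by simp
  show "integrable lborel (\<lambda>s. exp (of_real (- t * (s - a)\<^sup>2 / 2) + \<i> * of_real (\<eta> * s)) :: complex)"
    unfolding f_def[symmetric] using fi' r lborel_integrable_real_affine_iff[of r f a] by simp
  have "(LINT s|lborel. f s) = \<bar>r\<bar> *\<^sub>R (LINT s|lborel. f (a + r * s))"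
    using r by (intro lborel_integral_real_affine) auto
  also have "\<dots> = of_real (r * sqrt (2 * pi)) * (iexp (\<eta> * a) * of_real (exp (- (\<eta>\<^sup>2 / (2 * t)))))"
    unfolding fg using gi r by (simp add: gI scaleR_conv_of_real)
  also have "r * sqrt (2 * pi) = sqrt (2 * pi / t)" using t by (simp add: r_def real_sqrt_divide)
  finally show "(LINT s|lborel. exp (of_real (- t * (s - a)\<^sup>2 / 2) + \<i> * of_real (\<eta> * s)) :: complex)
      = of_real (sqrt (2 * pi / t)) * exp (of_real (- \<eta>\<^sup>2 / (2 * t)) + \<i> * of_real (\<eta> * a))"
    unfolding f_def by (simp only: exp_add exp_of_real minus_divide_left mult_ac)
qed

text \<open>Centre \<open>a\<close> and modulation \<open>b\<close> are both included because the
  Fourier transform exchanges them, up to sign and phase, while it inverts \<open>t\<close>. The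
  family is thus mapped into itself up to constants, and it factors over the coordinates.\<close>

definition gaussian :: "real \<Rightarrow> 'a::euclidean_space \<Rightarrow> 'a \<Rightarrow> 'a \<Rightarrow> complex" where
  "gaussian t a b x = exp (of_real (- t * (norm (x - a))\<^sup>2 / 2) + \<i> * of_real (b \<bullet> x))"

lemma gaussian_prod:
  "gaussian t a b x = (\<Prod>i\<in>Basis. exp (of_real (- t * (x \<bullet> i - a \<bullet> i)\<^sup>2 / 2) + \<i> * of_real ((b \<bullet> i) * (x \<bullet> i))))"
proof -
  have 1: "(norm (x - a))\<^sup>2 = (\<Sum>i\<in>Basis. (x \<bullet> i - a \<bullet> i)\<^sup>2)"
    unfolding power2_norm_eq_inner euclidean_inner[of "x - a" "x - a"]
    by (simp add: inner_diff_left power2_eq_square)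
  have 2: "b \<bullet> x = (\<Sum>i\<in>Basis. (b \<bullet> i) * (x \<bullet> i))" by (rule euclidean_inner)
  show ?thesis unfolding gaussian_def exp_sum[symmetric, OF finite_Basis] 1 2
    by (simp add: sum_distrib_left sum_divide_distrib sum_negf sum.distrib sum_subtractf)
qed

lemma continuous_on_gaussian: "continuous_on S (gaussian t a b)"
  unfolding gaussian_def by (intro continuous_intros) auto

lemma gaussian_measurable [measurable]: "gaussian t a b \<in> borel_measurable borel"
  by (rule borel_measurable_continuous_onI[OF continuous_on_gaussian])

lemma integrable_gaussian: "t > 0 \<Longrightarrow> integrable lborel (gaussian t a b)"
  unfolding gaussian_prod by (intro lborel_product_integral gaussian_integral_real)

lemma integral_gaussian:
  fixes a b :: "'a::euclidean_space"
  assumes t: "t > 0"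
  shows "(LINT x|lborel. gaussian t a b x)
    = of_real (sqrt (2 * pi / t) ^ DIM('a)) * exp (of_real (- (norm b)\<^sup>2 / (2 * t)) + \<i> * of_real (b \<bullet> a))"
proof -
  have 1: "(norm b)\<^sup>2 = (\<Sum>i\<in>Basis. (b \<bullet> i)\<^sup>2)"
    unfolding power2_norm_eq_inner euclidean_inner[of b b] by (simp add: power2_eq_square)
  have 2: "b \<bullet> a = (\<Sum>i\<in>Basis. (b \<bullet> i) * (a \<bullet> i))" by (rule euclidean_inner)
  have "(LINT x|lborel. gaussian t a b x) =
    (\<Prod>i\<in>(Basis::'a set). of_real (sqrt (2 * pi / t)) * exp (of_real (- (b \<bullet> i)\<^sup>2 / (2 * t)) + \<i> * of_real ((b \<bullet> i) * (a \<bullet> i))))"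
    unfolding gaussian_prod
    by (subst lborel_product_integral(2)) (use t in \<open>auto simp only: gaussian_integral_real\<close>)
  also have "\<dots> = of_real (sqrt (2 * pi / t) ^ DIM('a)) * exp (of_real (- (norm b)\<^sup>2 / (2 * t)) + \<i> * of_real (b \<bullet> a))"
    unfolding prod.distrib exp_sum[symmetric, OF finite_Basis] 1 2
    by (simp add: sum_distrib_left sum_divide_distrib sum_negf sum.distrib sum_subtractf)
  finally show ?thesis .
qed

lemma cnj_gaussian: "cnj (gaussian t a b x) = gaussian t a (- b) x"
  by (simp add: gaussian_def exp_cnj algebra_simps)

lemma norm_gaussian: "cmod (gaussian t a b x) = exp (- t * (norm (x - a))\<^sup>2 / 2)"
  by (simp add: gaussian_def)

lemma gaussian_0: "gaussian t a 0 x = of_real (exp (- t * (norm (x - a))\<^sup>2 / 2))"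
  unfolding gaussian_def by (simp only: inner_zero_left of_real_0 mult_zero_right add_0_right exp_of_real)

lemma iexp_times_gaussian: "iexp (c \<bullet> x) * gaussian t a b x = gaussian t a (b + c) x"
  by (simp add: gaussian_def inner_add_left exp_add[symmetric] algebra_simps)

lemma square_integrable_gaussian:
  assumes "t > 0"
  shows "square_integrable (gaussian t a b)"
  unfolding square_integrable_def
proof
  have "(\<lambda>x. (cmod (gaussian t a b x))\<^sup>2) = (\<lambda>x. cmod (gaussian (2 * t) a 0 x))"
    by (auto simp: norm_gaussian power2_eq_square simp flip: exp_add)
  then show "integrable lborel (\<lambda>x. (cmod (gaussian t a b x))\<^sup>2)"
    using integrable_gaussian[of "2 * t" a 0] assms by (simp add: integrable_norm)
qed simp

section \<open>Fubini for bounded kernels; functions annihilated by all Gaussians\<close>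

lemma kernel_Fubini:
  fixes f :: "'x \<Rightarrow> complex" and g :: "'y \<Rightarrow> complex" and k :: "'x \<Rightarrow> 'y \<Rightarrow> complex"
  assumes sf: "sigma_finite_measure M" "sigma_finite_measure N"
    and f: "integrable M f" and g: "integrable N g"
    and k [measurable]: "case_prod k \<in> borel_measurable (M \<Otimes>\<^sub>M N)"
    and bd: "\<And>x y. cmod (k x y) \<le> C"
  shows "integrable N (\<lambda>y. (LINT x|M. k x y * f x) * g y)"
    and "integrable M (\<lambda>x. f x * (LINT y|N. k x y * g y))"
    and "(LINT y|N. (LINT x|M. k x y * f x) * g y) = (LINT x|M. f x * (LINT y|N. k x y * g y))"
proof -
  interpret pair_sigma_finite M N
    using sf by (simp add: pair_sigma_finite_def)
  have [measurable]: "f \<in> borel_measurable M" "g \<in> borel_measurable N"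
    using f g by auto
  have C: "C \<ge> 0" using bd[of undefined undefined] norm_ge_zero order_trans by blast
  have km: "(\<lambda>y. k x y) \<in> borel_measurable N" if "x \<in> space M" for x
    using measurable_Pair2[OF k that] by simp
  have bdi: "cmod (k x y * f x * g y) \<le> C * cmod (f x) * cmod (g y)" for x y
    using bd[of x y] by (auto simp: norm_mult intro!: mult_right_mono)
  have int: "integrable (M \<Otimes>\<^sub>M N) (\<lambda>(x, y). k x y * f x * g y)"
  proof (rule Bochner_Integration.integrable_bound)
    show "integrable (M \<Otimes>\<^sub>M N) (\<lambda>(x, y). C * cmod (f x) * cmod (g y))"
    proof (rule Fubini_integrable)
      show "integrable M (\<lambda>x. LINT y|N. norm (case (x, y) of (x, y) \<Rightarrow> C * cmod (f x) * cmod (g y)))"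
        using f C by (simp add: integrable_norm abs_mult)
      show "AE x in M. integrable N (\<lambda>y. case (x, y) of (x, y) \<Rightarrow> C * cmod (f x) * cmod (g y))"
        using g by (simp add: integrable_norm)
    qed measurable
    show "AE z in M \<Otimes>\<^sub>M N. norm (case z of (x, y) \<Rightarrow> k x y * f x * g y)
        \<le> norm (case z of (x, y) \<Rightarrow> C * cmod (f x) * cmod (g y))"
      using bdi C by (auto simp: split_beta' abs_mult)
  qed measurable
  have e1: "(LINT x|M. k x y * f x * g y) = (LINT x|M. k x y * f x) * g y" for y
    by (rule integral_mult_left_zero)
  have e2: "(LINT y|N. k x y * f x * g y) = f x * (LINT y|N. k x y * g y)" for x
    by (simp add: integral_mult_right_zero[symmetric] mult_ac del: integral_mult_right_zero)
  show "integrable N (\<lambda>y. (LINT x|M. k x y * f x) * g y)"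
    using integrable_snd[OF int] by (simp add: e1)
  show "integrable M (\<lambda>x. f x * (LINT y|N. k x y * g y))"
    using integrable_fst[OF int] by (simp add: e2)
  show "(LINT y|N. (LINT x|M. k x y * f x) * g y) = (LINT x|M. f x * (LINT y|N. k x y * g y))"
    using Fubini_integral[OF int] by (simp add: e1 e2)
qed

text \<open>Indicators of open sets are pointwise limits of bounded continuous functions, and the
  open sets are an intersection-stable generator of the Borel sets. Hence \<open>F\<close> has
  integral 0 over every Borel set, which determines its real and imaginary parts.\<close>

lemma integral_against_continuous_zero_imp_AE:
  fixes F :: "'a::euclidean_space \<Rightarrow> complex"
  assumes F: "integrable lborel F"
    and zero: "\<And>h :: 'a \<Rightarrow> real. continuous_on UNIV h \<Longrightarrow> bounded (range h) \<Longrightarrow> (LINT x|lborel. of_real (h x) * F x) = 0"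
  shows "AE x in lborel. F x = 0"
proof -
  have [measurable]: "F \<in> borel_measurable borel" using F by simp
  \<comment> \<open>The whole space is separated off because \<open>infdist\<close> to the empty
    complement is 0 by convention, which would turn the approximating functions into 0.\<close>
  have op: "(LINT x|lborel. indicator U x *\<^sub>R F x) = 0" if U: "open U" for U
  proof (cases "U = UNIV")
    case True
    then show ?thesis using zero[of "\<lambda>_. 1"] by simp
  next
    case False
    define h where "h n x = min 1 (real n * infdist x (- U))" for n x
    have hc: "continuous_on UNIV (h n)" for n unfolding h_def by (intro continuous_intros)
    have h01: "0 \<le> h n x" "h n x \<le> 1" for n x by (auto simp: h_def infdist_nonneg)
    have hb: "bounded (range (h n))" for n
      using h01 by (auto simp: bounded_iff intro!: exI[of _ 1])
    have [measurable]: "h n \<in> borel_measurable borel" for n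
      using hc by (rule borel_measurable_continuous_onI)
    have [measurable]: "U \<in> sets borel" using U by simp
    have lim: "(\<lambda>n. h n x) \<longlonglongrightarrow> indicator U x" for x
    proof (cases "x \<in> U")
      case True
      then have "infdist x (- U) > 0"
        using U False in_closed_iff_infdist_zero[of "- U" x] infdist_nonneg[of x "- U"]
        by (auto simp: closed_Compl less_le)
      then obtain N :: nat where N: "1 < real N * infdist x (- U)"
        using reals_Archimedean3 by blast
      have "eventually (\<lambda>n. h n x = 1) sequentially"
        using eventually_ge_at_top[of N]
      proof eventually_elim
        case (elim n)
        have "real N * infdist x (- U) \<le> real n * infdist x (- U)"
          using elim by (intro mult_right_mono) (auto simp: infdist_nonneg)
        with N show ?case by (simp add: h_def)
      qed
      then show ?thesis using True by (simp add: tendsto_eventually)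
    qed (simp add: h_def)
    have "(\<lambda>n. LINT x|lborel. of_real (h n x) * F x) \<longlonglongrightarrow> (LINT x|lborel. indicator U x *\<^sub>R F x)"
    proof (rule integral_dominated_convergence[where w="\<lambda>x. cmod (F x)"])
      show "integrable lborel (\<lambda>x. cmod (F x))" using F by simp
      show "AE x in lborel. (\<lambda>n. of_real (h n x) * F x) \<longlonglongrightarrow> indicator U x *\<^sub>R F x"
        using lim by (auto simp: scaleR_conv_of_real intro!: tendsto_intros)
      show "AE x in lborel. norm (of_real (h n x) * F x) \<le> cmod (F x)" for n
        using h01 by (auto simp: norm_mult intro!: mult_left_le_one_le)
    qed measurable
    then show ?thesis using zero[OF hc hb] by (simp add: LIMSEQ_const_iff)
  qed
  have all: "(LINT x|lborel. indicator A x *\<^sub>R F x) = 0" if "A \<in> sets borel" for A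
  proof -
    have "Int_stable {S :: 'a set. open S}" "{S :: 'a set. open S} \<subseteq> Pow UNIV" "A \<in> sigma_sets UNIV {S. open S}"
      using that by (auto simp add: borel_def Int_stable_def)
    then show ?thesis
    proof (induction rule: sigma_sets_induct_disjoint)
      case (compl A)
      then have [measurable]: "A \<in> sets borel" by (simp add: borel_def)
      have "(\<lambda>x. indicator (UNIV - A) x *\<^sub>R F x) = (\<lambda>x. F x - indicator A x *\<^sub>R F x)"
        by (auto simp: indicator_def fun_eq_iff)
      moreover have "integrable lborel (\<lambda>x. indicator A x *\<^sub>R F x)"
        using F by (intro integrable_mult_indicator) auto
      ultimately show ?case using F compl(2) op[of UNIV] by simp
    next
      case (union A)
      have [measurable]: "A i \<in> sets borel" for i using union(2) by (auto simp: borel_def)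
      have "(LINT x:(\<Union>i. A i)|lborel. F x) = (\<Sum>i. LINT x:A i|lborel. F x)"
      proof (rule lebesgue_integral_countable_add)
        show "set_integrable lborel (\<Union>i. A i) F"
          unfolding set_integrable_def using F by (intro integrable_mult_indicator) auto
      qed (use union(1) in \<open>auto simp: disjoint_family_on_def\<close>)
      then show ?case using union(3) by (simp add: set_lebesgue_integral_def)
    qed (auto simp: op Int_stable_def)
  qed
  have *: "integrable lborel (\<lambda>x. indicator A x *\<^sub>R F x)" if "A \<in> sets borel" for A
    using F that by (intro integrable_mult_indicator) auto
  have "AE x in lborel. Re (F x) = 0"
  proof (rule density_unique_real)
    fix A :: "'a set" assume "A \<in> sets lborel"
    then show "(LINT x:A|lborel. Re (F x)) = (LINT x:A|lborel. 0)"
      using arg_cong[OF all[of A], of Re] *[of A] by (simp add: set_lebesgue_integral_def integral_Re[symmetric] del: integral_Re)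
  qed (use F in auto)
  moreover have "AE x in lborel. Im (F x) = 0"
  proof (rule density_unique_real)
    fix A :: "'a set" assume "A \<in> sets lborel"
    then show "(LINT x:A|lborel. Im (F x)) = (LINT x:A|lborel. 0)"
      using arg_cong[OF all[of A], of Im] *[of A] by (simp add: set_lebesgue_integral_def integral_Im[symmetric] del: integral_Im)
  qed (use F in auto)
  ultimately show ?thesis by eventually_elim (simp add: complex_eq_iff)
qed

text \<open>A bounded continuous \<open>h\<close> is smoothed at scale \<open>\<sigma> n\<close> by
  a Gaussian profile \<open>P\<close>. By Fubini the smoothed function integrates to 0 against
  \<open>F\<close>, and letting the scale shrink recovers \<open>h\<close> up to the factor
  \<open>c\<close>, the integral of \<open>P\<close>. Only \<open>c \<noteq> 0\<close> matters, so
  \<open>P\<close> is left unnormalised.\<close>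

lemma integral_against_gaussians_zero_imp_AE:
  fixes F :: "'a::euclidean_space \<Rightarrow> complex"
  assumes F: "integrable lborel F"
    and zero: "\<And>t y. t > 0 \<Longrightarrow> (LINT x|lborel. F x * gaussian t y 0 x) = 0"
  shows "AE x in lborel. F x = 0"
proof (rule integral_against_continuous_zero_imp_AE[OF F])
  fix h :: "'a \<Rightarrow> real" assume hc: "continuous_on UNIV h" and hb: "bounded (range h)"
  have [measurable]: "F \<in> borel_measurable borel" using F by simp
  have [measurable]: "h \<in> borel_measurable borel" using hc by (rule borel_measurable_continuous_onI)
  from hb obtain M where M: "\<And>x. \<bar>h x\<bar> \<le> M" by (auto simp: bounded_iff)
  have M0: "M \<ge> 0" using M[of 0] by linarith
  define P where "P = gaussian 1 (0::'a) 0"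
  have Pi: "integrable lborel P" unfolding P_def by (rule integrable_gaussian) simp
  have [measurable]: "P \<in> borel_measurable borel" by (simp add: P_def)
  define c where "c = integral\<^sup>L lborel P"
  have c: "c \<noteq> 0" unfolding c_def P_def by (subst integral_gaussian) auto
  define \<sigma> where "\<sigma> n = 1 / real (Suc n)" for n
  have \<sigma>: "\<sigma> n > 0" for n by (simp add: \<sigma>_def)
  have \<sigma>0: "\<sigma> \<longlonglongrightarrow> 0" unfolding \<sigma>_def by (rule LIMSEQ_Suc[OF lim_1_over_n])
  define A where "A n x = (LINT z|lborel. of_real (h (x + \<sigma> n *\<^sub>R z)) * P z)" for n x
  have Ameas [measurable]: "A n \<in> borel_measurable borel" for n
    unfolding A_def by measurable
  have Alim: "(\<lambda>n. A n x) \<longlonglongrightarrow> of_real (h x) * c" for x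
  proof -
    have "(\<lambda>n. A n x) \<longlonglongrightarrow> (LINT z|lborel. of_real (h x) * P z)"
      unfolding A_def
    proof (rule integral_dominated_convergence[where w="\<lambda>z. M * cmod (P z)"])
      have "isCont h x" using hc by (simp add: continuous_on_eq_continuous_at)
      moreover have "(\<lambda>n. x + \<sigma> n *\<^sub>R z) \<longlonglongrightarrow> x" for z
        using tendsto_add[OF tendsto_const tendsto_scaleR[OF \<sigma>0 tendsto_const], of x z] by simp
      ultimately have "(\<lambda>n. h (x + \<sigma> n *\<^sub>R z)) \<longlonglongrightarrow> h x" for z
        by (rule isCont_tendsto_compose)
      then show "AE z in lborel. (\<lambda>n. of_real (h (x + \<sigma> n *\<^sub>R z)) * P z) \<longlonglongrightarrow> of_real (h x) * P z"
        by (auto intro!: tendsto_intros)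
      show "integrable lborel (\<lambda>z. M * cmod (P z))" using Pi by simp
      show "AE z in lborel. norm (of_real (h (x + \<sigma> n *\<^sub>R z)) * P z) \<le> M * cmod (P z)" for n
        using M by (auto simp: norm_mult intro!: mult_right_mono)
    qed measurable
    then show ?thesis by (simp add: c_def)
  qed
  have Abd: "cmod (A n x) \<le> M * (LINT z|lborel. cmod (P z))" for n x
  proof -
    have "cmod (A n x) \<le> (LINT z|lborel. cmod (of_real (h (x + \<sigma> n *\<^sub>R z)) * P z))"
      unfolding A_def by (rule integral_norm_bound)
    also have "\<dots> \<le> (LINT z|lborel. M * cmod (P z))"
    proof (rule integral_mono')
      show "integrable lborel (\<lambda>z. M * cmod (P z))" using Pi by simp
    qed (use M M0 in \<open>auto simp: norm_mult intro!: mult_right_mono\<close>)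
    finally show ?thesis by simp
  qed
  have A0: "(LINT x|lborel. A n x * F x) = 0" for n
  proof -
    \<comment> \<open>Substituting \<open>y = x + \<sigma> n z\<close> turns the profile at scale
      \<open>\<sigma> n\<close> into a Gaussian in \<open>x\<close> with centre \<open>y\<close>;
      its parameter is the inverse square of the scale.\<close>
    define t where "t = 1 / (\<sigma> n)\<^sup>2"
    have t: "t > 0" using \<sigma>[of n] by (simp add: t_def)
    have Pz: "P ((y - x) /\<^sub>R \<sigma> n) = gaussian t y 0 x" for x y
    proof -
      have "(norm ((y - x) /\<^sub>R \<sigma> n))\<^sup>2 = t * (norm (x - y))\<^sup>2"
        using \<sigma>[of n] by (simp add: t_def power_mult_distrib norm_minus_commute divide_inverse power_inverse)
      then show ?thesis unfolding P_def gaussian_0 by simp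
    qed
    have A': "A n x = of_real ((1 / \<sigma> n) ^ DIM('a)) * (LINT y|lborel. of_real (h y) * gaussian t y 0 x)" for x
    proof -
      have "(LINT z|lborel. of_real (h (x + \<sigma> n *\<^sub>R z)) * P z)
        = \<bar>1 / \<sigma> n\<bar> ^ DIM('a) *\<^sub>R (LINT y|lborel. of_real (h (x + \<sigma> n *\<^sub>R (- x /\<^sub>R \<sigma> n + (1 / \<sigma> n) *\<^sub>R y)))
            * P (- x /\<^sub>R \<sigma> n + (1 / \<sigma> n) *\<^sub>R y))"
        using \<sigma>[of n] by (intro lborel_integral_affine) auto
      also have "\<dots> = of_real ((1 / \<sigma> n) ^ DIM('a)) * (LINT y|lborel. of_real (h y) * P ((y - x) /\<^sub>R \<sigma> n))"
        using \<sigma>[of n] by (simp add: scaleR_conv_of_real scaleR_add_right scaleR_diff_right divide_inverse)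
      finally show ?thesis by (simp add: A_def Pz)
    qed
    have gm [measurable]: "(\<lambda>(x, y). gaussian t y 0 x) \<in> borel_measurable (borel \<Otimes>\<^sub>M borel)"
      unfolding gaussian_def by measurable
    have int: "integrable (lborel \<Otimes>\<^sub>M lborel) (\<lambda>(x, y). of_real (h y) * gaussian t y 0 x * F x)"
    proof (rule lborel_pair.Fubini_integrable)
      have sym: "cmod (gaussian t y 0 x) = cmod (gaussian t x 0 y)" for x y :: 'a
        by (simp add: norm_gaussian norm_minus_commute)
      have gi: "integrable lborel (\<lambda>y. cmod (gaussian t y 0 x))" for x :: 'a
        unfolding sym[of _ x] using integrable_gaussian[OF t, of x 0] by simp
      have gib: "(LINT y|lborel. cmod (gaussian t y 0 x)) = (LINT y|lborel. cmod (gaussian t (0::'a) 0 y))" for x :: 'a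
      proof -
        have "(LINT y|lborel. cmod (gaussian t x 0 y)) = (LINT y|lborel. cmod (gaussian t x 0 (x + 1 *\<^sub>R y)))"
          by (subst lborel_integral_affine(2)[of _ 1 x]) auto
        then show ?thesis unfolding sym[of _ x] by (simp add: norm_gaussian)
      qed
      have hgi: "integrable lborel (\<lambda>y. of_real (h y) * gaussian t y 0 x * F x)" for x
      proof (rule Bochner_Integration.integrable_bound)
        show "integrable lborel (\<lambda>y. M * cmod (F x) * cmod (gaussian t y 0 x))" using gi by simp
        show "AE y in lborel. norm (of_real (h y) * gaussian t y 0 x * F x) \<le> norm (M * cmod (F x) * cmod (gaussian t y 0 x))"
          using M M0 by (auto simp: norm_mult abs_mult mult_ac intro!: mult_right_mono mult_left_mono)
      qed measurable
      then show "AE x in lborel. integrable lborel (\<lambda>y. case (x, y) of (x, y) \<Rightarrow> of_real (h y) * gaussian t y 0 x * F x)"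
        by simp
      show "integrable lborel (\<lambda>x. LINT y|lborel. norm (case (x, y) of (x, y) \<Rightarrow> of_real (h y) * gaussian t y 0 x * F x))"
      proof (rule Bochner_Integration.integrable_bound)
        show "integrable lborel (\<lambda>x. M * (LINT y|lborel. cmod (gaussian t (0::'a) 0 y)) * cmod (F x))" using F by simp
        have "(LINT y|lborel. cmod (of_real (h y) * gaussian t y 0 x * F x)) \<le> (LINT y|lborel. M * cmod (gaussian t y 0 x) * cmod (F x))" for x
          using M M0 gi[of x] by (intro integral_mono') (auto simp: norm_mult intro!: mult_right_mono)
        then show "AE x in lborel. norm (LINT y|lborel. norm (case (x, y) of (x, y) \<Rightarrow> of_real (h y) * gaussian t y 0 x * F x))
          \<le> norm (M * (LINT y|lborel. cmod (gaussian t (0::'a) 0 y)) * cmod (F x))"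
          using M0 by (simp add: gib abs_mult)
      qed measurable
    qed measurable
    have "(LINT x|lborel. (LINT y|lborel. of_real (h y) * gaussian t y 0 x * F x))
      = (LINT y|lborel. (LINT x|lborel. of_real (h y) * gaussian t y 0 x * F x))"
      using lborel_pair.Fubini_integral[OF int] by simp
    also have "\<dots> = (LINT y|lborel. of_real (h y) * (LINT x|lborel. F x * gaussian t y 0 x))"
      by (simp add: mult.assoc mult.commute[of "F _"])
    finally have "(LINT x|lborel. (LINT y|lborel. of_real (h y) * gaussian t y 0 x) * F x) = 0"
      using zero[OF t] by simp
    then show ?thesis unfolding A' by (simp add: mult.assoc)
  qed
  have "(\<lambda>n. LINT x|lborel. A n x * F x) \<longlonglongrightarrow> (LINT x|lborel. of_real (h x) * c * F x)"
  proof (rule integral_dominated_convergence[where w="\<lambda>x. M * (LINT z|lborel. cmod (P z)) * cmod (F x)"])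
    show "AE x in lborel. (\<lambda>n. A n x * F x) \<longlonglongrightarrow> of_real (h x) * c * F x"
      using Alim by (auto intro!: tendsto_intros)
    show "AE x in lborel. norm (A n x * F x) \<le> M * (LINT z|lborel. cmod (P z)) * cmod (F x)" for n
      using Abd by (auto simp: norm_mult intro!: mult_right_mono)
  qed (use F in auto)
  then have "(LINT x|lborel. of_real (h x) * c * F x) = 0"
    unfolding A0 by (simp add: LIMSEQ_const_iff)
  then have "(LINT x|lborel. c * (of_real (h x) * F x)) = 0"
    by (simp only: mult_ac)
  then show "(LINT x|lborel. of_real (h x) * F x) = 0" using c by simp
qed

text \<open>Completing the square: the parameters add, and the new centre is the mean of the centres
  0 and \<open>y\<close> with weights 1 and \<open>t\<close>.\<close>

lemma gaussian_mult_gaussian: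
  assumes "t > 0"
  shows "gaussian 1 0 0 x * gaussian t y 0 x
    = of_real (exp (- t * (norm y)\<^sup>2 / (2 * (t + 1)))) * gaussian (t + 1) ((t / (t + 1)) *\<^sub>R y) 0 x"
proof -
  have "(norm x)\<^sup>2 + t * (norm (x - y))\<^sup>2 = t * (norm y)\<^sup>2 / (t + 1) + (t + 1) * (norm (x - (t / (t + 1)) *\<^sub>R y))\<^sup>2"
  proof -
    have "(t + 1) * ((norm x)\<^sup>2 + t * (norm (x - y))\<^sup>2)
        = t * (norm y)\<^sup>2 + (t + 1)\<^sup>2 * (norm (x - (t / (t + 1)) *\<^sub>R y))\<^sup>2"
    proof -
      have "(t + 1)\<^sup>2 * (norm (x - (t / (t + 1)) *\<^sub>R y))\<^sup>2 = (norm ((t + 1) *\<^sub>R (x - (t / (t + 1)) *\<^sub>R y)))\<^sup>2"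
        by (simp add: power_mult_distrib)
      also have "(t + 1) *\<^sub>R (x - (t / (t + 1)) *\<^sub>R y) = (t + 1) *\<^sub>R x - t *\<^sub>R y"
        using assms by (simp add: scaleR_diff_right)
      finally show ?thesis
        by (simp add: power2_norm_eq_inner inner_diff_left inner_diff_right inner_commute algebra_simps)
    qed
    then show ?thesis using assms by (simp add: field_simps power2_eq_square)
  qed
  moreover have "- A / 2 + - t * B / 2 = - t * Y / (2 * (t + 1)) + - (t + 1) * Z / 2"
    if "A + t * B = t * Y / (t + 1) + (t + 1) * Z" for A B Y Z :: real
  proof -
    have "- A / 2 + - t * B / 2 = - (A + t * B) / 2" by (simp add: field_simps)
    also have "\<dots> = - (t * Y / (t + 1)) / 2 + - ((t + 1) * Z) / 2"
      unfolding that minus_add_distrib add_divide_distrib ..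
    also have "- (t * Y / (t + 1)) / 2 = - t * Y / (2 * (t + 1))" by (simp only: minus_divide_left divide_divide_eq_left mult.commute[of 2] mult_minus_left)
    also have "- ((t + 1) * Z) / 2 = - (t + 1) * Z / 2" by (simp only: mult_minus_left)
    finally show ?thesis .
  qed
  ultimately have "- (norm x)\<^sup>2 / 2 + - t * (norm (x - y))\<^sup>2 / 2
     = - t * (norm y)\<^sup>2 / (2 * (t + 1)) + - (t + 1) * (norm (x - (t / (t + 1)) *\<^sub>R y))\<^sup>2 / 2"
    by blast
  then show ?thesis
    unfolding gaussian_0 by (simp flip: of_real_mult exp_add)
qed

text \<open>For functions that are not integrable by themselves, such as a coordinate times a
  square-integrable function. A fixed Gaussian weight makes \<open>H\<close> integrable, and testing
  the weighted function against a Gaussian amounts to testing \<open>H\<close> against another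
  Gaussian.\<close>

lemma gaussian_weighted_zero_imp_AE:
  fixes H :: "'a::euclidean_space \<Rightarrow> complex"
  assumes H: "integrable lborel (\<lambda>x. H x * gaussian 1 0 0 x)"
    and zero: "\<And>t y. t > 0 \<Longrightarrow> (LINT x|lborel. H x * gaussian t y 0 x) = 0"
  shows "AE x in lborel. H x = 0"
proof -
  have "AE x in lborel. H x * gaussian 1 0 0 x = 0"
  proof (rule integral_against_gaussians_zero_imp_AE[OF H])
    fix t :: real and y :: 'a assume t: "t > 0"
    have "(LINT x|lborel. H x * gaussian 1 0 0 x * gaussian t y 0 x)
      = (LINT x|lborel. of_real (exp (- t * (norm y)\<^sup>2 / (2 * (t + 1)))) * (H x * gaussian (t + 1) ((t / (t + 1)) *\<^sub>R y) 0 x))"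
      by (rule Bochner_Integration.integral_cong) (simp_all add: gaussian_mult_gaussian[OF t] mult.assoc mult.left_commute)
    also have "\<dots> = 0" using zero[of "t + 1"] t by simp
    finally show "(LINT x|lborel. H x * gaussian 1 0 0 x * gaussian t y 0 x) = 0" .
  qed
  then show ?thesis by (simp add: gaussian_def)
qed

section \<open>The Fourier transform as a unitary operator\<close>

lemma borel_measurable_cnj [measurable (raw)]:
  "f \<in> borel_measurable M \<Longrightarrow> (\<lambda>x. cnj (f x)) \<in> borel_measurable M"
  by (rule borel_measurable_continuous_on) (intro continuous_intros)

text \<open>The normalising factor is the symmetric one, which makes the transform unitary. As a
  Bochner integral the value is meaningful for integrable \<open>f\<close>.\<close>

definition fourier_integral :: "('a::euclidean_space \<Rightarrow> complex) \<Rightarrow> 'a \<Rightarrow> complex" where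
  "fourier_integral f \<xi> = of_real ((1 / sqrt (2 * pi)) ^ DIM('a)) * (LINT x|lborel. iexp (- (\<xi> \<bullet> x)) * f x)"

lemma iexp_measurable_pair [measurable]:
  "(\<lambda>(x, y). iexp (- (y \<bullet> x))) \<in> borel_measurable (borel \<Otimes>\<^sub>M (borel :: 'a::euclidean_space measure))"
  "(\<lambda>(x, y). iexp (y \<bullet> x)) \<in> borel_measurable (borel \<Otimes>\<^sub>M (borel :: 'a::euclidean_space measure))"
  by measurable

text \<open>The multiplication formula. Inserting a conjugated transform for \<open>g\<close> turns
  it into Plancherel's identity as soon as inversion is known for that function.\<close>

lemma fourier_integral_duality:
  fixes f g :: "'a::euclidean_space \<Rightarrow> complex"
  assumes "integrable lborel f" "integrable lborel g"
  shows "(LINT \<xi>|lborel. fourier_integral f \<xi> * g \<xi>) = (LINT x|lborel. f x * fourier_integral g x)"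
proof -
  have "(LINT \<xi>|lborel. (LINT x|lborel. iexp (- (\<xi> \<bullet> x)) * f x) * g \<xi>)
      = (LINT x|lborel. f x * (LINT \<xi>|lborel. iexp (- (\<xi> \<bullet> x)) * g \<xi>))"
    by (rule kernel_Fubini(3)[where C=1]) (use assms in \<open>auto intro: sigma_finite_lborel\<close>)
  then show ?thesis
    by (simp add: fourier_integral_def mult.assoc mult.left_commute[of "f _"] inner_commute)
qed

lemma fourier_integral_gaussian:
  fixes a b :: "'a::euclidean_space"
  assumes t: "t > 0"
  shows "fourier_integral (gaussian t a b) \<xi>
    = of_real ((1 / sqrt t) ^ DIM('a)) * iexp (a \<bullet> b) * gaussian (1 / t) b (- a) \<xi>"
proof -
  have "(LINT x|lborel. iexp (- (\<xi> \<bullet> x)) * gaussian t a b x) = (LINT x|lborel. gaussian t a (b - \<xi>) x)"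
    using iexp_times_gaussian[of "- \<xi>"] by simp
  also have "\<dots> = of_real (sqrt (2 * pi / t) ^ DIM('a))
      * exp (of_real (- (norm (b - \<xi>))\<^sup>2 / (2 * t)) + \<i> * of_real ((b - \<xi>) \<bullet> a))"
    by (rule integral_gaussian[OF t])
  also have "exp (of_real (- (norm (b - \<xi>))\<^sup>2 / (2 * t)) + \<i> * of_real ((b - \<xi>) \<bullet> a))
      = iexp (a \<bullet> b) * gaussian (1 / t) b (- a) \<xi>"
    by (simp add: gaussian_def exp_add[symmetric] inner_diff_left norm_minus_commute inner_commute algebra_simps)
  finally have "fourier_integral (gaussian t a b) \<xi> = of_real ((1 / sqrt (2 * pi)) ^ DIM('a) * sqrt (2 * pi / t) ^ DIM('a))
     * (iexp (a \<bullet> b) * gaussian (1 / t) b (- a) \<xi>)"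
    by (simp add: fourier_integral_def)
  also have "(1 / sqrt (2 * pi)) ^ DIM('a) * sqrt (2 * pi / t) ^ DIM('a) = (1 / sqrt t) ^ DIM('a)"
    by (simp add: power_mult_distrib[symmetric] real_sqrt_divide)
  finally show ?thesis by (simp add: mult.assoc)
qed

lemmas fourier_integral_gaussian_fun = ext[OF fourier_integral_gaussian]

lemma fourier_integral_cmult: "fourier_integral (\<lambda>x. c * f x) \<xi> = c * fourier_integral f \<xi>"
  by (simp add: fourier_integral_def mult.left_commute[of _ c])

lemma fourier_integral_cnj: "cnj (fourier_integral f \<xi>) = fourier_integral (\<lambda>x. cnj (f x)) (- \<xi>)"
proof -
  have "cnj (LINT x|lborel. iexp (- (\<xi> \<bullet> x)) * f x) = (LINT x|lborel. iexp (- (- \<xi> \<bullet> x)) * cnj (f x))"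
    unfolding Bochner_Integration.integral_cnj[symmetric] by (simp add: exp_cnj)
  then show ?thesis by (simp add: fourier_integral_def)
qed

text \<open>Fourier inversion for Gaussians, stated with conjugates so that it fits the
  multiplication formula. Transforming twice restores the parameters, and the constants and phases
  cancel.\<close>

lemma fourier_integral_cnj_gaussian:
  fixes a b :: "'a::euclidean_space"
  assumes t: "t > 0"
  shows "fourier_integral (\<lambda>\<xi>. cnj (fourier_integral (gaussian t a b) \<xi>)) x = cnj (gaussian t a b x)"
proof -
  have "(\<lambda>\<xi>. cnj (fourier_integral (gaussian t a b) \<xi>))
      = (\<lambda>\<xi>. (of_real ((1 / sqrt t) ^ DIM('a)) * iexp (- (a \<bullet> b))) * gaussian (1 / t) b a \<xi>)"
    using t by (simp add: fourier_integral_gaussian cnj_gaussian exp_cnj)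
  then have "fourier_integral (\<lambda>\<xi>. cnj (fourier_integral (gaussian t a b) \<xi>)) x
      = of_real ((1 / sqrt t) ^ DIM('a) * (1 / sqrt (1 / t)) ^ DIM('a)) * (iexp (- (a \<bullet> b)) * iexp (b \<bullet> a))
         * gaussian t a (- b) x"
    using t by (simp add: fourier_integral_cmult fourier_integral_gaussian)
  also have "(1 / sqrt t) ^ DIM('a) * (1 / sqrt (1 / t)) ^ DIM('a) = 1"
    using t by (simp add: power_mult_distrib[symmetric] real_sqrt_divide)
  also have "iexp (- (a \<bullet> b)) * iexp (b \<bullet> a) = 1"
    by (simp add: exp_add[symmetric] inner_commute)
  finally show ?thesis by (simp add: cnj_gaussian)
qed

lemma integrable_fourier_gaussian: "t > 0 \<Longrightarrow> integrable lborel (fourier_integral (gaussian t a b))"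
  by (simp add: fourier_integral_gaussian_fun integrable_gaussian)

lemma square_integrable_fourier_gaussian: "t > 0 \<Longrightarrow> square_integrable (fourier_integral (gaussian t a b))"
  using square_integrable_scale[OF square_integrable_gaussian[of "1 / t" b "- a"]]
  by (simp add: fourier_integral_gaussian_fun mult.assoc[symmetric])

section \<open>Plancherel's identity on Gaussians and its unitary extension\<close>

definition l2_gaussian :: "real \<Rightarrow> 'a::euclidean_space \<Rightarrow> 'a \<Rightarrow> 'a l2" where
  "l2_gaussian t a b = abs_l2 (gaussian t a b)"

definition l2_gaussian_hat :: "real \<Rightarrow> 'a::euclidean_space \<Rightarrow> 'a \<Rightarrow> 'a l2" where
  "l2_gaussian_hat t a b = abs_l2 (fourier_integral (gaussian t a b))"

lemma cinner_gaussian_hat: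
  assumes "t > 0" "t' > 0"
  shows "cinner (l2_gaussian_hat t a b) (l2_gaussian_hat t' a' b') = cinner (l2_gaussian t a b) (l2_gaussian t' a' b')"
proof -
  have "cinner (l2_gaussian_hat t a b) (l2_gaussian_hat t' a' b')
      = (LINT \<xi>|lborel. fourier_integral (gaussian t a b) \<xi> * cnj (fourier_integral (gaussian t' a' b') \<xi>))"
    using assms by (simp add: l2_gaussian_hat_def cinner_abs square_integrable_fourier_gaussian)
  also have "\<dots> = (LINT x|lborel. gaussian t a b x * fourier_integral (\<lambda>\<xi>. cnj (fourier_integral (gaussian t' a' b') \<xi>)) x)"
    using assms by (intro fourier_integral_duality integrable_gaussian) (simp_all add: integrable_fourier_gaussian)
  finally show ?thesis
    using assms by (simp add: fourier_integral_cnj_gaussian l2_gaussian_def cinner_abs square_integrable_gaussian)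
qed

lemma integrable_times_gaussian:
  assumes "square_integrable f" "t > 0"
  shows "integrable lborel (\<lambda>x. f x * gaussian t a b x)"
  using square_integrable_mult[OF assms(1) square_integrable_gaussian[OF assms(2), of a "- b"]]
  by (simp add: cnj_gaussian)

lemma total_gaussian:
  assumes "\<And>t a. t > 0 \<Longrightarrow> cinner f (l2_gaussian t a 0) = 0"
  shows "f = 0"
proof -
  have "AE x in lborel. rep_l2 f x = 0"
  proof (rule gaussian_weighted_zero_imp_AE)
    show "integrable lborel (\<lambda>x. rep_l2 f x * gaussian 1 0 0 x)"
      by (rule integrable_times_gaussian) simp_all
    show "(LINT x|lborel. rep_l2 f x * gaussian t y 0 x) = 0" if "t > 0" for t y
      using assms[OF that, of y] that
      by (simp add: l2_gaussian_def cinner_rep_abs square_integrable_gaussian cnj_gaussian)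
  qed
  then have "abs_l2 (\<lambda>_. 0) = f"
    by (intro abs_l2_eqI) (auto simp: square_integrable_zero elim!: eventually_mono)
  then show ?thesis by (simp add: abs_l2_zero)
qed

text \<open>A Gaussian centred at 0 with modulation \<open>y\<close> transforms into a multiple of
  the pure Gaussian centred at \<open>y\<close>. So the transforms contain, up to nonzero factors,
  the family already known to be total.\<close>

lemma total_gaussian_hat:
  assumes "\<And>t a b. t > 0 \<Longrightarrow> cinner f (l2_gaussian_hat t a b) = 0"
  shows "f = 0"
proof (rule total_gaussian)
  fix t :: real and y :: 'a assume t: "t > 0"
  define c where "c = complex_of_real ((1 / sqrt (1 / t)) ^ DIM('a))"
  have "c \<noteq> 0" using t by (simp add: c_def)
  have "fourier_integral (gaussian (1 / t) 0 y) = (\<lambda>x. c * gaussian t y 0 x)"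
    using t by (simp add: fourier_integral_gaussian_fun c_def)
  then have "l2_gaussian_hat (1 / t) 0 y = cscale c (l2_gaussian t y 0)"
    using t by (simp add: l2_gaussian_hat_def l2_gaussian_def abs_l2_cscale square_integrable_gaussian)
  then have "cnj c * cinner f (l2_gaussian t y 0) = 0"
    using assms[of "1 / t" 0 y] t by (simp add: cinner_cscale_right)
  then show "cinner f (l2_gaussian t y 0) = 0" using \<open>c \<noteq> 0\<close> by simp
qed

lemma inner_cscale_zero_imp_cinner_zero:
  assumes "\<And>c. inner f (cscale c g) = 0"
  shows "cinner f g = 0"
  using assms[of 1] assms[of \<i>] Re_cinner[of f g] Im_cinner[of f g] by (simp add: complex_eq_iff)

lemma fourier_exists:
  "\<exists>U :: 'a::euclidean_space l2 \<Rightarrow> 'a l2. linear U \<and> (\<forall>x. norm (U x) = norm x) \<and> surj U \<and>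
     (\<forall>c t a b. t > 0 \<longrightarrow> U (cscale c (l2_gaussian t a b)) = cscale c (l2_gaussian_hat t a b))"
proof -
  \<comment> \<open>The complex factor \<open>c\<close> is part of the index because the extension
    theorem concerns real inner products: totality over the reals with all complex multiples is
    totality over the complex numbers. The width is written \<open>exp s\<close> so that the index
    ranges over a full type.\<close>
  define \<phi> where "\<phi> = (\<lambda>(c, s, a, b). cscale c (l2_gaussian (exp s) a (b::'a)))"
  define \<psi> where "\<psi> = (\<lambda>(c, s, a, b). cscale c (l2_gaussian_hat (exp s) a (b::'a)))"
  have "\<exists>U. linear U \<and> (\<forall>x. norm (U x) = norm x) \<and> surj U \<and> (\<forall>i. U (\<phi> i) = \<psi> i)"
  proof (rule isometry_from_total_families)
    show "inner (\<phi> i) (\<phi> j) = inner (\<psi> i) (\<psi> j)" for i j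
      by (cases i; cases j)
        (simp add: \<phi>_def \<psi>_def inner_l2_def cinner_cscale_left cinner_cscale_right cinner_gaussian_hat)
  next
    fix x assume *: "\<And>i. inner x (\<phi> i) = 0"
    show "x = 0"
    proof (rule total_gaussian, rule inner_cscale_zero_imp_cinner_zero)
      fix t :: real and a c assume "t > 0"
      then show "inner x (cscale c (l2_gaussian t a 0)) = 0"
        using *[of "(c, ln t, a, 0)"] by (simp add: \<phi>_def)
    qed
  next
    fix x assume *: "\<And>i. inner x (\<psi> i) = 0"
    show "x = 0"
    proof (rule total_gaussian_hat, rule inner_cscale_zero_imp_cinner_zero)
      fix t :: real and a b c assume "t > 0"
      then show "inner x (cscale c (l2_gaussian_hat t a b)) = 0"
        using *[of "(c, ln t, a, b)"] by (simp add: \<psi>_def)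
    qed
  qed
  then obtain U where U: "linear U" "\<forall>x. norm (U x) = norm x" "surj U" "\<And>i. U (\<phi> i) = \<psi> i" by blast
  have "U (cscale c (l2_gaussian t a b)) = cscale c (l2_gaussian_hat t a b)" if "t > 0" for c t a b
    using U(4)[of "(c, ln t, a, b)"] that by (simp add: \<phi>_def \<psi>_def)
  with U show ?thesis by blast
qed

text \<open>The choice is immaterial, since a linear isometry is determined by its values on a total
  family that contains all complex multiples of its members.\<close>

definition fourier :: "'a::euclidean_space l2 \<Rightarrow> 'a l2" where
  "fourier = (SOME U. linear U \<and> (\<forall>x. norm (U x) = norm x) \<and> surj U \<and>
     (\<forall>c t a b. t > 0 \<longrightarrow> U (cscale c (l2_gaussian t a b)) = cscale c (l2_gaussian_hat t a b)))"

lemma linear_fourier: "linear fourier"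
  and norm_fourier [simp]: "norm (fourier x) = norm x"
  and surj_fourier: "surj fourier"
  and fourier_cscale_gaussian:
    "t > 0 \<Longrightarrow> fourier (cscale c (l2_gaussian t a b)) = cscale c (l2_gaussian_hat t a b)"
  using someI_ex[OF fourier_exists] unfolding fourier_def by blast+

lemma fourier_gaussian: "t > 0 \<Longrightarrow> fourier (l2_gaussian t a b) = l2_gaussian_hat t a b"
  using fourier_cscale_gaussian[of t 1] by simp

lemma fourier_add: "fourier (x + y) = fourier x + fourier y"
  using linear_fourier by (rule linear_add)

lemma fourier_diff: "fourier (x - y) = fourier x - fourier y"
  using linear_fourier by (rule linear_diff)

lemma fourier_sum: "fourier (sum f I) = (\<Sum>i\<in>I. fourier (f i))"
  using linear_fourier by (rule linear_sum)

lemma fourier_inner: "inner (fourier x) (fourier y) = inner x y"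
proof -
  have *: "inner u v = ((norm (u + v))\<^sup>2 - (norm u)\<^sup>2 - (norm v)\<^sup>2) / 2" for u v :: "'a l2"
    by (simp add: power2_norm_eq_inner inner_add_left inner_add_right inner_commute)
  show ?thesis unfolding *[of "fourier x"] *[of x] by (simp flip: fourier_add)
qed

lemma inner_cscale_left: "inner (cscale c x) y = inner x (cscale (cnj c) y)"
  by (simp add: inner_l2_def cinner_cscale_left cinner_cscale_right)

text \<open>The construction provides real linearity only. Complex scalars commute with
  \<open>fourier\<close> on Gaussians, and testing against transformed Gaussians moves the scalar
  \<open>c\<close> to that side as its conjugate.\<close>

lemma fourier_cscale: "fourier (cscale c x) = cscale c (fourier x)"
proof -
  have "fourier (cscale c x) - cscale c (fourier x) = 0"
  proof (rule total_gaussian_hat, rule inner_cscale_zero_imp_cinner_zero)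
    fix t :: real and a b :: 'a and d assume t: "t > 0"
    have "inner (fourier (cscale c x)) (cscale d (l2_gaussian_hat t a b)) = inner (cscale c x) (cscale d (l2_gaussian t a b))"
      using t by (simp only: fourier_cscale_gaussian[symmetric] fourier_inner)
    also have "\<dots> = inner (fourier x) (fourier (cscale (cnj c * d) (l2_gaussian t a b)))"
      by (simp add: inner_cscale_left cscale_cscale fourier_inner)
    also have "\<dots> = inner (cscale c (fourier x)) (cscale d (l2_gaussian_hat t a b))"
      using t by (simp add: inner_cscale_left cscale_cscale fourier_cscale_gaussian)
    finally show "inner (fourier (cscale c x) - cscale c (fourier x)) (cscale d (l2_gaussian_hat t a b)) = 0"
      by (simp add: inner_diff_left)
  qed
  then show ?thesis by simp
qed

lemma fourier_cinner: "cinner (fourier x) (fourier y) = cinner x y"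
  by (simp add: complex_eq_iff Re_cinner Im_cinner fourier_inner flip: fourier_cscale)

lemma inj_fourier: "inj fourier"
proof (rule injI)
  fix x y :: "'a l2" assume "fourier x = fourier y"
  then have "norm (fourier (x - y)) = 0" by (simp add: fourier_diff)
  then show "x = y" by simp
qed

lemma fourier_eq_iff: "fourier x = fourier y \<longleftrightarrow> x = y"
  using inj_fourier by (auto dest: injD)

definition ifourier :: "'a::euclidean_space l2 \<Rightarrow> 'a l2" where
  "ifourier = inv fourier"

lemma fourier_ifourier [simp]: "fourier (ifourier x) = x"
  unfolding ifourier_def by (rule surj_f_inv_f[OF surj_fourier])

lemma ifourier_fourier [simp]: "ifourier (fourier x) = x"
  unfolding ifourier_def by (rule inv_f_f[OF inj_fourier])

lemma norm_ifourier [simp]: "norm (ifourier x) = norm x"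
  using norm_fourier[of "ifourier x"] by simp

lemma ifourier_add: "ifourier (x + y) = ifourier x + ifourier y"
  by (simp add: fourier_add flip: fourier_eq_iff)

lemma ifourier_cscale: "ifourier (cscale c x) = cscale c (ifourier x)"
  by (simp add: fourier_cscale flip: fourier_eq_iff)

lemma fourier_eqI:
  assumes "\<And>t a b. t > 0 \<Longrightarrow> cinner g (l2_gaussian_hat t a b) = cinner f (l2_gaussian t a b)"
  shows "fourier f = g"
proof -
  have "fourier f - g = 0"
  proof (rule total_gaussian_hat)
    fix t :: real and a b :: 'a assume t: "t > 0"
    then show "cinner (fourier f - g) (l2_gaussian_hat t a b) = 0"
      using assms[OF t] fourier_cinner[of f "l2_gaussian t a b"]
      by (simp add: cinner_diff_left fourier_gaussian)
  qed
  then show ?thesis by simp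
qed

section \<open>Comparison of the unitary transform with the Fourier integral; translations\<close>

lemma fourier_integral_measurable [measurable]:
  assumes [measurable]: "f \<in> borel_measurable borel"
  shows "fourier_integral f \<in> borel_measurable borel"
  unfolding fourier_integral_def by measurable

lemma norm_fourier_integral_le:
  fixes f :: "'a::euclidean_space \<Rightarrow> complex"
  shows "cmod (fourier_integral f \<xi>) \<le> (1 / sqrt (2 * pi)) ^ DIM('a) * (LINT x|lborel. cmod (f x))"
proof -
  have "cmod (LINT x|lborel. iexp (- (\<xi> \<bullet> x)) * f x) \<le> (LINT x|lborel. cmod (iexp (- (\<xi> \<bullet> x)) * f x))"
    by (rule integral_norm_bound)
  then show ?thesis
    unfolding fourier_integral_def norm_mult by (intro mult_mono) (auto simp del: of_real_power)
qed

text \<open>Identifies a class with an explicit bounded function \<open>E\<close>, which is not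
  known beforehand to be square-integrable. The difference of the two becomes integrable after
  multiplication by a Gaussian, so the weighted criterion applies.\<close>

lemma rep_l2_eqI_gaussian:
  fixes u :: "'a::euclidean_space l2"
  assumes [measurable]: "E \<in> borel_measurable borel" and C: "\<And>x. cmod (E x) \<le> C"
    and eq: "\<And>t y. t > 0 \<Longrightarrow> cinner u (l2_gaussian t y 0) = (LINT x|lborel. E x * gaussian t y 0 x)"
  shows "AE x in lborel. rep_l2 u x = E x"
proof -
  have C0: "C \<ge> 0" using C[of undefined] norm_ge_zero order_trans by blast
  have Ei: "integrable lborel (\<lambda>x. E x * gaussian t y 0 x)" if "t > 0" for t y
  proof (rule Bochner_Integration.integrable_bound)
    show "integrable lborel (\<lambda>x. C * cmod (gaussian t y 0 x))"
      using integrable_norm[OF integrable_gaussian[OF that, of y 0]] by simp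
    show "AE x in lborel. norm (E x * gaussian t y 0 x) \<le> norm (C * cmod (gaussian t y 0 x))"
      using C0 by (intro AE_I2) (simp add: norm_mult abs_mult mult_right_mono C)
  qed measurable
  have ui: "integrable lborel (\<lambda>x. rep_l2 u x * gaussian t y 0 x)" if "t > 0" for t y
    by (rule integrable_times_gaussian) (use that in simp_all)
  have "AE x in lborel. rep_l2 u x - E x = 0"
  proof (rule gaussian_weighted_zero_imp_AE)
    show "integrable lborel (\<lambda>x. (rep_l2 u x - E x) * gaussian 1 0 0 x)"
      using ui[of 1] Ei[of 1] by (simp add: left_diff_distrib)
    fix t :: real and y :: 'a assume t: "t > 0"
    have "cinner u (l2_gaussian t y 0) = (LINT x|lborel. rep_l2 u x * gaussian t y 0 x)"
      using t by (simp add: l2_gaussian_def cinner_rep_abs square_integrable_gaussian cnj_gaussian)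
    then show "(LINT x|lborel. (rep_l2 u x - E x) * gaussian t y 0 x) = 0"
      using ui[OF t] Ei[OF t] eq[OF t, of y] by (simp add: left_diff_distrib)
  qed
  then show ?thesis by simp
qed

lemma rep_ifourier:
  fixes g :: "'a::euclidean_space \<Rightarrow> complex"
  assumes g: "integrable lborel g" "square_integrable g"
  shows "AE x in lborel. rep_l2 (ifourier (abs_l2 g)) x = fourier_integral g (- x)"
proof (rule rep_l2_eqI_gaussian[OF _ norm_fourier_integral_le])
  have [measurable]: "g \<in> borel_measurable borel" using g(1) by simp
  show "(\<lambda>x. fourier_integral g (- x)) \<in> borel_measurable borel"
    by (rule measurable_compose[OF _ fourier_integral_measurable]) auto
  fix t :: real and y :: 'a assume t: "t > 0"
  have "cinner (ifourier (abs_l2 g)) (l2_gaussian t y 0) = cinner (abs_l2 g) (l2_gaussian_hat t y 0)"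
    using fourier_cinner[of "ifourier (abs_l2 g)" "l2_gaussian t y 0"] t by (simp add: fourier_gaussian)
  also have "\<dots> = (LINT \<xi>|lborel. g \<xi> * fourier_integral (gaussian t y 0) (- \<xi>))"
    using t g by (simp add: l2_gaussian_hat_def cinner_abs square_integrable_fourier_gaussian fourier_integral_cnj
        cnj_gaussian)
  also have "\<dots> = (LINT x|lborel. fourier_integral g (- x) * gaussian t y 0 x)"
  proof -
    have "(LINT x|lborel. (LINT \<xi>|lborel. iexp (x \<bullet> \<xi>) * g \<xi>) * gaussian t y 0 x)
      = (LINT \<xi>|lborel. g \<xi> * (LINT x|lborel. iexp (x \<bullet> \<xi>) * gaussian t y 0 x))"
      by (rule kernel_Fubini(3)[where C=1])
        (use g integrable_gaussian[OF t] in \<open>auto intro: sigma_finite_lborel\<close>)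
    then show ?thesis
      by (simp add: fourier_integral_def mult.assoc mult.left_commute[of "g _"] inner_commute)
  qed
  finally show "cinner (ifourier (abs_l2 g)) (l2_gaussian t y 0) = (LINT x|lborel. fourier_integral g (- x) * gaussian t y 0 x)" .
qed

lemma square_integrable_bounded_mult:
  assumes "square_integrable f" and [measurable]: "m \<in> borel_measurable borel"
    and bd: "\<And>x. cmod (m x) \<le> C"
  shows "square_integrable (\<lambda>x. m x * f x)"
  unfolding square_integrable_def
proof
  have [measurable]: "f \<in> borel_measurable borel" using assms(1) by (rule square_integrable_measurable)
  show "(\<lambda>x. m x * f x) \<in> borel_measurable lborel" by measurable
  show "integrable lborel (\<lambda>x. (cmod (m x * f x))\<^sup>2)"
  proof (rule Bochner_Integration.integrable_bound)
    show "integrable lborel (\<lambda>x. C\<^sup>2 * (cmod (f x))\<^sup>2)" using assms(1) by (simp add: square_integrable_def)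
    show "AE x in lborel. norm ((cmod (m x * f x))\<^sup>2) \<le> norm (C\<^sup>2 * (cmod (f x))\<^sup>2)"
      using bd by (auto simp: norm_mult power_mult_distrib intro!: mult_right_mono power_mono)
  qed measurable
qed

lemma square_integrable_translate:
  assumes "square_integrable f"
  shows "square_integrable (\<lambda>x. f (x + h))"
proof -
  have [measurable]: "f \<in> borel_measurable borel" using assms by (rule square_integrable_measurable)
  show ?thesis
    unfolding square_integrable_def
  proof
    have "integrable lborel (\<lambda>x. (cmod (f x))\<^sup>2)" using assms by (simp add: square_integrable_def)
    then have "integrable lborel (\<lambda>x. (cmod (f (h + 1 *\<^sub>R x)))\<^sup>2)"
      by (subst lborel_integral_affine(1)[of _ 1 h, symmetric]) auto
    then show "integrable lborel (\<lambda>x. (cmod (f (x + h)))\<^sup>2)" by (simp add: add.commute)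
  qed measurable
qed

lemma gaussian_translate: "gaussian t a b (x - h) = iexp (- (b \<bullet> h)) * gaussian t (a + h) b x"
  by (simp add: gaussian_def exp_add[symmetric] inner_diff_right algebra_simps)

text \<open>On transformed Gaussians the character acts as a shift of the centre by \<open>h\<close>
  up to a phase, and on Gaussians the shift of the centre is the translation. The result makes the
  transform of a difference quotient explicit.\<close>

lemma fourier_translate:
  fixes f :: "'a::euclidean_space \<Rightarrow> complex"
  assumes f: "square_integrable f"
  shows "fourier (abs_l2 (\<lambda>x. f (x + h))) = abs_l2 (\<lambda>\<xi>. iexp (h \<bullet> \<xi>) * rep_l2 (fourier (abs_l2 f)) \<xi>)"
proof (rule fourier_eqI)
  fix t :: real and a b :: 'a assume t: "t > 0"
  have [measurable]: "f \<in> borel_measurable borel" using f by (rule square_integrable_measurable)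
  define F where "F = fourier (abs_l2 f)"
  have hat: "iexp (- (h \<bullet> \<xi>)) * fourier_integral (gaussian t a b) \<xi>
      = iexp (- (b \<bullet> h)) * fourier_integral (gaussian t (a + h) b) \<xi>" for \<xi>
    using t by (simp add: fourier_integral_gaussian gaussian_def exp_add[symmetric] inner_add_left inner_add_right
        inner_commute algebra_simps)
  have "cinner (abs_l2 (\<lambda>\<xi>. iexp (h \<bullet> \<xi>) * rep_l2 F \<xi>)) (l2_gaussian_hat t a b)
      = (LINT \<xi>|lborel. iexp (h \<bullet> \<xi>) * rep_l2 F \<xi> * cnj (fourier_integral (gaussian t a b) \<xi>))"
    unfolding l2_gaussian_hat_def using t
    by (intro cinner_abs square_integrable_fourier_gaussian square_integrable_bounded_mult[where C=1]) auto
  also have "\<dots> = (LINT \<xi>|lborel. rep_l2 F \<xi> * cnj (iexp (- (h \<bullet> \<xi>)) * fourier_integral (gaussian t a b) \<xi>))"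
    by (simp add: exp_cnj mult_ac)
  also have "\<dots> = (LINT \<xi>|lborel. rep_l2 F \<xi> * cnj (iexp (- (b \<bullet> h)) * fourier_integral (gaussian t (a + h) b) \<xi>))"
    unfolding hat ..
  also have "\<dots> = cinner F (cscale (iexp (- (b \<bullet> h))) (l2_gaussian_hat t (a + h) b))"
    using t by (simp add: l2_gaussian_hat_def cinner_rep_abs square_integrable_fourier_gaussian
        square_integrable_scale flip: abs_l2_cscale)
  also have "\<dots> = cinner (abs_l2 f) (cscale (iexp (- (b \<bullet> h))) (l2_gaussian t (a + h) b))"
    unfolding F_def using t by (simp only: fourier_cscale_gaussian[symmetric] fourier_cinner)
  also have "\<dots> = (LINT x|lborel. f x * cnj (gaussian t a b (x - h)))"
    unfolding gaussian_translate
    using t f by (simp add: l2_gaussian_def cinner_abs square_integrable_gaussian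
        square_integrable_scale flip: abs_l2_cscale)
  also have "\<dots> = (LINT x|lborel. f (x + h) * cnj (gaussian t a b x))"
    by (subst lborel_integral_affine(2)[of _ 1 h]) (auto simp: add.commute)
  also have "\<dots> = cinner (abs_l2 (\<lambda>x. f (x + h))) (l2_gaussian t a b)"
    using t f by (simp add: l2_gaussian_def cinner_abs square_integrable_gaussian square_integrable_translate)
  finally show "cinner (abs_l2 (\<lambda>\<xi>. iexp (h \<bullet> \<xi>) * rep_l2 (fourier (abs_l2 f)) \<xi>)) (l2_gaussian_hat t a b)
    = cinner (abs_l2 (\<lambda>x. f (x + h))) (l2_gaussian t a b)" by (simp add: F_def)
qed

section \<open>Smooth functions of product form\<close>

text \<open>The classical smooth function vanishing on the negative half-line is the case
  \<open>n = 0\<close>. The powers of \<open>t\<close> are included to close the family under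
  differentiation, which raises \<open>n\<close> by one or two.\<close>

definition flat_exp :: "nat \<Rightarrow> real \<Rightarrow> real" where
  "flat_exp n t = (if t > 0 then exp (- (1 / t)) / t ^ n else 0)"

lemma flat_exp_nonneg: "0 \<le> flat_exp n t"
  by (simp add: flat_exp_def)

lemma flat_exp_0_le: "flat_exp 0 t \<le> 1"
  by (simp add: flat_exp_def)

lemma flat_exp_2_le: "flat_exp 2 t \<le> 2"
proof (cases "t > 0")
  case True
  define u where "u = 1 / t"
  have u: "u > 0" using True by (simp add: u_def)
  have "u\<^sup>2 \<le> 2 * exp u" using exp_lower_Taylor_quadratic[of u] u by simp
  then have "u\<^sup>2 * exp (- u) \<le> 2 * exp u * exp (- u)" by (intro mult_right_mono) auto
  then have "u\<^sup>2 * exp (- u) \<le> 2" by (simp add: mult.assoc flip: exp_add)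
  moreover have "flat_exp 2 t = u\<^sup>2 * exp (- u)" using True by (simp add: flat_exp_def u_def power_divide)
  ultimately show ?thesis by simp
qed (simp add: flat_exp_def)

text \<open>Differentiability at 0, the only delicate point. For positive \<open>h\<close> and
  \<open>u = 1 / h\<close> the quotient is \<open>u ^ Suc n / exp u\<close>; for negative
  \<open>h\<close> it is identically 0.\<close>

lemma flat_exp_quotient_tendsto: "((\<lambda>h. flat_exp n h / h) \<longlongrightarrow> 0) (at 0)"
proof -
  have "((\<lambda>h. (inverse h) ^ Suc n / exp (inverse h)) \<longlongrightarrow> (0::real)) (at_right 0)"
    by (rule filterlim_compose[OF tendsto_power_div_exp_0 filterlim_inverse_at_top_right])
  moreover have "eventually (\<lambda>h. (inverse h) ^ Suc n / exp (inverse h) = flat_exp n h / h) (at_right (0::real))"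
    by (auto simp: eventually_at_right_field flat_exp_def exp_minus field_simps intro!: exI[of _ 1])
  ultimately have "((\<lambda>h. flat_exp n h / h) \<longlongrightarrow> 0) (at_right 0)"
    by (rule Lim_transform_eventually)
  moreover have "((\<lambda>h. flat_exp n h / h) \<longlongrightarrow> 0) (at_left 0)"
    by (rule tendsto_eventually) (auto simp: eventually_at_left_field flat_exp_def intro!: exI[of _ "-1"])
  ultimately show ?thesis by (simp add: filterlim_split_at)
qed

lemma flat_exp_deriv:
  "(flat_exp n has_real_derivative flat_exp (n + 2) t - real n * flat_exp (Suc n) t) (at t)"
proof -
  consider "t > 0" | "t < 0" | "t = 0" by linarith
  then show ?thesis
  proof cases
    case 1
    have i: "(inverse has_real_derivative - ((inverse t)\<^sup>2)) (at t)"
      using 1 DERIV_inverse[of t] by (simp add: numeral_2_eq_2)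
    have e: "((\<lambda>t. exp (- inverse t)) has_real_derivative exp (- inverse t) * (inverse t)\<^sup>2) (at t)"
      using DERIV_chain2[OF DERIV_exp DERIV_minus[OF i]] by simp
    have "((\<lambda>t. exp (- inverse t) * inverse t ^ n) has_real_derivative flat_exp (n + 2) t - real n * flat_exp (Suc n) t) (at t)"
      using DERIV_mult[OF e DERIV_power[OF i, of n]] 1
      by (cases n) (simp_all add: flat_exp_def divide_inverse power_inverse[symmetric] algebra_simps power2_eq_square)
    then show ?thesis
    proof (rule has_field_derivative_transform_within_open)
      show "open {0::real<..}" "t \<in> {0<..}" using 1 by auto
    qed (simp add: flat_exp_def divide_inverse power_inverse)
  next
    case 2
    have "((\<lambda>_. 0) has_real_derivative flat_exp (n + 2) t - real n * flat_exp (Suc n) t) (at t)"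
      using 2 by (simp add: flat_exp_def)
    then show ?thesis
    proof (rule has_field_derivative_transform_within_open)
      show "open {..<0::real}" "t \<in> {..<0}" using 2 by auto
    qed (simp add: flat_exp_def)
  next
    case 3
    then show ?thesis using flat_exp_quotient_tendsto[of n]
      by (simp add: has_field_derivative_iff flat_exp_def)
  qed
qed

text \<open>Smoothness in the sense of \<^const>\<open>iterated_partial\<close> is obtained from a class of functions of one
  variable that is closed under differentiation.\<close>

inductive_set smooth1 :: "(real \<Rightarrow> complex) set" where
  const: "(\<lambda>_. c) \<in> smooth1"
| ident: "(\<lambda>t. of_real t) \<in> smooth1"
| flat: "(\<lambda>t. of_real (flat_exp n (k + s * t))) \<in> smooth1"
| gauss: "(\<lambda>s. exp (of_real (- t * (s - a)\<^sup>2 / 2) + \<i> * of_real (\<beta> * s))) \<in> smooth1"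
| add: "F \<in> smooth1 \<Longrightarrow> G \<in> smooth1 \<Longrightarrow> (\<lambda>t. F t + G t) \<in> smooth1"
| mult: "F \<in> smooth1 \<Longrightarrow> G \<in> smooth1 \<Longrightarrow> (\<lambda>t. F t * G t) \<in> smooth1"

lemma smooth1_deriv:
  "F \<in> smooth1 \<Longrightarrow> \<exists>F'\<in>smooth1. \<forall>t. (F has_vector_derivative F' t) (at t)"
proof (induction rule: smooth1.induct)
  case (const c)
  show ?case by (intro bexI[of _ "\<lambda>_. 0"]) (auto intro: smooth1.const)
next
  case ident
  show ?case by (intro bexI[of _ "\<lambda>_. 1"])
      (auto intro: smooth1.const has_vector_derivative_of_real[of "\<lambda>x. x" 1, simplified])
next
  case (flat n k s)
  define F' where "F' = (\<lambda>t. of_real s * of_real (flat_exp (n + 2) (k + s * t)) + of_real (- s * real n) * of_real (flat_exp (Suc n) (k + s * t)) :: complex)"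
  have "F' \<in> smooth1" unfolding F'_def by (intro smooth1.intros)
  moreover have "((\<lambda>t. complex_of_real (flat_exp n (k + s * t))) has_vector_derivative F' t) (at t)" for t
  proof -
    have "((\<lambda>t. flat_exp n (k + s * t)) has_real_derivative
        (flat_exp (n + 2) (k + s * t) - real n * flat_exp (Suc n) (k + s * t)) * s) (at t)"
      by (rule DERIV_chain2[OF flat_exp_deriv]) (auto intro!: derivative_eq_intros)
    then have "((\<lambda>t. complex_of_real (flat_exp n (k + s * t))) has_vector_derivative
        of_real ((flat_exp (n + 2) (k + s * t) - real n * flat_exp (Suc n) (k + s * t)) * s)) (at t)"
      by (intro has_vector_derivative_of_real) (simp add: has_real_derivative_iff_has_vector_derivative)
    then show ?thesis by (simp add: F'_def algebra_simps)
  qed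
  ultimately show ?case by blast
next
  case (gauss t a \<beta>)
  define E where "E = (\<lambda>s. exp (of_real (- t * (s - a)\<^sup>2 / 2) + \<i> * of_real (\<beta> * s)) :: complex)"
  define F' where "F' = (\<lambda>s. (of_real (- t) * of_real s + (of_real (t * a) + \<i> * of_real \<beta>)) * E s :: complex)"
  have "F' \<in> smooth1" unfolding F'_def E_def by (intro smooth1.intros)
  moreover have "(E has_vector_derivative F' s) (at s)" for s
  proof -
    \<comment> \<open>The derivative is computed for the entire function of a complex variable and
      then restricted to the real axis.\<close>
    have "((\<lambda>z. exp (- of_real t * (z - of_real a)\<^sup>2 / 2 + \<i> * (of_real \<beta> * z))) has_field_derivative F' s) (at (of_real s))"
      by (auto intro!: derivative_eq_intros simp: F'_def E_def algebra_simps diff_divide_distrib)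
    from has_vector_derivative_real_field[OF this]
    show ?thesis by (simp add: E_def)
  qed
  ultimately show ?case unfolding E_def by blast
next
  case (add F G)
  then obtain F' G' where "F' \<in> smooth1" "G' \<in> smooth1" "\<And>t. (F has_vector_derivative F' t) (at t)"
    "\<And>t. (G has_vector_derivative G' t) (at t)" by blast
  then show ?case
    by (intro bexI[of _ "\<lambda>t. F' t + G' t"]) (auto intro: smooth1.intros has_vector_derivative_add)
next
  case (mult F G)
  then obtain F' G' where "F' \<in> smooth1" "G' \<in> smooth1" "\<And>t. (F has_vector_derivative F' t) (at t)"
    "\<And>t. (G has_vector_derivative G' t) (at t)" by blast
  then show ?case using mult.hyps
    by (intro bexI[of _ "\<lambda>t. F t * G' t + F' t * G t"]) (auto intro: smooth1.intros has_vector_derivative_mult)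
qed

section \<open>Functions that factor over the coordinates\<close>

definition prod_fun :: "('a::euclidean_space \<Rightarrow> real \<Rightarrow> complex) \<Rightarrow> 'a \<Rightarrow> complex" where
  "prod_fun F x = (\<Prod>b\<in>Basis. F b (x \<bullet> b))"

lemma prod_fun_has_derivative:
  assumes "\<And>b t. b \<in> Basis \<Longrightarrow> (F b has_vector_derivative F' b t) (at t)"
  shows "(prod_fun F has_derivative
    (\<lambda>h. \<Sum>b\<in>Basis. ((h \<bullet> b) *\<^sub>R F' b (x \<bullet> b)) * (\<Prod>c\<in>Basis - {b}. F c (x \<bullet> c)))) (at x)"
  unfolding prod_fun_def
proof (rule has_derivative_prod)
  fix b :: 'a assume b: "b \<in> Basis"
  have "(F b has_derivative (\<lambda>h. h *\<^sub>R F' b (x \<bullet> b))) (at (x \<bullet> b))"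
    using assms[OF b] by (simp add: has_vector_derivative_def)
  moreover have "((\<lambda>x. x \<bullet> b) has_derivative (\<lambda>h. h \<bullet> b)) (at x)"
    by (auto intro!: derivative_eq_intros)
  ultimately
  show "((\<lambda>x. F b (x \<bullet> b)) has_derivative (\<lambda>h. (h \<bullet> b) *\<^sub>R F' b (x \<bullet> b))) (at x)"
    by (rule has_derivative_compose[rotated])
qed

text \<open>A partial derivative affects a single factor and leaves the product form intact; the
  induction over iterated partial derivatives rests on this.\<close>

lemma frechet_derivative_prod_fun:
  assumes F: "\<And>b t. b \<in> Basis \<Longrightarrow> (F b has_vector_derivative F' b t) (at t)" and b: "b \<in> Basis"
  shows "frechet_derivative (prod_fun F) (at x) b = prod_fun (F(b := F' b)) x"
proof -
  have "frechet_derivative (prod_fun F) (at x) b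
      = (\<Sum>c\<in>Basis. ((b \<bullet> c) *\<^sub>R F' c (x \<bullet> c)) * (\<Prod>d\<in>Basis - {c}. F d (x \<bullet> d)))"
    using frechet_derivative_at[OF prod_fun_has_derivative[OF F, where x=x], symmetric] by simp
  also have "\<dots> = F' b (x \<bullet> b) * (\<Prod>d\<in>Basis - {b}. F d (x \<bullet> d))"
    using b by (subst sum.remove[OF _ b]) (auto simp: inner_Basis intro!: sum.neutral split: if_splits)
  also have "\<dots> = prod_fun (F(b := F' b)) x"
    unfolding prod_fun_def using b by (subst prod.remove[OF _ b]) (auto intro!: prod.cong)
  finally show ?thesis .
qed

lemma smooth1_deriv_family:
  assumes "\<forall>b\<in>B. F b \<in> smooth1"
  shows "\<exists>F'. (\<forall>b\<in>B. F' b \<in> smooth1) \<and> (\<forall>b\<in>B. \<forall>t. (F b has_vector_derivative F' b t) (at t))"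
proof -
  have "\<forall>b\<in>B. \<exists>F'. F' \<in> smooth1 \<and> (\<forall>t. (F b has_vector_derivative F' t) (at t))"
    using assms smooth1_deriv by blast
  from bchoice[OF this] show ?thesis by blast
qed

lemma smooth_prod_fun:
  assumes "set bs \<subseteq> Basis" "\<forall>b\<in>Basis. F b \<in> smooth1"
  shows "iterated_partial bs (prod_fun F) differentiable_on UNIV"
  using assms
proof (induction bs arbitrary: F)
  case Nil
  from smooth1_deriv_family[OF Nil.prems(2)] obtain F'
    where F': "\<forall>b\<in>Basis. \<forall>t. (F b has_vector_derivative F' b t) (at t)" by (elim exE conjE)
  from prod_fun_has_derivative[of F F'] F' show ?case
    by (auto simp: differentiable_on_def differentiable_def)
next
  case (Cons b bs)
  from smooth1_deriv_family[OF Cons.prems(2)] obtain F'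
    where F': "\<forall>b\<in>Basis. F' b \<in> smooth1" "\<forall>b\<in>Basis. \<forall>t. (F b has_vector_derivative F' b t) (at t)"
    by (elim exE conjE)
  have b: "b \<in> Basis" using Cons.prems by simp
  have "(\<lambda>x. frechet_derivative (prod_fun F) (at x) b) = prod_fun (F(b := F' b))"
    by (rule ext, rule frechet_derivative_prod_fun) (use F' b in auto)
  moreover have "\<forall>c\<in>Basis. (F(b := F' b)) c \<in> smooth1" using Cons.prems F' b by simp
  then have "iterated_partial bs (prod_fun (F(b := F' b))) differentiable_on UNIV"
    using Cons.prems(1) by (intro Cons.IH) auto
  ultimately show ?case by simp
qed

text \<open>As soon as one coordinate leaves the interval from \<open>-k\<close> to \<open>k\<close>
  a factor vanishes, so the support lies in a cube.\<close>

lemma test_function_prod_fun: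
  assumes "\<And>b. b \<in> Basis \<Longrightarrow> F b \<in> smooth1" and "\<And>b t. b \<in> Basis \<Longrightarrow> \<bar>t\<bar> > k \<Longrightarrow> F b t = 0"
  shows "test_function (prod_fun F)"
  unfolding test_function_def
proof (intro conjI allI impI)
  show "iterated_partial bs (prod_fun F) differentiable_on UNIV" if "set bs \<subseteq> Basis" for bs
    using that assms(1) by (intro smooth_prod_fun) auto
  have "{x. prod_fun F x \<noteq> 0} \<subseteq> cbox (- (k *\<^sub>R One)) (k *\<^sub>R One)"
  proof
    fix x assume "x \<in> {x. prod_fun F x \<noteq> 0}"
    then have "F b (x \<bullet> b) \<noteq> 0" if "b \<in> Basis" for b using that by (auto simp: prod_fun_def)
    then have "\<bar>x \<bullet> b\<bar> \<le> k" if "b \<in> Basis" for b using assms(2)[OF that, of "x \<bullet> b"] that by force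
    then show "x \<in> cbox (- (k *\<^sub>R One)) (k *\<^sub>R One)" by (force simp: mem_box abs_le_iff)
  qed
  then have "bounded {x. prod_fun F x \<noteq> 0}" using bounded_cbox bounded_subset by blast
  then show "compact (closure {x. prod_fun F x \<noteq> 0})" by simp
qed

section \<open>Smooth cutoffs on the line\<close>

definition cutoff1 :: "real \<Rightarrow> real \<Rightarrow> complex" where
  "cutoff1 k s = of_real (flat_exp 0 (k + 1 * s)) * of_real (flat_exp 0 (k + (-1) * s))"

definition cutoff1' :: "real \<Rightarrow> real \<Rightarrow> complex" where
  "cutoff1' k s = of_real (flat_exp 2 (k + s) * flat_exp 0 (k - s) - flat_exp 0 (k + s) * flat_exp 2 (k - s))"

text \<open>The coefficients \<open>1\<close> and \<open>(-1)\<close> are spelled out in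
  \<open>cutoff1\<close> so that both factors match the rule \<open>smooth1.flat\<close>.\<close>

lemma cutoff1_smooth: "cutoff1 k \<in> smooth1"
  unfolding cutoff1_def by (intro smooth1.intros)

lemma cutoff1_deriv: "(cutoff1 k has_vector_derivative cutoff1' k s) (at s)"
proof -
  have d: "(flat_exp 0 has_real_derivative flat_exp 2 t) (at t)" for t
    using flat_exp_deriv[of 0 t] by (simp add: numeral_2_eq_2)
  have 1: "((\<lambda>s. flat_exp 0 (k + s)) has_real_derivative flat_exp 2 (k + s) * 1) (at s)"
    by (rule DERIV_chain2[OF d]) (auto intro!: derivative_eq_intros)
  have 2: "((\<lambda>s. flat_exp 0 (k - s)) has_real_derivative flat_exp 2 (k - s) * (-1)) (at s)"
    by (rule DERIV_chain2[OF d]) (auto intro!: derivative_eq_intros)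
  have "((\<lambda>s. complex_of_real (flat_exp 0 (k + s) * flat_exp 0 (k - s))) has_vector_derivative cutoff1' k s) (at s)"
    unfolding cutoff1'_def
    by (intro has_vector_derivative_of_real)
      (use DERIV_mult[OF 1 2] in \<open>simp add: has_real_derivative_iff_has_vector_derivative algebra_simps\<close>)
  then show ?thesis by (simp add: cutoff1_def[abs_def])
qed

lemma norm_cutoff1_le: "cmod (cutoff1 k s) \<le> 1"
  using flat_exp_0_le flat_exp_nonneg by (auto simp: cutoff1_def norm_mult intro!: mult_le_one)

lemma norm_cutoff1'_le: "cmod (cutoff1' k s) \<le> 4"
proof -
  have m: "flat_exp 2 a * flat_exp 0 b \<le> 2 * 1" "0 \<le> flat_exp 2 a * flat_exp 0 b" for a b
    by (intro mult_mono flat_exp_2_le flat_exp_0_le flat_exp_nonneg mult_nonneg_nonneg; simp)+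
  show ?thesis
    unfolding cutoff1'_def norm_of_real
    using m[of "k + s" "k - s"] m[of "k - s" "k + s"] by (simp add: mult.commute)
qed

lemma flat_exp_tendsto: "(\<lambda>k. flat_exp 0 (real k + s)) \<longlonglongrightarrow> 1" "(\<lambda>k. flat_exp 2 (real k + s)) \<longlonglongrightarrow> 0"
proof -
  have pos: "eventually (\<lambda>k. real k + s > 0) sequentially"
    using eventually_gt_at_top[of "nat \<lceil>- s\<rceil>"] by eventually_elim linarith
  have "(\<lambda>k. exp (- (1 / (real k + s)))) \<longlonglongrightarrow> 1" by real_asymp
  then show "(\<lambda>k. flat_exp 0 (real k + s)) \<longlonglongrightarrow> 1"
    by (rule Lim_transform_eventually) (use pos in \<open>eventually_elim, simp add: flat_exp_def\<close>)
  have "(\<lambda>k. exp (- (1 / (real k + s))) / (real k + s) ^ 2) \<longlonglongrightarrow> 0" by real_asymp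
  then show "(\<lambda>k. flat_exp 2 (real k + s)) \<longlonglongrightarrow> 0"
    by (rule Lim_transform_eventually) (use pos in \<open>eventually_elim, simp add: flat_exp_def\<close>)
qed

text \<open>The cutoffs have no plateau: they stay below 1 and approach it because
  \<open>exp (- 1 / t)\<close> tends to 1 as \<open>t\<close> grows. Together with the uniform
  bounds 1 and 4 on the cutoff and its derivative this is enough for dominated convergence.\<close>

lemma cutoff1_tendsto: "(\<lambda>k. cutoff1 (real k) s) \<longlonglongrightarrow> 1"
proof -
  have "(\<lambda>k. complex_of_real (flat_exp 0 (real k + s)) * of_real (flat_exp 0 (real k + - s))) \<longlonglongrightarrow> of_real 1 * of_real 1"
    by (intro tendsto_intros flat_exp_tendsto)
  then show ?thesis by (simp add: cutoff1_def)
qed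

lemma cutoff1'_tendsto: "(\<lambda>k. cutoff1' (real k) s) \<longlonglongrightarrow> 0"
proof -
  have "(\<lambda>k. complex_of_real (flat_exp 2 (real k + s) * flat_exp 0 (real k + - s) - flat_exp 0 (real k + s) * flat_exp 2 (real k + - s)))
    \<longlonglongrightarrow> of_real (0 * 1 - 1 * 0)"
    by (intro tendsto_intros flat_exp_tendsto)
  then show ?thesis by (simp add: cutoff1'_def)
qed

lemma cutoff1_eq_0: "\<bar>s\<bar> > k \<Longrightarrow> cutoff1 k s = 0"
  by (auto simp: cutoff1_def flat_exp_def)

section \<open>Derivatives of Gaussians\<close>

definition gaussian_deriv :: "'a::euclidean_space \<Rightarrow> real \<Rightarrow> 'a \<Rightarrow> 'a \<Rightarrow> 'a \<Rightarrow> complex" where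
  "gaussian_deriv h t a \<beta> x = (of_real (- t * ((x - a) \<bullet> h)) + \<i> * of_real (\<beta> \<bullet> h)) * gaussian t a \<beta> x"

lemma gaussian_deriv_measurable [measurable]: "gaussian_deriv h t a \<beta> \<in> borel_measurable borel"
  unfolding gaussian_deriv_def by measurable

lemma gaussian_has_derivative:
  "(gaussian t a \<beta> has_derivative (\<lambda>h. gaussian_deriv h t a \<beta> x)) (at x)"
proof -
  define q where "q x = complex_of_real (- t * ((x - a) \<bullet> (x - a)) / 2) + \<i> * of_real (\<beta> \<bullet> x)" for x
  have q: "(q has_derivative (\<lambda>h. of_real (- t * ((x - a) \<bullet> h)) + \<i> * of_real (\<beta> \<bullet> h))) (at x)"
    unfolding q_def
    by (auto intro!: derivative_eq_intros simp: fun_eq_iff inner_commute algebra_simps diff_divide_distrib)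
  have "((\<lambda>x. exp (q x)) has_derivative (\<lambda>h. (of_real (- t * ((x - a) \<bullet> h)) + \<i> * of_real (\<beta> \<bullet> h)) * exp (q x))) (at x)"
    using has_derivative_compose[OF q DERIV_exp[unfolded has_field_derivative_def]] by (simp add: mult.commute)
  moreover have "gaussian t a \<beta> = (\<lambda>x. exp (q x))"
    by (simp add: gaussian_def q_def power2_norm_eq_inner fun_eq_iff)
  ultimately show ?thesis by (simp add: gaussian_deriv_def)
qed

text \<open>The linear factor is absorbed by half of the exponential decay. With
  \<open>y = norm (x - a)\<close>, the quotient of the moduli of the Gaussians with parameters
  \<open>t / 2\<close> and \<open>t\<close> is \<open>e = exp (t y^2 / 4)\<close>, which is at least
  1 and dominates \<open>y\<close> up to a constant.\<close>

lemma gaussian_deriv_bound: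
  assumes t: "t > 0"
  shows "\<exists>C. \<forall>x. cmod (gaussian_deriv h t a \<beta> x) \<le> C * cmod (gaussian (t / 2) a 0 x)"
proof (intro exI allI)
  fix x
  define y where "y = norm (x - a)"
  have y: "y \<ge> 0" by (simp add: y_def)
  define e where "e = exp (t * y\<^sup>2 / 4)"
  have e1: "e \<ge> 1" using t by (simp add: e_def)
  have "t * y\<^sup>2 / 4 \<le> e" unfolding e_def using exp_ge_add_one_self[of "t * y\<^sup>2 / 4"] by linarith
  then have y2: "y\<^sup>2 \<le> (4 / t) * e" using t by (simp add: field_simps)
  have "y \<le> 1 + y\<^sup>2" using sum_squares_bound[of 1 y] y by (simp add: power2_eq_square)
  then have ye: "y \<le> (1 + 4 / t) * e" using y2 e1 by (simp add: algebra_simps)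
  have "cmod (of_real (- t * ((x - a) \<bullet> h)) + \<i> * of_real (\<beta> \<bullet> h)) \<le> t * \<bar>(x - a) \<bullet> h\<bar> + \<bar>\<beta> \<bullet> h\<bar>"
    using norm_triangle_ineq[of "complex_of_real (- t * ((x - a) \<bullet> h))" "\<i> * of_real (\<beta> \<bullet> h)"] t
    by (simp add: norm_mult abs_mult)
  also have "\<dots> \<le> t * (y * norm h) + \<bar>\<beta> \<bullet> h\<bar>"
    using t Cauchy_Schwarz_ineq2[of "x - a" h] by (intro add_mono mult_left_mono) (auto simp: y_def)
  also have "\<dots> \<le> t * ((1 + 4 / t) * e * norm h) + \<bar>\<beta> \<bullet> h\<bar> * e"
  proof (rule add_mono)
    show "t * (y * norm h) \<le> t * ((1 + 4 / t) * e * norm h)"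
      using t by (intro mult_left_mono mult_right_mono ye) auto
    show "\<bar>\<beta> \<bullet> h\<bar> \<le> \<bar>\<beta> \<bullet> h\<bar> * e" using mult_left_mono[OF e1, of "\<bar>\<beta> \<bullet> h\<bar>"] by simp
  qed
  also have "\<dots> = (t * (1 + 4 / t) * norm h + \<bar>\<beta> \<bullet> h\<bar>) * e" by (simp add: algebra_simps)
  finally have "cmod (gaussian_deriv h t a \<beta> x) \<le> (t * (1 + 4 / t) * norm h + \<bar>\<beta> \<bullet> h\<bar>) * e * cmod (gaussian t a \<beta> x)"
    unfolding gaussian_deriv_def norm_mult by (rule mult_right_mono) simp
  moreover have "e * cmod (gaussian t a \<beta> x) = cmod (gaussian (t / 2) a 0 x)"
    by (simp add: e_def norm_gaussian y_def flip: exp_add)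
  ultimately show "cmod (gaussian_deriv h t a \<beta> x) \<le> (t * (1 + 4 / t) * norm h + \<bar>\<beta> \<bullet> h\<bar>) * cmod (gaussian (t / 2) a 0 x)"
    by (simp only: mult.assoc)
qed

lemma integrable_gaussian_deriv:
  assumes "t > 0"
  shows "integrable lborel (gaussian_deriv h t a \<beta>)"
proof -
  obtain C where C: "\<And>x. cmod (gaussian_deriv h t a \<beta> x) \<le> C * cmod (gaussian (t / 2) a 0 x)"
    using gaussian_deriv_bound[OF assms] by metis
  show ?thesis
  proof (rule Bochner_Integration.integrable_bound)
    show "integrable lborel (\<lambda>x. C * cmod (gaussian (t / 2) a 0 x))"
      using integrable_norm[OF integrable_gaussian[of "t / 2" a 0]] assms by simp
    show "AE x in lborel. norm (gaussian_deriv h t a \<beta> x) \<le> norm (C * cmod (gaussian (t / 2) a 0 x))"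
      using C order_trans[OF C abs_ge_self] by auto
  qed measurable
qed

lemma square_integrable_dominated:
  assumes g: "square_integrable g" and [measurable]: "f \<in> borel_measurable borel"
    and le: "\<And>x. cmod (f x) \<le> C * cmod (g x)"
  shows "square_integrable f"
  unfolding square_integrable_def
proof
  have [measurable]: "g \<in> borel_measurable borel" using g by (rule square_integrable_measurable)
  show "integrable lborel (\<lambda>x. (cmod (f x))\<^sup>2)"
  proof (rule Bochner_Integration.integrable_bound)
    show "integrable lborel (\<lambda>x. C\<^sup>2 * (cmod (g x))\<^sup>2)" using g by (simp add: square_integrable_def)
    have "(cmod (f x))\<^sup>2 \<le> (C * cmod (g x))\<^sup>2" for x
      by (rule power_mono[OF le]) simp
    then show "AE x in lborel. norm ((cmod (f x))\<^sup>2) \<le> norm (C\<^sup>2 * (cmod (g x))\<^sup>2)"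
      by (simp add: power_mult_distrib)
  qed measurable
qed measurable

lemma square_integrable_gaussian_deriv:
  assumes "t > 0"
  shows "square_integrable (gaussian_deriv h t a \<beta>)"
proof -
  obtain C where C: "\<And>x. cmod (gaussian_deriv h t a \<beta> x) \<le> C * cmod (gaussian (t / 2) a 0 x)"
    using gaussian_deriv_bound[OF assms] by metis
  show ?thesis
    by (rule square_integrable_dominated[OF square_integrable_gaussian[of "t / 2" a 0] _ C]) (use assms in auto)
qed

lemma integral_gaussian_deriv_real:
  fixes a \<beta> :: real
  assumes t: "t > 0"
  shows "(LINT x|lborel. gaussian_deriv 1 t a \<beta> x) = 0"
proof -
  have "(LBINT x=-\<infinity>..\<infinity>. gaussian_deriv 1 t a \<beta> x) = 0 - 0"
  proof (rule interval_integral_FTC_integrable)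
    show "(gaussian t a \<beta> has_vector_derivative gaussian_deriv 1 t a \<beta> x) (at x)" for x
    proof -
      have "(\<lambda>h. gaussian_deriv h t a \<beta> x) = (\<lambda>h. h *\<^sub>R gaussian_deriv 1 t a \<beta> x)"
        by (auto simp: gaussian_deriv_def scaleR_conv_of_real algebra_simps)
      then show ?thesis using gaussian_has_derivative[of t a \<beta> x] by (simp add: has_vector_derivative_def)
    qed
    show "isCont (gaussian_deriv 1 t a \<beta>) x" for x
    proof -
      have "continuous_on UNIV (gaussian_deriv 1 t a \<beta>)"
        unfolding gaussian_deriv_def by (intro continuous_intros continuous_on_gaussian)
      then show ?thesis by (simp add: continuous_on_eq_continuous_at)
    qed
    show "set_integrable lborel (einterval (-\<infinity>) \<infinity>) (gaussian_deriv 1 t a \<beta>)"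
      using integrable_gaussian_deriv[OF t, of 1 a \<beta>] by (simp add: set_integrable_def)
    have 1: "((\<lambda>x. exp (- t * (x - a)\<^sup>2 / 2)) \<longlongrightarrow> 0) at_top"
      using t by real_asymp
    have 2: "((\<lambda>x. exp (- t * (x - a)\<^sup>2 / 2)) \<longlongrightarrow> 0) at_bot"
      using t by real_asymp
    have n: "(\<lambda>x. norm (gaussian t a \<beta> x)) = (\<lambda>x. exp (- t * (x - a)\<^sup>2 / 2))"
      by (simp add: norm_gaussian fun_eq_iff)
    show "((gaussian t a \<beta> \<circ> real_of_ereal) \<longlongrightarrow> 0) (at_left \<infinity>)"
      unfolding ereal_tendsto_simps by (rule tendsto_norm_zero_cancel) (simp only: n 1)
    show "((gaussian t a \<beta> \<circ> real_of_ereal) \<longlongrightarrow> 0) (at_right (-\<infinity>))"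
      unfolding ereal_tendsto_simps by (rule tendsto_norm_zero_cancel) (simp only: n 2)
  qed simp
  then show ?thesis by (simp add: interval_lebesgue_integral_def set_lebesgue_integral_def)
qed

text \<open>The integral factors over the coordinates, and the factor belonging to \<open>b\<close>
  is the integral over the line of a derivative that is taken between two vanishing limits.\<close>

lemma integral_gaussian_deriv:
  fixes a \<beta> :: "'a::euclidean_space"
  assumes t: "t > 0" and b: "b \<in> Basis"
  shows "(LINT x|lborel. gaussian_deriv b t a \<beta> x) = 0"
proof -
  define F where "F i = (if i = b then gaussian_deriv 1 t (a \<bullet> i) (\<beta> \<bullet> i) else gaussian t (a \<bullet> i) (\<beta> \<bullet> i))" for i
  have eq: "gaussian_deriv b t a \<beta> x = (\<Prod>i\<in>Basis. F i (x \<bullet> i))" for x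
  proof -
    have "gaussian t a \<beta> x = (\<Prod>i\<in>Basis. gaussian t (a \<bullet> i) (\<beta> \<bullet> i) (x \<bullet> i))"
      unfolding gaussian_prod[of t a] by (simp add: gaussian_def)
    then show ?thesis
      unfolding gaussian_deriv_def using b
      by (simp add: prod.remove[OF finite_Basis b] F_def gaussian_deriv_def inner_diff_left mult.assoc)
  qed
  have "(LINT x|lborel. gaussian_deriv b t a \<beta> x) = (\<Prod>i\<in>Basis. LINT s|lborel. F i s)"
    unfolding eq by (rule lborel_product_integral)
      (use t in \<open>auto simp: F_def integrable_gaussian_deriv integrable_gaussian\<close>)
  also have "\<dots> = 0"
    using b t by (intro prod_zero) (auto simp: F_def integral_gaussian_deriv_real intro!: bexI[of _ b])
  finally show ?thesis .
qed

text \<open>The character is absorbed into the modulation, which changes the derivative of the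
  Gaussian only by a multiple of the Gaussian. The derivative of the modulated Gaussian integrates
  to 0, and that multiple is what remains.\<close>

lemma fourier_integral_gaussian_deriv:
  assumes t: "t > 0" and b: "b \<in> Basis"
  shows "fourier_integral (gaussian_deriv b t a \<beta>) \<xi> = \<i> * of_real (\<xi> \<bullet> b) * fourier_integral (gaussian t a \<beta>) \<xi>"
proof -
  have g: "iexp (- (\<xi> \<bullet> x)) * gaussian t a \<beta> x = gaussian t a (\<beta> - \<xi>) x" for x
    using iexp_times_gaussian[of "- \<xi>" x t a \<beta>] by simp
  have "iexp (- (\<xi> \<bullet> x)) * gaussian_deriv b t a \<beta> x
      = gaussian_deriv b t a (\<beta> - \<xi>) x + \<i> * of_real (\<xi> \<bullet> b) * gaussian t a (\<beta> - \<xi>) x" for x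
    unfolding gaussian_deriv_def g[symmetric] by (simp add: inner_diff_left algebra_simps)
  then have "(LINT x|lborel. iexp (- (\<xi> \<bullet> x)) * gaussian_deriv b t a \<beta> x)
      = \<i> * of_real (\<xi> \<bullet> b) * (LINT x|lborel. gaussian t a (\<beta> - \<xi>) x)"
    using t b by (simp add: integrable_gaussian integrable_gaussian_deriv integral_gaussian_deriv)
  then show ?thesis unfolding fourier_integral_def g by simp
qed

lemma ifourier_gaussian:
  assumes t: "t > 0"
  shows "ifourier (l2_gaussian t y 0) = abs_l2 (\<lambda>x. fourier_integral (gaussian t y 0) (- x))"
proof (rule abs_l2_eqI[symmetric])
  have "fourier_integral (gaussian t y 0) (- x) = fourier_integral (gaussian t (- y) 0) x" for x
    using t by (simp add: fourier_integral_gaussian gaussian_def)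
  then show "square_integrable (\<lambda>x. fourier_integral (gaussian t y 0) (- x))"
    using square_integrable_fourier_gaussian[OF t, of "- y" 0] by simp
  show "AE x in lborel. fourier_integral (gaussian t y 0) (- x) = rep_l2 (ifourier (l2_gaussian t y 0)) x"
    using rep_ifourier[OF integrable_gaussian[OF t] square_integrable_gaussian[OF t], of y 0]
    by (auto simp: l2_gaussian_def elim!: eventually_mono)
qed

lemma rep_fourier:
  fixes g :: "'a::euclidean_space \<Rightarrow> complex"
  assumes g: "integrable lborel g" "square_integrable g"
  shows "AE x in lborel. rep_l2 (fourier (abs_l2 g)) x = fourier_integral g x"
proof (rule rep_l2_eqI_gaussian[OF _ norm_fourier_integral_le])
  have [measurable]: "g \<in> borel_measurable borel" using g(1) by simp
  show "fourier_integral g \<in> borel_measurable borel" by measurable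
  fix t :: real and y :: 'a assume t: "t > 0"
  have e: "fourier_integral (gaussian t y 0) (- x) = fourier_integral (gaussian t (- y) 0) x" for x
    using t by (simp add: fourier_integral_gaussian gaussian_def)
  have "cinner (fourier (abs_l2 g)) (l2_gaussian t y 0) = cinner (abs_l2 g) (abs_l2 (\<lambda>x. fourier_integral (gaussian t y 0) (- x)))"
    by (simp only: fourier_cinner[of "abs_l2 g", symmetric] ifourier_gaussian[OF t, symmetric] fourier_ifourier)
  also have "\<dots> = (LINT \<xi>|lborel. g \<xi> * cnj (fourier_integral (gaussian t y 0) (- \<xi>)))"
    using g square_integrable_fourier_gaussian[OF t, of "- y" 0] by (simp add: cinner_abs e)
  also have "\<dots> = (LINT \<xi>|lborel. g \<xi> * fourier_integral (gaussian t y 0) \<xi>)"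
    by (simp add: fourier_integral_cnj cnj_gaussian)
  also have "\<dots> = (LINT x|lborel. fourier_integral g x * gaussian t y 0 x)"
    using g t by (intro fourier_integral_duality[symmetric] integrable_gaussian)
  finally show "cinner (fourier (abs_l2 g)) (l2_gaussian t y 0) = (LINT x|lborel. fourier_integral g x * gaussian t y 0 x)" .
qed

text \<open>Square-integrability of the right-hand side comes for free: it agrees almost everywhere
  with the unitary transform of a square-integrable function.\<close>

lemma fourier_gaussian_deriv:
  assumes t: "t > 0" and b: "b \<in> Basis"
  shows "square_integrable (\<lambda>\<xi>. \<i> * of_real (\<xi> \<bullet> b) * fourier_integral (gaussian t a \<beta>) \<xi>)"
    and "fourier (abs_l2 (gaussian_deriv b t a \<beta>)) = abs_l2 (\<lambda>\<xi>. \<i> * of_real (\<xi> \<bullet> b) * fourier_integral (gaussian t a \<beta>) \<xi>)"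
proof -
  have ae: "AE \<xi> in lborel. rep_l2 (fourier (abs_l2 (gaussian_deriv b t a \<beta>))) \<xi>
      = \<i> * of_real (\<xi> \<bullet> b) * fourier_integral (gaussian t a \<beta>) \<xi>"
    using rep_fourier[OF integrable_gaussian_deriv[OF t] square_integrable_gaussian_deriv[OF t], of b a \<beta>]
    by (simp add: fourier_integral_gaussian_deriv[OF t b])
  show s: "square_integrable (\<lambda>\<xi>. \<i> * of_real (\<xi> \<bullet> b) * fourier_integral (gaussian t a \<beta>) \<xi>)"
  proof -
    have "integrable lborel (\<lambda>\<xi>. (cmod (\<i> * of_real (\<xi> \<bullet> b) * fourier_integral (gaussian t a \<beta>) \<xi>))\<^sup>2)
       \<longleftrightarrow> integrable lborel (\<lambda>\<xi>. (cmod (rep_l2 (fourier (abs_l2 (gaussian_deriv b t a \<beta>))) \<xi>))\<^sup>2)"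
      by (rule integrable_cong_AE) (use ae in \<open>auto elim!: eventually_mono\<close>)
    then show ?thesis
      using square_integrable_rep[of "fourier (abs_l2 (gaussian_deriv b t a \<beta>))"]
      by (auto simp: square_integrable_def)
  qed
  show "fourier (abs_l2 (gaussian_deriv b t a \<beta>)) = abs_l2 (\<lambda>\<xi>. \<i> * of_real (\<xi> \<bullet> b) * fourier_integral (gaussian t a \<beta>) \<xi>)"
    by (rule abs_l2_eqI[OF s, symmetric]) (use ae in \<open>auto elim!: eventually_mono\<close>)
qed

section \<open>Weak derivatives in Fourier space\<close>

lemma square_integrable_cnj: "square_integrable f \<Longrightarrow> square_integrable (\<lambda>x. cnj (f x))"
  by (auto simp: square_integrable_def intro: borel_measurable_cnj)

lemma square_integrable_times:
  assumes "square_integrable f" "square_integrable g"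
  shows "integrable lborel (\<lambda>x. f x * g x)"
  using square_integrable_mult[OF assms(1) square_integrable_cnj[OF assms(2)]] by simp

lemma square_integrable_AE_eq:
  assumes f: "square_integrable f" and [measurable]: "g \<in> borel_measurable borel"
    and ae: "AE x in lborel. f x = g x"
  shows "square_integrable g"
proof -
  have [measurable]: "f \<in> borel_measurable borel" using f by (rule square_integrable_measurable)
  have "integrable lborel (\<lambda>x. (cmod (f x))\<^sup>2) \<longleftrightarrow> integrable lborel (\<lambda>x. (cmod (g x))\<^sup>2)"
    by (rule integrable_cong_AE) (use ae in \<open>auto elim!: eventually_mono\<close>)
  then show ?thesis using f by (simp add: square_integrable_def)
qed

lemma norm_prod_fun_le:
  assumes "\<And>b s. b \<in> Basis \<Longrightarrow> cmod (F b s) \<le> C b"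
  shows "cmod (prod_fun F x) \<le> (\<Prod>b\<in>Basis. C b)"
  unfolding prod_fun_def prod_norm[symmetric] by (intro prod_mono) (auto intro: assms)

lemma prod_fun_tendsto:
  assumes "\<And>b. b \<in> Basis \<Longrightarrow> (\<lambda>k. F k b (x \<bullet> b)) \<longlonglongrightarrow> L b"
  shows "(\<lambda>k. prod_fun (F k) x) \<longlonglongrightarrow> (\<Prod>b\<in>Basis. L b)"
  unfolding prod_fun_def by (intro tendsto_prod assms)

text \<open>Gaussians are limits of the test functions \<open>gaussian t a \<beta> x * X k x\<close> below.\<close>

lemma weak_partial_against_gaussian:
  fixes f g :: "'a::euclidean_space l2"
  assumes w: "has_weak_partial b f g" and b: "b \<in> Basis" and t: "t > 0"
  shows "(LINT x|lborel. rep_l2 f x * gaussian_deriv b t a \<beta> x) = - (LINT x|lborel. rep_l2 g x * gaussian t a \<beta> x)"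
proof -
  define X where "X k = prod_fun (\<lambda>_::'a. cutoff1 (real k))" for k
  define dX where "dX k = prod_fun ((\<lambda>_::'a. cutoff1 (real k))(b := cutoff1' (real k)))" for k
  define T where "T k x = gaussian t a \<beta> x * X k x" for k x
  have Xd: "X k differentiable (at x)" for k x
    unfolding X_def using prod_fun_has_derivative[of "\<lambda>_. cutoff1 (real k)" "\<lambda>_. cutoff1' (real k)"]
    by (auto simp: differentiable_def cutoff1_deriv)
  have dX: "frechet_derivative (X k) (at x) b = dX k x" for k x
    unfolding X_def dX_def by (rule frechet_derivative_prod_fun) (auto simp: cutoff1_deriv b)
  \<comment> \<open>Gaussian and cutoff both factor over the coordinates, so their product is again
    a \<open>prod_fun\<close> with factors in \<open>smooth1\<close>, and the cutoff supplies the
    compact support.\<close>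
  have Tt: "test_function (T k)" for k
  proof -
    have "T k = prod_fun (\<lambda>i s. exp (of_real (- t * (s - a \<bullet> i)\<^sup>2 / 2) + \<i> * of_real ((\<beta> \<bullet> i) * s)) * cutoff1 (real k) s)"
      by (simp add: T_def X_def prod_fun_def gaussian_prod prod.distrib fun_eq_iff)
    moreover have "test_function (prod_fun (\<lambda>i s. exp (of_real (- t * (s - a \<bullet> i)\<^sup>2 / 2) + \<i> * of_real ((\<beta> \<bullet> i) * s)) * cutoff1 (real k) s))"
      by (rule test_function_prod_fun[where k="real k"], rule smooth1.mult[OF smooth1.gauss cutoff1_smooth])
        (simp add: cutoff1_eq_0)
    ultimately show ?thesis by simp
  qed
  have Td: "frechet_derivative (T k) (at x) b = gaussian t a \<beta> x * dX k x + gaussian_deriv b t a \<beta> x * X k x" for k x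
  proof -
    have "(T k has_derivative (\<lambda>h. gaussian t a \<beta> x * frechet_derivative (X k) (at x) h + gaussian_deriv h t a \<beta> x * X k x)) (at x)"
      unfolding T_def
      by (intro has_derivative_mult gaussian_has_derivative Xd[unfolded frechet_derivative_works])
    from frechet_derivative_at[OF this, symmetric] show ?thesis by (simp add: dX)
  qed
  have Xb: "cmod (X k x) \<le> 1" for k x
    using norm_prod_fun_le[of "\<lambda>_. cutoff1 (real k)" "\<lambda>_. 1" x] by (simp add: X_def norm_cutoff1_le)
  have dXb: "cmod (dX k x) \<le> 4" for k x
  proof -
    have "cmod (dX k x) \<le> (\<Prod>c\<in>(Basis::'a set). if c = b then 4 else 1)"
      unfolding dX_def by (intro norm_prod_fun_le) (auto simp: norm_cutoff1_le norm_cutoff1'_le)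
    then show ?thesis using b by (simp add: prod.delta)
  qed
  have Xl: "(\<lambda>k. X k x) \<longlonglongrightarrow> 1" for x
    using prod_fun_tendsto[of "\<lambda>k _. cutoff1 (real k)" x "\<lambda>_. 1"] by (simp add: X_def cutoff1_tendsto)
  \<comment> \<open>The differentiated factor, the one for \<open>b\<close>, tends to 0 while all
    others tend to 1.\<close>
  have dXl: "(\<lambda>k. dX k x) \<longlonglongrightarrow> 0" for x
  proof -
    have "(\<lambda>k. dX k x) \<longlonglongrightarrow> (\<Prod>c\<in>(Basis::'a set). if c = b then 0 else 1)"
      unfolding dX_def by (intro prod_fun_tendsto) (auto simp: cutoff1_tendsto cutoff1'_tendsto)
    then show ?thesis using b by (simp add: prod.delta)
  qed
  have Xc: "continuous_on UNIV (X k)" for k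
    using Xd by (intro differentiable_imp_continuous_on) (auto simp: differentiable_on_def)
  have [measurable]: "X k \<in> borel_measurable borel" for k
    using Xc by (rule borel_measurable_continuous_onI)
  have c1: "continuous_on UNIV (cutoff1' k)" for k
  proof -
    have "continuous_on UNIV (flat_exp n)" for n
      by (rule DERIV_continuous_on) (auto intro: has_field_derivative_at_within flat_exp_deriv)
    then have c: "continuous_on UNIV (\<lambda>s. flat_exp n (h s))" if "continuous_on UNIV h" for n h
      using that by (auto intro: continuous_on_compose2)
    show ?thesis unfolding cutoff1'_def by (intro continuous_intros c)
  qed
  have c0: "continuous_on UNIV (cutoff1 k)" for k
    by (rule continuous_on_vector_derivative[OF has_vector_derivative_at_within[OF cutoff1_deriv]])
  have [measurable]: "cutoff1 k \<in> borel_measurable borel" "cutoff1' k \<in> borel_measurable borel" for k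
    using c0 c1 by (auto intro: borel_measurable_continuous_onI)
  have [measurable]: "((\<lambda>_::'a. cutoff1 k)(b := cutoff1' k)) c \<in> borel_measurable borel" for k c
    by auto
  have [measurable]: "dX k \<in> borel_measurable borel" for k
    unfolding dX_def prod_fun_def by measurable
  have fg: "integrable lborel (\<lambda>x. cmod (rep_l2 u x * gaussian t a \<beta> x))" for u
    by (intro integrable_norm integrable_times_gaussian t) simp
  have fd: "integrable lborel (\<lambda>x. cmod (rep_l2 u x * gaussian_deriv b t a \<beta> x))" for u
    by (intro integrable_norm square_integrable_times square_integrable_gaussian_deriv t) simp
  have l1: "(\<lambda>k. LINT x|lborel. rep_l2 f x * frechet_derivative (T k) (at x) b)
      \<longlonglongrightarrow> (LINT x|lborel. rep_l2 f x * gaussian_deriv b t a \<beta> x)"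
    unfolding Td
  proof (rule integral_dominated_convergence[where w="\<lambda>x. 4 * cmod (rep_l2 f x * gaussian t a \<beta> x) + cmod (rep_l2 f x * gaussian_deriv b t a \<beta> x)"])
    show "integrable lborel (\<lambda>x. 4 * cmod (rep_l2 f x * gaussian t a \<beta> x) + cmod (rep_l2 f x * gaussian_deriv b t a \<beta> x))"
      by (intro Bochner_Integration.integrable_add integrable_mult_right fg fd)
    show "AE x in lborel. (\<lambda>k. rep_l2 f x * (gaussian t a \<beta> x * dX k x + gaussian_deriv b t a \<beta> x * X k x))
        \<longlonglongrightarrow> rep_l2 f x * gaussian_deriv b t a \<beta> x"
    proof (intro AE_I2)
      fix x
      have "(\<lambda>k. rep_l2 f x * (gaussian t a \<beta> x * dX k x + gaussian_deriv b t a \<beta> x * X k x))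
        \<longlonglongrightarrow> rep_l2 f x * (gaussian t a \<beta> x * 0 + gaussian_deriv b t a \<beta> x * 1)"
        by (intro tendsto_intros Xl dXl)
      then show "(\<lambda>k. rep_l2 f x * (gaussian t a \<beta> x * dX k x + gaussian_deriv b t a \<beta> x * X k x))
        \<longlonglongrightarrow> rep_l2 f x * gaussian_deriv b t a \<beta> x" by simp
    qed
    show "AE x in lborel. norm (rep_l2 f x * (gaussian t a \<beta> x * dX k x + gaussian_deriv b t a \<beta> x * X k x))
        \<le> 4 * cmod (rep_l2 f x * gaussian t a \<beta> x) + cmod (rep_l2 f x * gaussian_deriv b t a \<beta> x)" for k
    proof (intro AE_I2)
      fix x
      have "norm (rep_l2 f x * (gaussian t a \<beta> x * dX k x + gaussian_deriv b t a \<beta> x * X k x))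
        \<le> cmod (rep_l2 f x * gaussian t a \<beta> x) * cmod (dX k x) + cmod (rep_l2 f x * gaussian_deriv b t a \<beta> x) * cmod (X k x)"
        by (simp only: distrib_left mult.assoc[symmetric] norm_mult[symmetric] norm_triangle_ineq)
      also have "\<dots> \<le> cmod (rep_l2 f x * gaussian t a \<beta> x) * 4 + cmod (rep_l2 f x * gaussian_deriv b t a \<beta> x) * 1"
        by (intro add_mono mult_left_mono dXb Xb) auto
      finally show "norm (rep_l2 f x * (gaussian t a \<beta> x * dX k x + gaussian_deriv b t a \<beta> x * X k x))
        \<le> 4 * cmod (rep_l2 f x * gaussian t a \<beta> x) + cmod (rep_l2 f x * gaussian_deriv b t a \<beta> x)" by simp
    qed
  qed measurable
  have l2: "(\<lambda>k. LINT x|lborel. rep_l2 g x * T k x) \<longlonglongrightarrow> (LINT x|lborel. rep_l2 g x * gaussian t a \<beta> x)"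
    unfolding T_def
  proof (rule integral_dominated_convergence[where w="\<lambda>x. cmod (rep_l2 g x * gaussian t a \<beta> x)"])
    show "AE x in lborel. (\<lambda>k. rep_l2 g x * (gaussian t a \<beta> x * X k x)) \<longlonglongrightarrow> rep_l2 g x * gaussian t a \<beta> x"
    proof (intro AE_I2)
      fix x
      have "(\<lambda>k. rep_l2 g x * (gaussian t a \<beta> x * X k x)) \<longlonglongrightarrow> rep_l2 g x * (gaussian t a \<beta> x * 1)"
        by (intro tendsto_intros Xl)
      then show "(\<lambda>k. rep_l2 g x * (gaussian t a \<beta> x * X k x)) \<longlonglongrightarrow> rep_l2 g x * gaussian t a \<beta> x" by simp
    qed
    show "AE x in lborel. norm (rep_l2 g x * (gaussian t a \<beta> x * X k x)) \<le> cmod (rep_l2 g x * gaussian t a \<beta> x)" for k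
      using Xb by (auto simp: norm_mult intro!: mult_left_mono mult_left_le)
  qed (use fg in measurable)
  have "(LINT x|lborel. rep_l2 f x * frechet_derivative (T k) (at x) b) = - (LINT x|lborel. rep_l2 g x * T k x)" for k
    using w Tt unfolding has_weak_partial_def by blast
  with l1 have "(\<lambda>k. - (LINT x|lborel. rep_l2 g x * T k x)) \<longlonglongrightarrow> (LINT x|lborel. rep_l2 f x * gaussian_deriv b t a \<beta> x)"
    by simp
  from LIMSEQ_unique[OF this tendsto_minus[OF l2]] show ?thesis .
qed

lemma cnj_gaussian_deriv: "cnj (gaussian_deriv h t a \<beta> x) = gaussian_deriv h t a (- \<beta>) x"
  by (simp add: gaussian_deriv_def cnj_gaussian)

text \<open>The defect \<open>H\<close> of the claimed identity is tested against transforms of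
  Gaussians. Plancherel leads back to \<open>x\<close>-space, where the integral vanishes by the
  weak derivative tested against a Gaussian. Since \<open>H\<close> contains a coordinate times a
  square-integrable function, the weighted criterion is the one to use.\<close>

lemma has_weak_partial_imp_fourier:
  fixes f g :: "'a::euclidean_space l2"
  assumes w: "has_weak_partial b f g" and b: "b \<in> Basis"
  shows "AE \<xi> in lborel. rep_l2 (fourier g) \<xi> = \<i> * of_real (\<xi> \<bullet> b) * rep_l2 (fourier f) \<xi>"
proof -
  define H where "H \<xi> = rep_l2 (fourier g) \<xi> - \<i> * of_real (\<xi> \<bullet> b) * rep_l2 (fourier f) \<xi>" for \<xi>
  have main: "integrable lborel (\<lambda>\<xi>. H \<xi> * cnj (fourier_integral (gaussian t a \<beta>) \<xi>))"
    "(LINT \<xi>|lborel. H \<xi> * cnj (fourier_integral (gaussian t a \<beta>) \<xi>)) = 0" if t: "t > 0" for t a \<beta>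
  proof -
    note D = fourier_gaussian_deriv[OF t b, of a \<beta>]
    have i1: "integrable lborel (\<lambda>\<xi>. rep_l2 (fourier g) \<xi> * cnj (fourier_integral (gaussian t a \<beta>) \<xi>))"
      by (intro square_integrable_mult square_integrable_fourier_gaussian t) simp
    have i2: "integrable lborel (\<lambda>\<xi>. rep_l2 (fourier f) \<xi> * cnj (\<i> * of_real (\<xi> \<bullet> b) * fourier_integral (gaussian t a \<beta>) \<xi>))"
      by (intro square_integrable_mult D) simp
    have e: "H \<xi> * cnj (fourier_integral (gaussian t a \<beta>) \<xi>) = rep_l2 (fourier g) \<xi> * cnj (fourier_integral (gaussian t a \<beta>) \<xi>)
        + rep_l2 (fourier f) \<xi> * cnj (\<i> * of_real (\<xi> \<bullet> b) * fourier_integral (gaussian t a \<beta>) \<xi>)" for \<xi>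
      by (simp add: H_def algebra_simps)
    show "integrable lborel (\<lambda>\<xi>. H \<xi> * cnj (fourier_integral (gaussian t a \<beta>) \<xi>))"
      unfolding e using i1 i2 by (rule Bochner_Integration.integrable_add)
    have "(LINT \<xi>|lborel. H \<xi> * cnj (fourier_integral (gaussian t a \<beta>) \<xi>))
       = cinner (fourier g) (fourier (l2_gaussian t a \<beta>)) + cinner (fourier f) (fourier (abs_l2 (gaussian_deriv b t a \<beta>)))"
      unfolding e D(2) fourier_gaussian[OF t] l2_gaussian_hat_def
      using i1 i2 D(1) t by (simp add: cinner_rep_abs square_integrable_fourier_gaussian)
    also have "\<dots> = cinner g (l2_gaussian t a \<beta>) + cinner f (abs_l2 (gaussian_deriv b t a \<beta>))"
      by (simp add: fourier_cinner)
    also have "\<dots> = (LINT x|lborel. rep_l2 g x * gaussian t a (- \<beta>) x) + (LINT x|lborel. rep_l2 f x * gaussian_deriv b t a (- \<beta>) x)"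
      using t by (simp add: l2_gaussian_def cinner_rep_abs square_integrable_gaussian square_integrable_gaussian_deriv
          cnj_gaussian cnj_gaussian_deriv)
    also have "\<dots> = 0" using weak_partial_against_gaussian[OF w b t, of a "- \<beta>"] by simp
    finally show "(LINT \<xi>|lborel. H \<xi> * cnj (fourier_integral (gaussian t a \<beta>) \<xi>)) = 0" .
  qed
  \<comment> \<open>Selects among the transforms those that are constant multiples of unmodulated
    Gaussians, the form in which the criterion for \<open>H = 0\<close> is stated.\<close>
  have hat: "\<exists>c. c \<noteq> 0 \<and> (\<forall>\<xi>. cnj (fourier_integral (gaussian (1 / t) 0 y) \<xi>) = c * gaussian t y 0 \<xi>)" if "t > 0" for t and y :: 'a
    using that by (intro exI[of _ "of_real ((1 / sqrt (1 / t)) ^ DIM('a))"]) (simp add: fourier_integral_gaussian cnj_gaussian)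
  have "AE \<xi> in lborel. H \<xi> = 0"
  proof (rule gaussian_weighted_zero_imp_AE)
    obtain c where "c \<noteq> 0" "\<And>\<xi>::'a. cnj (fourier_integral (gaussian (1 / 1) 0 0) \<xi>) = c * gaussian 1 0 0 \<xi>"
      using hat[of 1 0] by auto
    then show "integrable lborel (\<lambda>\<xi>. H \<xi> * gaussian 1 0 0 \<xi>)"
      using integrable_mult_right[OF main(1)[of "1 / 1" 0 0], of "1 / c"] by (simp add: mult.left_commute)
    fix t :: real and y :: 'a assume t: "t > 0"
    obtain c where "c \<noteq> 0" "\<And>\<xi>. cnj (fourier_integral (gaussian (1 / t) 0 y) \<xi>) = c * gaussian t y 0 \<xi>"
      using hat[OF t, of y] by auto
    then show "(LINT \<xi>|lborel. H \<xi> * gaussian t y 0 \<xi>) = 0"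
      using main(2)[of "1 / t" 0 y] t by (simp add: mult.left_commute)
  qed
  then show ?thesis by (auto simp: H_def elim!: eventually_mono)
qed

text \<open>The quotients converge pointwise, and the mean value inequality bounds them by one
  constant on one fixed ball; convergence in \<open>L2\<close> is then dominated
  convergence.\<close>

lemma test_function_difference_quotient:
  fixes \<phi> :: "'a::euclidean_space \<Rightarrow> complex"
  assumes \<phi>: "test_function \<phi>" and b: "b \<in> Basis"
    and h: "\<And>n. 0 < h n" "\<And>n. h n \<le> 1" "h \<longlonglongrightarrow> 0"
  shows "square_integrable \<phi>" "square_integrable (\<lambda>x. frechet_derivative \<phi> (at x) b)"
    and "(\<lambda>n. abs_l2 (\<lambda>x. (\<phi> (x + h n *\<^sub>R b) - \<phi> x) / of_real (h n))) \<longlonglongrightarrow> abs_l2 (\<lambda>x. frechet_derivative \<phi> (at x) b)"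
proof -
  define d where "d x = frechet_derivative \<phi> (at x) b" for x
  have diff: "iterated_partial bs \<phi> differentiable_on UNIV" if "set bs \<subseteq> Basis" for bs
    using \<phi> that by (simp add: test_function_def)
  have \<phi>d: "\<phi> differentiable (at x)" for x using diff[of "[]"] by (simp add: differentiable_on_def)
  have \<phi>c: "continuous_on UNIV \<phi>" using diff[of "[]"] by (auto intro: differentiable_imp_continuous_on)
  have dc: "continuous_on UNIV d" using diff[of "[b]"] b by (auto simp: d_def[abs_def] intro: differentiable_imp_continuous_on)
  have [measurable]: "\<phi> \<in> borel_measurable borel" "d \<in> borel_measurable borel"
    using \<phi>c dc by (auto intro: borel_measurable_continuous_onI)
  have "bounded (closure {x. \<phi> x \<noteq> 0})" using \<phi> by (simp add: test_function_def compact_imp_bounded)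
  then obtain R where R: "\<And>x. x \<in> closure {x. \<phi> x \<noteq> 0} \<Longrightarrow> norm x \<le> R" by (auto simp: bounded_iff)
  have \<phi>0: "\<phi> x = 0" if "norm x > R" for x
    using R[of x] closure_subset[of "{x. \<phi> x \<noteq> 0}"] that by force
  \<comment> \<open>Since \<open>h n \<le> 1\<close>, the quotients vanish outside radius
    \<open>R + 1\<close>; the segments used in the mean value inequality start inside that radius
    and stay within \<open>R + 2\<close>.\<close>
  define K where "K = cball (0::'a) (R + 2)"
  have [measurable]: "K \<in> sets borel" by (simp add: K_def)
  have "compact K" by (simp add: K_def)
  then have "bounded (\<phi> ` K)" "bounded (d ` K)"
    using \<phi>c dc by (auto intro!: compact_imp_bounded compact_continuous_image intro: continuous_on_subset)
  then obtain M1 M2 where M12: "\<And>x. x \<in> K \<Longrightarrow> cmod (\<phi> x) \<le> M1" "\<And>x. x \<in> K \<Longrightarrow> cmod (d x) \<le> M2"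
    unfolding bounded_iff by auto
  \<comment> \<open>For an empty support \<open>R\<close> may be so negative that \<open>K\<close>
    is empty and the two bounds are arbitrary; the maximum with 0 keeps \<open>M\<close> nonnegative
    in that case too.\<close>
  define M where "M = max 0 (max M1 M2)"
  have M: "M \<ge> 0" "\<And>x. x \<in> K \<Longrightarrow> cmod (\<phi> x) \<le> M" "\<And>x. x \<in> K \<Longrightarrow> cmod (d x) \<le> M"
    using M12 by (force simp: M_def)+
  have line: "((\<lambda>s. \<phi> (x + s *\<^sub>R b)) has_vector_derivative d (x + s *\<^sub>R b)) (at s)" for x s
  proof -
    have "(\<phi> has_derivative frechet_derivative \<phi> (at (x + s *\<^sub>R b))) (at (x + s *\<^sub>R b))"
      using \<phi>d frechet_derivative_works by blast
    moreover have "((\<lambda>s. x + s *\<^sub>R b) has_derivative (\<lambda>h. h *\<^sub>R b)) (at s)"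
      by (auto intro!: derivative_eq_intros)
    ultimately have "((\<lambda>s. \<phi> (x + s *\<^sub>R b)) has_derivative (\<lambda>h. frechet_derivative \<phi> (at (x + s *\<^sub>R b)) (h *\<^sub>R b))) (at s)"
      by (rule has_derivative_compose[rotated])
    moreover have "linear (frechet_derivative \<phi> (at (x + s *\<^sub>R b)))"
      using \<phi>d by (intro linear_frechet_derivative)
    ultimately show ?thesis by (simp add: has_vector_derivative_def d_def linear_scale)
  qed
  define H where "H x = M * indicator K x" for x
  have Hi: "integrable lborel (\<lambda>x. (H x)\<^sup>2)"
  proof -
    have "(\<lambda>x. (H x)\<^sup>2) = (\<lambda>x. M\<^sup>2 * indicator K x)" by (auto simp: H_def indicator_def)
    moreover have "integrable lborel (indicator K :: 'a \<Rightarrow> real)"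
      using \<open>compact K\<close> by (intro integrable_real_indicator) (use emeasure_bounded_finite[OF bounded_cball] in \<open>auto simp: K_def\<close>)
    ultimately show ?thesis by simp
  qed
  define D where "D n x = (\<phi> (x + h n *\<^sub>R b) - \<phi> x) / of_real (h n)" for n x
  have [measurable]: "D n \<in> borel_measurable borel" for n unfolding D_def by measurable
  have DH: "cmod (D n x) \<le> H x" for n x
  proof (cases "x \<in> K \<and> norm x \<le> R + 1")
    case True
    have seg: "x + s *\<^sub>R b \<in> K" if "0 \<le> s" "s \<le> 1" for s
    proof -
      have "norm (x + s *\<^sub>R b) \<le> norm x + norm (s *\<^sub>R b)" by (rule norm_triangle_ineq)
      also have "\<dots> \<le> (R + 1) + 1" using True that b by (intro add_mono) auto
      finally show ?thesis by (simp add: K_def)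
    qed
    have "\<exists>s\<in>{0<..<h n}. norm (\<phi> (x + h n *\<^sub>R b) - \<phi> (x + 0 *\<^sub>R b)) \<le> norm ((h n - 0) *\<^sub>R d (x + s *\<^sub>R b))"
    proof (rule mvt_general)
      show "((\<lambda>s. \<phi> (x + s *\<^sub>R b)) has_derivative (\<lambda>h. h *\<^sub>R d (x + s *\<^sub>R b))) (at s)" for s
        using line[of x s] by (simp add: has_vector_derivative_def)
      show "continuous_on {0..h n} (\<lambda>s. \<phi> (x + s *\<^sub>R b))"
        by (rule continuous_on_vector_derivative[OF has_vector_derivative_at_within[OF line]])
    qed (use h in simp)
    then obtain s where s: "0 < s" "s < h n" "cmod (\<phi> (x + h n *\<^sub>R b) - \<phi> x) \<le> h n * cmod (d (x + s *\<^sub>R b))"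
      using h(1)[of n] by auto
    have "cmod (d (x + s *\<^sub>R b)) \<le> M" using seg[of s] s h(2)[of n] M(3) by auto
    then have "cmod (\<phi> (x + h n *\<^sub>R b) - \<phi> x) \<le> h n * M"
      using s(3) h(1)[of n] by (meson mult_left_mono less_imp_le order_trans)
    then show ?thesis using True h(1)[of n] by (simp add: D_def H_def norm_divide field_simps)
  next
    case False
    then have n: "norm x > R + 1" by (auto simp: K_def)
    have "norm x \<le> norm (x + h n *\<^sub>R b) + norm (h n *\<^sub>R b)"
      using norm_triangle_ineq4[of "x + h n *\<^sub>R b" "h n *\<^sub>R b"] by simp
    moreover have "norm (h n *\<^sub>R b) \<le> 1" using h(1,2)[of n] b by simp
    ultimately have "norm (x + h n *\<^sub>R b) > R" using n by linarith
    then show ?thesis using n \<phi>0 M by (simp add: D_def H_def indicator_def)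
  qed
  have \<phi>H: "cmod (\<phi> x) \<le> M * cmod (of_real (indicator K x))" for x
    using M(2)[of x] \<phi>0[of x] by (cases "x \<in> K") (auto simp: K_def)
  have "square_integrable (\<lambda>x. complex_of_real (indicator K x))"
    unfolding square_integrable_def
  proof
    show "(\<lambda>x. complex_of_real (indicator K x)) \<in> borel_measurable lborel"
      by measurable
    have "(\<lambda>x. (cmod (complex_of_real (indicator K x)))\<^sup>2) = (indicator K :: 'a \<Rightarrow> real)" by (auto simp: indicator_def)
    then show "integrable lborel (\<lambda>x. (cmod (complex_of_real (indicator K x)))\<^sup>2)"
      by (simp, intro integrable_real_indicator) (use emeasure_bounded_finite[OF bounded_cball] in \<open>auto simp: K_def\<close>)
  qed
  from square_integrable_dominated[OF this _ \<phi>H] show s\<phi>: "square_integrable \<phi>" by simp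
  have sD: "square_integrable (D n)" for n
  proof -
    have "square_integrable (\<lambda>x. (1 / of_real (h n)) * (\<phi> (x + h n *\<^sub>R b) - \<phi> x))"
      by (intro square_integrable_scale square_integrable_diff square_integrable_translate s\<phi>)
    then show ?thesis by (simp add: D_def[abs_def])
  qed
  have lim: "(\<lambda>n. D n x) \<longlonglongrightarrow> d x" for x
  proof -
    have "((\<lambda>s. norm (\<phi> (x + s *\<^sub>R b) - \<phi> x - s *\<^sub>R d x) / norm s) \<longlongrightarrow> 0) (at 0)"
      using line[of x 0] by (simp add: has_vector_derivative_def has_derivative_at)
    moreover have "filterlim h (at 0) sequentially"
      unfolding filterlim_at using h(1,3) by (auto simp: less_imp_neq[symmetric])
    ultimately have "(\<lambda>n. norm (\<phi> (x + h n *\<^sub>R b) - \<phi> x - h n *\<^sub>R d x) / norm (h n)) \<longlonglongrightarrow> 0"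
      by (rule filterlim_compose)
    moreover have "norm (\<phi> (x + h n *\<^sub>R b) - \<phi> x - h n *\<^sub>R d x) / norm (h n) = norm (D n x - d x)" for n
    proof -
      have "D n x - d x = (\<phi> (x + h n *\<^sub>R b) - \<phi> x - h n *\<^sub>R d x) / of_real (h n)"
        using h(1)[of n] by (simp add: D_def scaleR_conv_of_real diff_divide_distrib)
      then show ?thesis by (simp add: norm_divide)
    qed
    ultimately have "(\<lambda>n. norm (D n x - d x)) \<longlonglongrightarrow> 0" by (simp only:)
    then show ?thesis by (rule LIM_zero_cancel[OF tendsto_norm_zero_cancel])
  qed
  have "square_integrable d" "(\<lambda>n. abs_l2 (D n)) \<longlonglongrightarrow> abs_l2 d"
    using l2_dominated_convergence[of D d H] sD lim DH Hi by auto
  then show "square_integrable (\<lambda>x. frechet_derivative \<phi> (at x) b)"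
    and "(\<lambda>n. abs_l2 (\<lambda>x. (\<phi> (x + h n *\<^sub>R b) - \<phi> x) / of_real (h n))) \<longlonglongrightarrow> abs_l2 (\<lambda>x. frechet_derivative \<phi> (at x) b)"
    by (simp_all add: D_def[abs_def] d_def[abs_def])
qed

lemma norm_iexp_diff_le: "cmod (iexp s - 1) \<le> \<bar>s\<bar>"
  using iexp_approx1[of s 0] by simp

lemma iexp_quotient_tendsto:
  assumes "\<And>n. h n \<noteq> 0" "h \<longlonglongrightarrow> 0"
  shows "(\<lambda>n. (iexp (h n * s) - 1) / of_real (h n)) \<longlonglongrightarrow> \<i> * of_real s"
proof -
  have "((\<lambda>z. exp (\<i> * of_real s * z)) has_field_derivative \<i> * of_real s) (at 0)"
    by (auto intro!: derivative_eq_intros)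
  then have "((\<lambda>z. (exp (\<i> * of_real s * z) - 1) / z) \<longlongrightarrow> \<i> * of_real s) (at 0)"
    by (simp add: has_field_derivative_iff)
  moreover have "filterlim (\<lambda>n. complex_of_real (h n)) (at 0) sequentially"
    using assms tendsto_of_real[OF assms(2), where 'a=complex] by (simp add: filterlim_at)
  ultimately have "(\<lambda>n. (exp (\<i> * of_real s * of_real (h n)) - 1) / of_real (h n)) \<longlonglongrightarrow> \<i> * of_real s"
    by (rule filterlim_compose)
  then show ?thesis by (simp add: mult_ac)
qed

text \<open>Integration by parts is carried out for difference quotients. On the Fourier side the
  quotient is a bounded multiplier \<open>m n\<close>, which tends to \<open>i\<close> times the
  coordinate and never exceeds it in modulus, so the limit can be taken in \<open>L2\<close> on both
  sides.\<close>

lemma fourier_imp_has_weak_partial: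
  fixes f g :: "'a::euclidean_space l2"
  assumes ae: "AE \<xi> in lborel. rep_l2 (fourier g) \<xi> = \<i> * of_real (\<xi> \<bullet> b) * rep_l2 (fourier f) \<xi>" and b: "b \<in> Basis"
  shows "has_weak_partial b f g"
  unfolding has_weak_partial_def
proof (intro allI impI)
  fix \<phi> :: "'a \<Rightarrow> complex" assume \<phi>: "test_function \<phi>"
  define h where "h n = 1 / real (Suc n)" for n
  have h: "\<And>n. 0 < h n" "\<And>n. h n \<le> 1" "h \<longlonglongrightarrow> 0"
    unfolding h_def using LIMSEQ_Suc[OF lim_1_over_n[where 'a=real]] by auto
  note Q = test_function_difference_quotient[OF \<phi> b h]
  \<comment> \<open>The weak derivative pairs without conjugation, whereas \<open>cinner\<close>
    conjugates its second argument; conjugating the test function reconciles the two.\<close>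
  define \<psi> where "\<psi> = abs_l2 (\<lambda>x. cnj (\<phi> x))"
  define Dn where "Dn n = abs_l2 (\<lambda>x. cnj ((\<phi> (x + h n *\<^sub>R b) - \<phi> x) / of_real (h n)))" for n
  define d where "d = abs_l2 (\<lambda>x. cnj (frechet_derivative \<phi> (at x) b))"
  have sq: "square_integrable (\<lambda>x. (\<phi> (x + h n *\<^sub>R b) - \<phi> x) / of_real (h n))" for n
    using square_integrable_scale[OF square_integrable_diff[OF square_integrable_translate[OF Q(1)] Q(1)], of "1 / of_real (h n)"]
    by simp
  have Dl: "Dn \<longlonglongrightarrow> d"
  proof -
    have "norm (Dn n - d) = norm (abs_l2 (\<lambda>x. (\<phi> (x + h n *\<^sub>R b) - \<phi> x) / of_real (h n)) - abs_l2 (\<lambda>x. frechet_derivative \<phi> (at x) b))" for n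
    proof -
      have e: "cmod (cnj u - cnj v) = cmod (u - v)" for u v
        by (metis complex_cnj_diff complex_mod_cnj)
      have "(norm (Dn n - d))\<^sup>2 = (norm (abs_l2 (\<lambda>x. (\<phi> (x + h n *\<^sub>R b) - \<phi> x) / of_real (h n)) - abs_l2 (\<lambda>x. frechet_derivative \<phi> (at x) b)))\<^sup>2"
        unfolding Dn_def d_def
        by (simp only: abs_l2_diff[symmetric] norm_abs_l2 square_integrable_diff square_integrable_cnj sq Q(2) e)
      then show ?thesis by simp
    qed
    moreover have "(\<lambda>n. norm (abs_l2 (\<lambda>x. (\<phi> (x + h n *\<^sub>R b) - \<phi> x) / of_real (h n)) - abs_l2 (\<lambda>x. frechet_derivative \<phi> (at x) b))) \<longlonglongrightarrow> 0"
      using Q(3) by (simp add: tendsto_norm_zero LIM_zero)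
    ultimately have "(\<lambda>n. norm (Dn n - d)) \<longlonglongrightarrow> 0" by (simp only:)
    then show ?thesis by (rule LIM_zero_cancel[OF tendsto_norm_zero_cancel])
  qed
  have s\<psi>: "square_integrable (\<lambda>x. cnj (\<phi> x))" using Q(1) by (rule square_integrable_cnj)
  define m where "m n \<xi> = (iexp (h n * (\<xi> \<bullet> b)) - 1) / of_real (h n)" for n \<xi>
  have mb: "cmod (m n \<xi>) \<le> \<bar>\<xi> \<bullet> b\<bar>" for n \<xi>
    using norm_iexp_diff_le[of "h n * (\<xi> \<bullet> b)"] h(1)[of n]
    by (simp add: m_def norm_divide abs_mult divide_le_eq mult.commute del: of_real_mult)
  have mb2: "cmod (m n \<xi>) \<le> 2 / h n" for n \<xi>
    using norm_triangle_ineq4[of "iexp (h n * (\<xi> \<bullet> b))" 1] h(1)[of n]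
    by (simp add: m_def norm_divide divide_right_mono del: of_real_mult)
  have [measurable]: "m n \<in> borel_measurable borel" for n unfolding m_def by measurable
  have F: "fourier (Dn n) = abs_l2 (\<lambda>\<xi>. m n \<xi> * rep_l2 (fourier \<psi>) \<xi>)" for n
  proof -
    have "Dn n = cscale (1 / of_real (h n)) (abs_l2 (\<lambda>x. cnj (\<phi> (x + h n *\<^sub>R b))) - \<psi>)"
      unfolding Dn_def \<psi>_def using square_integrable_translate[OF s\<psi>] s\<psi>
      by (simp add: abs_l2_diff[symmetric] abs_l2_cscale[symmetric] square_integrable_diff)
    also have "fourier \<dots> = cscale (1 / of_real (h n)) (abs_l2 (\<lambda>\<xi>. iexp ((h n *\<^sub>R b) \<bullet> \<xi>) * rep_l2 (fourier \<psi>) \<xi>) - abs_l2 (rep_l2 (fourier \<psi>)))"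
      using fourier_translate[OF s\<psi>, of "h n *\<^sub>R b"] by (simp add: fourier_cscale fourier_diff \<psi>_def)
    also have "\<dots> = abs_l2 (\<lambda>\<xi>. 1 / of_real (h n) * (iexp ((h n *\<^sub>R b) \<bullet> \<xi>) * rep_l2 (fourier \<psi>) \<xi> - rep_l2 (fourier \<psi>) \<xi>))"
    proof -
      have "square_integrable (\<lambda>\<xi>. iexp ((h n *\<^sub>R b) \<bullet> \<xi>) * rep_l2 (fourier \<psi>) \<xi>)"
        by (rule square_integrable_bounded_mult[where C=1]) auto
      then show ?thesis
        by (simp only: abs_l2_diff[symmetric] abs_l2_cscale[symmetric] square_integrable_diff square_integrable_rep)
    qed
    finally show ?thesis by (simp add: m_def left_diff_distrib inner_commute)
  qed
  have lim1: "(\<lambda>n. cinner f (Dn n)) \<longlonglongrightarrow> cinner f d"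
  proof -
    have "(\<lambda>n. cinner f (Dn n) - cinner f d) \<longlonglongrightarrow> 0"
    proof (rule tendsto_0_le[where K="norm f"])
      show "(\<lambda>n. Dn n - d) \<longlonglongrightarrow> 0" using Dl by (simp add: LIM_zero)
      show "\<forall>\<^sub>F n in sequentially. cmod (cinner f (Dn n) - cinner f d) \<le> norm (Dn n - d) * norm f"
        by (intro always_eventually allI)
          (simp only: cinner_diff_right[symmetric] mult.commute[of "norm (Dn _ - d)"] cmod_cinner_le)
    qed
    then show ?thesis by (rule LIM_zero_cancel)
  qed
  \<comment> \<open>The multiplier is shifted from the test function to \<open>f\<close>. There
    \<open>mb\<close> provides the majorant \<open>fourier g\<close>, independent of
    \<open>n\<close>, while the cruder \<open>mb2\<close> gives square-integrability for each single
    \<open>n\<close>.\<close>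
  define G where "G n = abs_l2 (\<lambda>\<xi>. cnj (m n \<xi>) * rep_l2 (fourier f) \<xi>)" for n
  have sG: "square_integrable (\<lambda>\<xi>. cnj (m n \<xi>) * rep_l2 (fourier f) \<xi>)" for n
    by (rule square_integrable_bounded_mult[where C="2 / h n"]) (use mb2 in auto)
  have Gl: "G \<longlonglongrightarrow> abs_l2 (\<lambda>\<xi>. - \<i> * of_real (\<xi> \<bullet> b) * rep_l2 (fourier f) \<xi>)"
    unfolding G_def
  proof (rule l2_dominated_convergence(2)[where H="\<lambda>\<xi>. cmod (rep_l2 (fourier g) \<xi>)", OF sG])
    show "AE \<xi> in lborel. (\<lambda>n. cnj (m n \<xi>) * rep_l2 (fourier f) \<xi>) \<longlonglongrightarrow> - \<i> * of_real (\<xi> \<bullet> b) * rep_l2 (fourier f) \<xi>"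
    proof (intro AE_I2)
      fix \<xi>
      have "(\<lambda>n. m n \<xi>) \<longlonglongrightarrow> \<i> * of_real (\<xi> \<bullet> b)"
        unfolding m_def using h by (intro iexp_quotient_tendsto) (auto simp: less_imp_neq[symmetric])
      then have "(\<lambda>n. cnj (m n \<xi>) * rep_l2 (fourier f) \<xi>) \<longlonglongrightarrow> cnj (\<i> * of_real (\<xi> \<bullet> b)) * rep_l2 (fourier f) \<xi>"
        by (intro tendsto_intros)
      then show "(\<lambda>n. cnj (m n \<xi>) * rep_l2 (fourier f) \<xi>) \<longlonglongrightarrow> - \<i> * of_real (\<xi> \<bullet> b) * rep_l2 (fourier f) \<xi>" by simp
    qed
    show "AE \<xi> in lborel. cmod (cnj (m n \<xi>) * rep_l2 (fourier f) \<xi>) \<le> cmod (rep_l2 (fourier g) \<xi>)" for n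
      using ae by eventually_elim (use mb in \<open>auto simp: norm_mult intro!: mult_right_mono\<close>)
    show "integrable lborel (\<lambda>\<xi>. (cmod (rep_l2 (fourier g) \<xi>))\<^sup>2)"
      using square_integrable_rep[of "fourier g"] by (simp add: square_integrable_def)
  qed measurable
  also have "abs_l2 (\<lambda>\<xi>. - \<i> * of_real (\<xi> \<bullet> b) * rep_l2 (fourier f) \<xi>) = cscale (-1) (fourier g)"
  proof -
    have "AE \<xi> in lborel. rep_l2 (cscale (-1) (fourier g)) \<xi> = - \<i> * of_real (\<xi> \<bullet> b) * rep_l2 (fourier f) \<xi>"
      using rep_l2_cscale[of "-1" "fourier g"] ae by eventually_elim simp
    moreover then have "square_integrable (\<lambda>\<xi>. - \<i> * of_real (\<xi> \<bullet> b) * rep_l2 (fourier f) \<xi>)"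
      by (intro square_integrable_AE_eq[OF square_integrable_rep]) auto
    ultimately show ?thesis by (intro abs_l2_eqI) (auto elim!: eventually_mono)
  qed
  finally have Gl: "G \<longlonglongrightarrow> cscale (-1) (fourier g)" .
  have "(\<lambda>n. cinner (G n) (fourier \<psi>)) \<longlonglongrightarrow> cinner (cscale (-1) (fourier g)) (fourier \<psi>)"
  proof -
    have "(\<lambda>n. cinner (G n) (fourier \<psi>) - cinner (cscale (-1) (fourier g)) (fourier \<psi>)) \<longlonglongrightarrow> 0"
    proof (rule tendsto_0_le[where K="norm (fourier \<psi>)"])
      show "(\<lambda>n. G n - cscale (-1) (fourier g)) \<longlonglongrightarrow> 0" using Gl by (simp add: LIM_zero)
      show "\<forall>\<^sub>F n in sequentially. cmod (cinner (G n) (fourier \<psi>) - cinner (cscale (-1) (fourier g)) (fourier \<psi>))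
          \<le> norm (G n - cscale (-1) (fourier g)) * norm (fourier \<psi>)"
        by (intro always_eventually allI) (simp only: cinner_diff_left[symmetric] cmod_cinner_le)
    qed
    then show ?thesis by (rule LIM_zero_cancel)
  qed
  moreover have "cinner (G n) (fourier \<psi>) = cinner f (Dn n)" for n
  proof -
    have "square_integrable (\<lambda>\<xi>. m n \<xi> * rep_l2 (fourier \<psi>) \<xi>)"
      by (rule square_integrable_bounded_mult[where C="2 / h n"]) (use mb2 in auto)
    then have "cinner (fourier f) (fourier (Dn n)) = (LINT \<xi>|lborel. rep_l2 (fourier f) \<xi> * cnj (m n \<xi> * rep_l2 (fourier \<psi>) \<xi>))"
      unfolding F by (rule cinner_rep_abs)
    also have "\<dots> = cinner (G n) (fourier \<psi>)"
      unfolding G_def by (subst cinner_abs_rep[OF sG]) (simp add: mult_ac)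
    finally show ?thesis by (simp add: fourier_cinner)
  qed
  ultimately have "(\<lambda>n. cinner f (Dn n)) \<longlonglongrightarrow> - cinner g \<psi>"
    by (simp add: cinner_cscale_left fourier_cinner)
  with lim1 have "cinner f d = - cinner g \<psi>" by (rule LIMSEQ_unique)
  then show "(LINT x|lborel. rep_l2 f x * frechet_derivative \<phi> (at x) b) = - (LINT x|lborel. rep_l2 g x * \<phi> x)"
    unfolding d_def \<psi>_def by (simp add: cinner_rep_abs square_integrable_cnj Q(2) s\<psi>)
qed

lemma has_weak_partial_iff_fourier:
  "b \<in> Basis \<Longrightarrow> has_weak_partial b f g \<longleftrightarrow>
    (AE \<xi> in lborel. rep_l2 (fourier g) \<xi> = \<i> * of_real (\<xi> \<bullet> b) * rep_l2 (fourier f) \<xi>)"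
  using has_weak_partial_imp_fourier fourier_imp_has_weak_partial by blast

lemma weak_partial_eqI:
  assumes w: "has_weak_partial b f g" and b: "b \<in> Basis"
  shows "weak_partial b f = g"
  unfolding weak_partial_def
proof (rule the_equality[where P="has_weak_partial b f", OF w])
  fix g' assume "has_weak_partial b f g'"
  then have "AE \<xi> in lborel. rep_l2 (fourier g') \<xi> = rep_l2 (fourier g) \<xi>"
    using has_weak_partial_imp_fourier[OF _ b] w by (smt (verit) eventually_elim2)
  then show "g' = g" by (simp flip: l2_eq_iff add: fourier_eq_iff)
qed

section \<open>The Sobolev space in Fourier space\<close>

definition bounded_symbol :: "('a::euclidean_space \<Rightarrow> complex) \<Rightarrow> bool" where
  "bounded_symbol m \<longleftrightarrow> m \<in> borel_measurable borel \<and> (\<exists>C. \<forall>x. cmod (m x) \<le> C)"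

definition multiplier :: "('a::euclidean_space \<Rightarrow> complex) \<Rightarrow> 'a l2 \<Rightarrow> 'a l2" where
  "multiplier m f = abs_l2 (\<lambda>x. m x * rep_l2 f x)"

lemma bounded_symbolI:
  "m \<in> borel_measurable borel \<Longrightarrow> (\<And>x. cmod (m x) \<le> C) \<Longrightarrow> bounded_symbol m"
  unfolding bounded_symbol_def by blast

lemma square_integrable_symbol:
  "bounded_symbol m \<Longrightarrow> square_integrable (\<lambda>x. m x * rep_l2 f x)"
  unfolding bounded_symbol_def using square_integrable_bounded_mult[OF square_integrable_rep] by blast

lemma rep_multiplier:
  "bounded_symbol m \<Longrightarrow> AE x in lborel. rep_l2 (multiplier m f) x = m x * rep_l2 f x"
  unfolding multiplier_def by (intro rep_abs_l2 square_integrable_symbol)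

lemma cinner_multiplier:
  "bounded_symbol m \<Longrightarrow> cinner (multiplier m f) g = (LINT x|lborel. m x * rep_l2 f x * cnj (rep_l2 g x))"
  unfolding multiplier_def by (intro cinner_abs_rep square_integrable_symbol)

lemma cinner_multiplier_multiplier:
  assumes "bounded_symbol m" "bounded_symbol k"
  shows "cinner (multiplier m f) (multiplier k g) = (LINT x|lborel. (m x * cnj (k x)) * rep_l2 f x * cnj (rep_l2 g x))"
  unfolding multiplier_def by (subst cinner_abs) (use assms in \<open>auto intro: square_integrable_symbol simp: mult_ac\<close>)

lemma multiplier_add:
  assumes m: "bounded_symbol m"
  shows "multiplier m (f + g) = multiplier m f + multiplier m g"
proof -
  have "AE x in lborel. m x * rep_l2 (f + g) x = m x * rep_l2 f x + m x * rep_l2 g x"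
    using rep_l2_add[of f g] by eventually_elim (simp add: distrib_left)
  then show ?thesis
    unfolding multiplier_def abs_l2_add[OF square_integrable_symbol[OF m] square_integrable_symbol[OF m], symmetric]
    by (intro abs_l2_cong square_integrable_symbol[OF m] square_integrable_add)
qed

lemma multiplier_cscale:
  assumes m: "bounded_symbol m"
  shows "multiplier m (cscale c f) = cscale c (multiplier m f)"
proof -
  have "AE x in lborel. m x * rep_l2 (cscale c f) x = c * (m x * rep_l2 f x)"
    using rep_l2_cscale[of c f] by eventually_elim simp
  then show ?thesis
    unfolding multiplier_def abs_l2_cscale[OF square_integrable_symbol[OF m], symmetric]
    by (intro abs_l2_cong square_integrable_symbol[OF m] square_integrable_scale)
qed

lemma norm_multiplier_le:
  fixes f :: "'a::euclidean_space l2"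
  assumes m: "m \<in> borel_measurable borel" and C: "\<And>x. cmod (m x) \<le> C"
  shows "norm (multiplier m f) \<le> C * norm f"
proof -
  have C0: "C \<ge> 0" using C[of undefined] norm_ge_zero order_trans by blast
  have bs: "bounded_symbol m" using m C by (rule bounded_symbolI)
  have "(norm (multiplier m f))\<^sup>2 = (LINT x|lborel. (cmod (m x * rep_l2 f x))\<^sup>2)"
    unfolding multiplier_def using bs by (intro norm_abs_l2 square_integrable_symbol)
  also have "\<dots> \<le> (LINT x|lborel. C\<^sup>2 * (cmod (rep_l2 f x))\<^sup>2)"
  proof (rule integral_mono')
    show "integrable lborel (\<lambda>x. C\<^sup>2 * (cmod (rep_l2 f x))\<^sup>2)"
      using square_integrable_rep[of f] by (simp add: square_integrable_def)
  qed (use C in \<open>auto simp: norm_mult power_mult_distrib intro!: mult_right_mono power_mono\<close>)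
  also have "\<dots> = (C * norm f)\<^sup>2" by (simp add: power_mult_distrib norm_l2_rep)
  finally show ?thesis by (rule power2_le_imp_le) (simp add: C0)
qed

section \<open>Parametrising the Sobolev space by square-integrable functions\<close>

definition weight :: "'a::euclidean_space \<Rightarrow> real" where
  "weight \<xi> = 1 / (1 + (norm \<xi>)\<^sup>2)"

lemma weight_measurable [measurable]: "weight \<in> borel_measurable borel"
  unfolding weight_def by measurable

lemma weight_pos: "weight \<xi> > 0"
  by (simp add: weight_def add_pos_nonneg)

lemma weight_le_1: "weight \<xi> \<le> 1"
  by (simp add: weight_def divide_le_eq add_pos_nonneg)

lemma weight_nonneg [simp]: "0 \<le> weight \<xi>"
  using weight_pos[of \<xi>] by simp

lemma weight_mult_norm2: "(norm \<xi>)\<^sup>2 * weight \<xi> = 1 - weight \<xi>"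
proof -
  have "1 + (norm \<xi>)\<^sup>2 > 0" by (simp add: add_pos_nonneg)
  then show ?thesis by (simp add: weight_def field_simps)
qed

lemma abs_inner_Basis_mult_weight_le:
  assumes "b \<in> Basis" "c \<in> Basis"
  shows "\<bar>\<xi> \<bullet> b\<bar> * \<bar>\<xi> \<bullet> c\<bar> * weight \<xi> \<le> 1"
proof -
  have "\<bar>\<xi> \<bullet> b\<bar> * \<bar>\<xi> \<bullet> c\<bar> \<le> norm \<xi> * norm \<xi>" using assms by (intro mult_mono Basis_le_norm) auto
  then have "\<bar>\<xi> \<bullet> b\<bar> * \<bar>\<xi> \<bullet> c\<bar> * weight \<xi> \<le> (norm \<xi>)\<^sup>2 * weight \<xi>"
    using weight_pos[of \<xi>] by (intro mult_right_mono) (auto simp: power2_eq_square)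
  then show ?thesis using weight_pos[of \<xi>] by (simp add: weight_mult_norm2)
qed

lemma abs_inner_Basis_weight_le:
  assumes "b \<in> Basis"
  shows "\<bar>\<xi> \<bullet> b\<bar> * weight \<xi> \<le> 1"
proof -
  have "\<bar>\<xi> \<bullet> b\<bar> \<le> 1 + (\<bar>\<xi> \<bullet> b\<bar>)\<^sup>2" using sum_squares_bound[of 1 "\<bar>\<xi> \<bullet> b\<bar>"] by (simp add: power2_eq_square)
  also have "\<dots> \<le> 1 + (norm \<xi>)\<^sup>2" using Basis_le_norm[OF assms, of \<xi>] power_mono[of "\<bar>\<xi> \<bullet> b\<bar>" "norm \<xi>" 2] by simp
  finally show ?thesis by (simp add: weight_def divide_le_eq add_pos_nonneg)
qed

text \<open>\<open>(1 - \<Delta>)\<^sup>-\<^sup>1\<close> composed with the inverse Fourier transform; it maps \<open>L\<^sup>2\<close>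
  bijectively onto \<open>H\<^sup>2\<close>, so that all forms can be pulled back to \<open>L\<^sup>2\<close>.\<close>

definition lift_h2 :: "'a::euclidean_space l2 \<Rightarrow> 'a l2" where
  "lift_h2 \<phi> = ifourier (multiplier (\<lambda>\<xi>. of_real (weight \<xi>)) \<phi>)"

lemma bounded_symbol_weight: "bounded_symbol (\<lambda>\<xi>. complex_of_real (weight \<xi>))"
  by (rule bounded_symbolI[where C=1]) (auto simp: weight_le_1)

lemma bounded_symbol_weight1:
  "b \<in> Basis \<Longrightarrow> bounded_symbol (\<lambda>\<xi>. \<i> * complex_of_real (\<xi> \<bullet> b) * of_real (weight \<xi>))"
  by (rule bounded_symbolI[where C=1])
    (auto simp: norm_mult abs_inner_Basis_weight_le)

lemma bounded_symbol_weight2: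
  "b \<in> Basis \<Longrightarrow> c \<in> Basis \<Longrightarrow> bounded_symbol (\<lambda>\<xi>. - complex_of_real (\<xi> \<bullet> b) * of_real (\<xi> \<bullet> c) * of_real (weight \<xi>))"
  by (rule bounded_symbolI[where C=1])
    (auto simp: norm_mult abs_inner_Basis_mult_weight_le)

lemma lift_h2_add: "lift_h2 (\<phi> + \<psi>) = lift_h2 \<phi> + lift_h2 \<psi>"
  by (simp add: lift_h2_def multiplier_add bounded_symbol_weight ifourier_add)

lemma lift_h2_cscale: "lift_h2 (cscale c \<phi>) = cscale c (lift_h2 \<phi>)"
  by (simp add: lift_h2_def multiplier_cscale bounded_symbol_weight ifourier_cscale)

lemma lift_h2_diff: "lift_h2 (\<phi> - \<psi>) = lift_h2 \<phi> - lift_h2 \<psi>"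
  by (simp add: minus_l2_def lift_h2_add lift_h2_cscale)

lemma norm_lift_h2_le: "norm (lift_h2 \<phi>) \<le> norm \<phi>"
  unfolding lift_h2_def using norm_multiplier_le[of "\<lambda>\<xi>. complex_of_real (weight \<xi>)" 1 \<phi>]
  by (simp add: weight_le_1)

lemma has_weak_partial_ifourier_multiplier:
  assumes "bounded_symbol m" "bounded_symbol k" "b \<in> Basis" "\<And>\<xi>. k \<xi> = \<i> * of_real (\<xi> \<bullet> b) * m \<xi>"
  shows "has_weak_partial b (ifourier (multiplier m \<phi>)) (ifourier (multiplier k \<phi>))"
proof -
  have "AE \<xi> in lborel. rep_l2 (multiplier k \<phi>) \<xi> = \<i> * of_real (\<xi> \<bullet> b) * rep_l2 (multiplier m \<phi>) \<xi>"
    using rep_multiplier[OF assms(1), of \<phi>] rep_multiplier[OF assms(2), of \<phi>]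
    by eventually_elim (simp add: assms(4))
  then show ?thesis by (simp add: has_weak_partial_iff_fourier assms(3))
qed

lemma weak_partial_lift_h2:
  assumes b: "b \<in> Basis"
  shows "has_weak_partial b (lift_h2 \<phi>) (ifourier (multiplier (\<lambda>\<xi>. \<i> * of_real (\<xi> \<bullet> b) * of_real (weight \<xi>)) \<phi>))"
  unfolding lift_h2_def
  by (rule has_weak_partial_ifourier_multiplier) (use b in \<open>auto intro: bounded_symbol_weight bounded_symbol_weight1\<close>)

lemma weak_partial2_lift_h2:
  assumes b: "b \<in> Basis" "c \<in> Basis"
  shows "has_weak_partial c (ifourier (multiplier (\<lambda>\<xi>. \<i> * of_real (\<xi> \<bullet> b) * of_real (weight \<xi>)) \<phi>))
    (ifourier (multiplier (\<lambda>\<xi>. - of_real (\<xi> \<bullet> b) * of_real (\<xi> \<bullet> c) * of_real (weight \<xi>)) \<phi>))"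
  by (rule has_weak_partial_ifourier_multiplier[OF bounded_symbol_weight1[OF b(1)] bounded_symbol_weight2[OF b] b(2)])
    (simp add: complex_eq_iff)

lemma lift_h2_in_sobolev: "lift_h2 \<phi> \<in> sobolev 2"
  unfolding numeral_2_eq_2 using weak_partial_lift_h2 weak_partial2_lift_h2 by simp blast

lemma bounded_symbol_laplace: "bounded_symbol (\<lambda>\<xi>::'a::euclidean_space. - complex_of_real ((norm \<xi>)\<^sup>2 * weight \<xi>))"
proof (rule bounded_symbolI[where C=1])
  fix \<xi> :: 'a
  have "cmod (- complex_of_real ((norm \<xi>)\<^sup>2 * weight \<xi>)) = (norm \<xi>)\<^sup>2 * weight \<xi>"
    unfolding norm_minus_cancel norm_of_real by simp
  then show "cmod (- complex_of_real ((norm \<xi>)\<^sup>2 * weight \<xi>)) \<le> 1" by (simp add: weight_mult_norm2)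
qed measurable

lemma norm_sq_Basis: "(norm (\<xi>::'a::euclidean_space))\<^sup>2 = (\<Sum>b\<in>Basis. (\<xi> \<bullet> b)\<^sup>2)"
  unfolding power2_norm_eq_inner euclidean_inner[of \<xi> \<xi>] by (simp add: power2_eq_square)

lemma laplacian_lift_h2:
  "laplacian (lift_h2 \<phi>) = ifourier (multiplier (\<lambda>\<xi>. - of_real ((norm \<xi>)\<^sup>2 * weight \<xi>)) \<phi>)"
proof -
  have wp: "weak_partial b (weak_partial b (lift_h2 \<phi>))
      = ifourier (multiplier (\<lambda>\<xi>. - of_real (\<xi> \<bullet> b) * of_real (\<xi> \<bullet> b) * of_real (weight \<xi>)) \<phi>)" if "b \<in> Basis" for b
    using weak_partial_eqI[OF weak_partial_lift_h2[OF that] that] weak_partial_eqI[OF weak_partial2_lift_h2[OF that that] that]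
    by simp
  have "fourier (laplacian (lift_h2 \<phi>)) = (\<Sum>b\<in>Basis. multiplier (\<lambda>\<xi>. - of_real (\<xi> \<bullet> b) * of_real (\<xi> \<bullet> b) * of_real (weight \<xi>)) \<phi>)"
    unfolding laplacian_def fourier_sum by (intro sum.cong) (simp_all add: wp)
  also have "\<dots> = abs_l2 (\<lambda>\<xi>. \<Sum>b\<in>Basis. - of_real (\<xi> \<bullet> b) * of_real (\<xi> \<bullet> b) * of_real (weight \<xi>) * rep_l2 \<phi> \<xi>)"
    unfolding multiplier_def by (rule abs_l2_sum[symmetric]) (intro square_integrable_symbol bounded_symbol_weight2)
  also have "(\<lambda>\<xi>. \<Sum>b\<in>Basis. - of_real (\<xi> \<bullet> b) * of_real (\<xi> \<bullet> b) * of_real (weight \<xi>) * rep_l2 \<phi> \<xi>)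
      = (\<lambda>\<xi>. - of_real ((norm \<xi>)\<^sup>2 * weight \<xi>) * rep_l2 \<phi> \<xi>)"
    unfolding norm_sq_Basis by (simp add: sum_distrib_right sum_negf power2_eq_square fun_eq_iff)
  finally have "fourier (laplacian (lift_h2 \<phi>)) = multiplier (\<lambda>\<xi>. - of_real ((norm \<xi>)\<^sup>2 * weight \<xi>)) \<phi>"
    by (simp add: multiplier_def)
  then show ?thesis by (metis ifourier_fourier)
qed

text \<open>The preimage is the Fourier transform of \<open>f\<close> minus the Laplacian of
  \<open>f\<close>. The second derivatives along each \<open>b\<close> supply the terms whose sum is
  multiplication by minus the squared norm, so dividing by \<open>1 + (norm \<xi>)^2\<close> returns
  the transform of \<open>f\<close>.\<close>

lemma sobolev_2_imp_lift_h2: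
  fixes f :: "'a::euclidean_space l2"
  assumes "f \<in> sobolev 2"
  shows "\<exists>\<phi>. f = lift_h2 \<phi>"
proof -
  have "\<forall>b\<in>Basis. \<exists>g. has_weak_partial b f g \<and> (\<exists>g2. has_weak_partial b g g2)"
    using assms unfolding numeral_2_eq_2 by simp blast
  then obtain g g2 where g: "\<And>b. b \<in> Basis \<Longrightarrow> has_weak_partial b f (g b)"
      "\<And>b. b \<in> Basis \<Longrightarrow> has_weak_partial b (g b) (g2 b)"
    by metis
  define \<phi> where "\<phi> = fourier f - (\<Sum>b\<in>Basis. fourier (g2 b))"
  have "AE \<xi> in lborel. \<forall>b\<in>(Basis::'a set). rep_l2 (fourier (g2 b)) \<xi> = - of_real ((\<xi> \<bullet> b)\<^sup>2) * rep_l2 (fourier f) \<xi>"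
  proof (subst AE_finite_all[OF finite_Basis], intro ballI)
    fix b :: 'a assume b: "b \<in> Basis"
    show "AE \<xi> in lborel. rep_l2 (fourier (g2 b)) \<xi> = - of_real ((\<xi> \<bullet> b)\<^sup>2) * rep_l2 (fourier f) \<xi>"
      using has_weak_partial_imp_fourier[OF g(1)[OF b] b] has_weak_partial_imp_fourier[OF g(2)[OF b] b]
      by eventually_elim (simp add: complex_eq_iff power2_eq_square algebra_simps)
  qed
  moreover have "AE \<xi> in lborel. rep_l2 (\<Sum>b\<in>Basis. fourier (g2 b)) \<xi> = (\<Sum>b\<in>Basis. rep_l2 (fourier (g2 b)) \<xi>)"
    using rep_abs_l2[OF square_integrable_sum[of Basis "\<lambda>b. rep_l2 (fourier (g2 b))"]] by (simp add: abs_l2_sum)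
  ultimately have ae: "AE \<xi> in lborel. rep_l2 \<phi> \<xi> = of_real (1 + (norm \<xi>)\<^sup>2) * rep_l2 (fourier f) \<xi>"
    using rep_l2_diff[of "fourier f" "\<Sum>b\<in>Basis. fourier (g2 b)"]
  proof eventually_elim
    case (elim \<xi>)
    then show ?case by (simp add: \<phi>_def norm_sq_Basis sum_distrib_right sum_negf distrib_right)
  qed
  have "AE \<xi> in lborel. of_real (weight \<xi>) * rep_l2 \<phi> \<xi> = rep_l2 (fourier f) \<xi>"
    using ae
  proof eventually_elim
    case (elim \<xi>)
    have "weight \<xi> * (1 + (norm \<xi>)\<^sup>2) = 1" using weight_pos[of \<xi>] weight_mult_norm2[of \<xi>] by (simp add: algebra_simps)
    then show ?case unfolding elim mult.assoc[symmetric] of_real_mult[symmetric] by simp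
  qed
  then have "multiplier (\<lambda>\<xi>. of_real (weight \<xi>)) \<phi> = fourier f"
    unfolding multiplier_def by (intro abs_l2_eqI square_integrable_symbol bounded_symbol_weight)
  then show ?thesis by (auto simp: lift_h2_def intro!: exI[of _ \<phi>])
qed

text \<open>The symbol of the unperturbed operator, multiplied by \<open>weight\<close> once for
  each argument of the form. The fourth-order growth cancels, so the pulled-back form is bounded on
  \<open>L2\<close>.\<close>

definition form_symbol :: "real \<Rightarrow> 'a::euclidean_space \<Rightarrow> real" where
  "form_symbol \<epsilon> \<xi> = (\<epsilon>\<^sup>2 * ((norm \<xi>)\<^sup>2)\<^sup>2 + (norm \<xi>)\<^sup>2) * (weight \<xi>)\<^sup>2"

lemma form_symbol_measurable [measurable]: "form_symbol \<epsilon> \<in> borel_measurable borel"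
  unfolding form_symbol_def by measurable

lemma form_symbol_bounds: "0 \<le> form_symbol \<epsilon> \<xi>" "form_symbol \<epsilon> \<xi> \<le> \<epsilon>\<^sup>2 + 1"
proof -
  let ?s = "(norm \<xi>)\<^sup>2 * weight \<xi>"
  have s: "0 \<le> ?s" "?s \<le> 1" "0 \<le> weight \<xi>" "weight \<xi> \<le> 1"
    using weight_pos[of \<xi>] weight_le_1[of \<xi>] by (auto simp: weight_mult_norm2)
  have e: "form_symbol \<epsilon> \<xi> = \<epsilon>\<^sup>2 * ?s\<^sup>2 + ?s * weight \<xi>"
    by (simp add: form_symbol_def power_mult_distrib algebra_simps power2_eq_square)
  show "0 \<le> form_symbol \<epsilon> \<xi>" unfolding e using s by simp
  show "form_symbol \<epsilon> \<xi> \<le> \<epsilon>\<^sup>2 + 1"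
    unfolding e using mult_left_mono[OF power_le_one[OF s(1,2), of 2], of "\<epsilon>\<^sup>2"] mult_le_one[OF s(2-4)] by simp
qed

lemma bounded_symbol_form: "bounded_symbol (\<lambda>\<xi>. complex_of_real (form_symbol \<epsilon> \<xi>))"
  by (rule bounded_symbolI[where C="\<epsilon>\<^sup>2 + 1"]) (auto simp: form_symbol_bounds)

lemma ifourier_cinner: "cinner (ifourier x) (ifourier y) = cinner x y"
  using fourier_cinner[of "ifourier x" "ifourier y"] by simp

text \<open>By Plancherel the Laplacian term and the gradient terms become integrals against the
  same integrable product \<open>P\<close>, and their symbols add up to a single bounded
  multiplier.\<close>

lemma energy_form_lift_h2:
  "energy_form \<epsilon> \<mu> (lift_h2 \<phi>) (lift_h2 \<psi>) = cinner (multiplier (\<lambda>\<xi>. of_real (form_symbol \<epsilon> \<xi>)) \<phi>) \<psi>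
    + signed_integral \<mu> (\<lambda>x. continuous_rep (lift_h2 \<phi>) x * cnj (continuous_rep (lift_h2 \<psi>) x))"
proof -
  define P where "P \<xi> = rep_l2 \<phi> \<xi> * cnj (rep_l2 \<psi> \<xi>)" for \<xi>
  have P: "integrable lborel P" unfolding P_def by (intro square_integrable_mult square_integrable_rep)
  have int: "integrable lborel (\<lambda>\<xi>. complex_of_real (m \<xi>) * P \<xi>)"
    if [measurable]: "m \<in> borel_measurable borel" and C: "\<And>\<xi>. \<bar>m \<xi>\<bar> \<le> C" for m C
  proof (rule Bochner_Integration.integrable_bound)
    have [measurable]: "P \<in> borel_measurable borel" using P by simp
    show "(\<lambda>\<xi>. complex_of_real (m \<xi>) * P \<xi>) \<in> borel_measurable lborel" by measurable
    show "integrable lborel (\<lambda>\<xi>. C * cmod (P \<xi>))" using P by simp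
    have "C \<ge> 0" using C[of undefined] by linarith
    then show "AE \<xi> in lborel. norm (complex_of_real (m \<xi>) * P \<xi>) \<le> norm (C * cmod (P \<xi>))"
      using C by (auto simp: norm_mult abs_mult intro!: mult_right_mono)
  qed
  have 1: "cinner (laplacian (lift_h2 \<phi>)) (laplacian (lift_h2 \<psi>)) = (LINT \<xi>|lborel. of_real (((norm \<xi>)\<^sup>2 * weight \<xi>)\<^sup>2) * P \<xi>)"
    unfolding laplacian_lift_h2 ifourier_cinner cinner_multiplier_multiplier[OF bounded_symbol_laplace bounded_symbol_laplace]
    by (simp add: P_def power2_eq_square mult.assoc)
  have 2: "cinner (weak_partial b (lift_h2 \<phi>)) (weak_partial b (lift_h2 \<psi>)) = (LINT \<xi>|lborel. of_real ((\<xi> \<bullet> b)\<^sup>2 * (weight \<xi>)\<^sup>2) * P \<xi>)"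
    if b: "b \<in> Basis" for b
    unfolding weak_partial_eqI[OF weak_partial_lift_h2[OF b] b] ifourier_cinner
      cinner_multiplier_multiplier[OF bounded_symbol_weight1[OF b] bounded_symbol_weight1[OF b]]
    by (simp add: P_def power2_eq_square mult_ac)
  have i1: "integrable lborel (\<lambda>\<xi>. complex_of_real (((norm \<xi>)\<^sup>2 * weight \<xi>)\<^sup>2) * P \<xi>)"
    by (rule int[where C=1]) (auto simp: weight_mult_norm2 weight_le_1 intro!: power_le_one)
  have i2: "integrable lborel (\<lambda>\<xi>. complex_of_real ((\<xi> \<bullet> b)\<^sup>2 * (weight \<xi>)\<^sup>2) * P \<xi>)" if b: "b \<in> Basis" for b
  proof (rule int[where C=1])
    fix \<xi>
    have "(\<bar>\<xi> \<bullet> b\<bar> * weight \<xi>)\<^sup>2 \<le> 1"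
      using abs_inner_Basis_weight_le[OF b, of \<xi>] weight_pos[of \<xi>] by (intro power_le_one) auto
    then show "\<bar>(\<xi> \<bullet> b)\<^sup>2 * (weight \<xi>)\<^sup>2\<bar> \<le> 1" by (simp add: power_mult_distrib)
  qed measurable
  have "of_real (\<epsilon>\<^sup>2) * cinner (laplacian (lift_h2 \<phi>)) (laplacian (lift_h2 \<psi>))
     + (\<Sum>b\<in>Basis. cinner (weak_partial b (lift_h2 \<phi>)) (weak_partial b (lift_h2 \<psi>)))
     = (LINT \<xi>|lborel. of_real (\<epsilon>\<^sup>2) * (of_real (((norm \<xi>)\<^sup>2 * weight \<xi>)\<^sup>2) * P \<xi>)
        + (\<Sum>b\<in>Basis. of_real ((\<xi> \<bullet> b)\<^sup>2 * (weight \<xi>)\<^sup>2) * P \<xi>))"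
    using i1 i2 by (simp add: 1 2 Bochner_Integration.integral_sum del: of_real_mult of_real_power)
  also have "\<dots> = (LINT \<xi>|lborel. of_real (form_symbol \<epsilon> \<xi>) * P \<xi>)"
  proof (rule Bochner_Integration.integral_cong)
    fix \<xi> :: 'a
    have "form_symbol \<epsilon> \<xi> = \<epsilon>\<^sup>2 * ((norm \<xi>)\<^sup>2 * weight \<xi>)\<^sup>2 + (\<Sum>b\<in>Basis. (\<xi> \<bullet> b)\<^sup>2 * (weight \<xi>)\<^sup>2)"
    proof -
      have "form_symbol \<epsilon> \<xi> = \<epsilon>\<^sup>2 * ((norm \<xi>)\<^sup>2 * weight \<xi>)\<^sup>2 + (norm \<xi>)\<^sup>2 * (weight \<xi>)\<^sup>2"
        by (simp add: form_symbol_def power_mult_distrib algebra_simps)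
      also have "(norm \<xi>)\<^sup>2 * (weight \<xi>)\<^sup>2 = (\<Sum>b\<in>Basis. (\<xi> \<bullet> b)\<^sup>2 * (weight \<xi>)\<^sup>2)"
        by (simp add: norm_sq_Basis sum_distrib_right)
      finally show ?thesis .
    qed
    then show "of_real (\<epsilon>\<^sup>2) * (of_real (((norm \<xi>)\<^sup>2 * weight \<xi>)\<^sup>2) * P \<xi>)
        + (\<Sum>b\<in>Basis. of_real ((\<xi> \<bullet> b)\<^sup>2 * (weight \<xi>)\<^sup>2) * P \<xi>) = of_real (form_symbol \<epsilon> \<xi>) * P \<xi>"
      by (simp only: of_real_add of_real_mult of_real_sum distrib_right sum_distrib_right mult.assoc)
  qed simp
  also have "\<dots> = cinner (multiplier (\<lambda>\<xi>. of_real (form_symbol \<epsilon> \<xi>)) \<phi>) \<psi>"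
    by (simp add: cinner_multiplier[OF bounded_symbol_form] P_def mult.assoc)
  finally show ?thesis by (simp add: energy_form_def)
qed

section \<open>The continuous representative\<close>

text \<open>The exponent is chosen so that three factors make up the power \<open>-2\<close>; the
  tail still decays like the power \<open>-4/3\<close> and is integrable. The comparison function
  comes from \<open>(1 + s)^2 \<le> 2 (1 + s^2)\<close> and has an explicit antiderivative on the
  half-line; evenness covers the other half.\<close>

lemma integrable_powr_real: "integrable lborel (\<lambda>s::real. (1 + s\<^sup>2) powr (- 2 / 3))"
proof (rule integrableI_bounded)
  define g where "g s = (1 + s\<^sup>2) powr (- 2 / 3)" for s :: real
  have g0: "g s \<ge> 0" for s by (simp add: g_def)
  have [measurable]: "g \<in> borel_measurable borel" unfolding g_def by measurable
  have le: "g s \<le> 2 powr (2/3) * (1 + s) powr (- 4 / 3)" if "s \<ge> 0" for s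
  proof -
    have "(1 + s)\<^sup>2 \<le> 2 * (1 + s\<^sup>2)" using sum_squares_bound[of 1 s] by (simp add: power2_sum)
    then have "(1 + s\<^sup>2) powr (- 2 / 3) \<le> ((1 + s)\<^sup>2 / 2) powr (- 2 / 3)"
      using that by (intro powr_mono2') auto
    also have "\<dots> = 2 powr (2/3) * (1 + s) powr (- 4 / 3)"
      using that by (simp add: powr_divide powr_minus_divide powr_powr flip: powr_numeral)
    finally show ?thesis by (simp add: g_def)
  qed
  have half: "(\<integral>\<^sup>+s. ennreal (g s) * indicator {0..} s \<partial>lborel) < \<infinity>"
  proof -
    have "(\<integral>\<^sup>+s. ennreal (g s) * indicator {0..} s \<partial>lborel)
        \<le> (\<integral>\<^sup>+s. ennreal (2 powr (2/3) * (1 + s) powr (- 4 / 3)) * indicator {0..} s \<partial>lborel)"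
      using le by (intro nn_integral_mono) (auto simp: indicator_def intro!: ennreal_leI)
    also have "\<dots> = ennreal (0 - (- 3 * 2 powr (2/3) * (1 + 0) powr (- 1 / 3)))"
    proof (rule nn_integral_FTC_atLeast)
      fix s :: real assume "0 \<le> s"
      then show "((\<lambda>s. - 3 * 2 powr (2/3) * (1 + s) powr (- 1 / 3)) has_real_derivative 2 powr (2/3) * (1 + s) powr (- 4 / 3)) (at s)"
        by (auto intro!: derivative_eq_intros)
    next
      show "((\<lambda>s::real. - 3 * 2 powr (2/3) * (1 + s) powr (- 1 / 3)) \<longlongrightarrow> 0) at_top" by real_asymp
    qed (auto, measurable)
    finally show ?thesis by (rule le_less_trans) simp
  qed
  have "(\<integral>\<^sup>+s. ennreal (g s) * indicator {..0} s \<partial>lborel) = (\<integral>\<^sup>+s. ennreal (g s) * indicator {0..} s \<partial>lborel)"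
    by (subst nn_integral_real_affine[of _ "-1" 0]) (auto simp: g_def indicator_def intro!: nn_integral_cong)
  moreover have "(\<integral>\<^sup>+s. ennreal (g s) \<partial>lborel)
      \<le> (\<integral>\<^sup>+s. ennreal (g s) * indicator {0..} s + ennreal (g s) * indicator {..0} s \<partial>lborel)"
    by (intro nn_integral_mono) (auto simp: indicator_def)
  moreover have "\<dots> = (\<integral>\<^sup>+s. ennreal (g s) * indicator {0..} s \<partial>lborel) + (\<integral>\<^sup>+s. ennreal (g s) * indicator {..0} s \<partial>lborel)"
    by (rule nn_integral_add) measurable
  ultimately have "(\<integral>\<^sup>+s. ennreal (g s) \<partial>lborel) < \<infinity>" using half
    by (metis ennreal_add_less_top infinity_ennreal_def le_less_trans)
  then show "(\<integral>\<^sup>+s. ennreal (norm ((1 + s\<^sup>2) powr (- 2 / 3) :: real)) \<partial>lborel) < \<infinity>"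
    by (simp add: g_def)
qed measurable

text \<open>Here the restriction on the dimension enters: \<open>(1 + |\<xi>|\<^sup>2)\<^sup>-\<^sup>2\<close> is dominated by the product of
  the one-dimensional functions \<open>(1 + \<xi>\<^sub>b\<^sup>2) powr (-2/3)\<close> as long as there are at most three of them.\<close>

lemma square_integrable_weight:
  assumes d: "DIM('a::euclidean_space) \<le> 3"
  shows "square_integrable (\<lambda>\<xi>::'a. complex_of_real (weight \<xi>))"
  unfolding square_integrable_def
proof
  have le: "(weight \<xi>)\<^sup>2 \<le> (\<Prod>b\<in>Basis. (1 + (\<xi> \<bullet> b)\<^sup>2) powr (- 2 / 3))" for \<xi> :: 'a
  proof -
    define p where "p = 1 + (norm \<xi>)\<^sup>2"
    have p: "p \<ge> 1" by (simp add: p_def)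
    have "(\<Prod>b\<in>Basis. (1 + (\<xi> \<bullet> b)\<^sup>2) powr (- 2 / 3)) \<ge> (\<Prod>b\<in>(Basis::'a set). p powr (- 2 / 3))"
    proof (intro prod_mono conjI powr_mono2')
      fix b :: 'a assume "b \<in> Basis"
      then show "1 + (\<xi> \<bullet> b)\<^sup>2 \<le> p"
        using Basis_le_norm[of b \<xi>] power_mono[of "\<bar>\<xi> \<bullet> b\<bar>" "norm \<xi>" 2] by (simp add: p_def)
    qed (auto simp: add_pos_nonneg)
    moreover have "(\<Prod>b\<in>(Basis::'a set). p powr (- 2 / 3)) = p powr (real DIM('a) * (- 2 / 3))"
      using p by (simp add: powr_powr powr_realpow[symmetric] mult.commute)
    moreover have "p powr (real DIM('a) * (- 2 / 3)) \<ge> p powr (- 2)"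
      using p d by (intro powr_mono) auto
    moreover have "p powr (- 2) = (weight \<xi>)\<^sup>2"
      using p by (simp add: weight_def p_def[symmetric] powr_minus powr_numeral divide_inverse power_inverse)
    ultimately show ?thesis by linarith
  qed
  have "integrable lborel (\<lambda>\<xi>::'a. \<Prod>b\<in>Basis. (1 + (\<xi> \<bullet> b)\<^sup>2) powr (- 2 / 3) :: real)"
    by (rule lborel_product_integral(1)) (rule integrable_powr_real)
  then show "integrable lborel (\<lambda>\<xi>::'a. (cmod (complex_of_real (weight \<xi>)))\<^sup>2)"
    by (rule Bochner_Integration.integrable_bound) (use le in \<open>auto intro: order_trans[OF _ abs_ge_self]\<close>)
qed measurable

text \<open>Inverse Fourier integral of the transform of \<open>lift_h2 \<phi>\<close>, evaluated as
  the forward integral at \<open>- x\<close>. In the dimensions considered it converges absolutely,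
  so it assigns a value to every single point.\<close>

definition point_eval :: "'a::euclidean_space l2 \<Rightarrow> 'a \<Rightarrow> complex" where
  "point_eval \<phi> x = fourier_integral (\<lambda>\<xi>. of_real (weight \<xi>) * rep_l2 \<phi> \<xi>) (- x)"

lemma integrable_weight_rep:
  fixes \<phi> :: "'a::euclidean_space l2"
  assumes "DIM('a) \<le> 3"
  shows "integrable lborel (\<lambda>\<xi>. of_real (weight \<xi>) * rep_l2 \<phi> \<xi>)"
  by (rule square_integrable_times[OF square_integrable_weight[OF assms] square_integrable_rep])

lemma integrable_iexp_mult:
  fixes g :: "'a::euclidean_space \<Rightarrow> complex"
  assumes "integrable lborel g"
  shows "integrable lborel (\<lambda>x. iexp (- (\<xi> \<bullet> x)) * g x)"
proof (rule Bochner_Integration.integrable_bound)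
  have [measurable]: "g \<in> borel_measurable borel" using assms by simp
  show "(\<lambda>x. iexp (- (\<xi> \<bullet> x)) * g x) \<in> borel_measurable lborel" by measurable
  show "integrable lborel (\<lambda>x. cmod (g x))" using assms by simp
qed (simp add: norm_mult)

lemma continuous_on_fourier_integral:
  fixes g :: "'a::euclidean_space \<Rightarrow> complex"
  assumes g: "integrable lborel g"
  shows "continuous_on UNIV (fourier_integral g)"
  unfolding continuous_on_sequentially comp_def
proof (intro ballI allI impI, elim conjE)
  fix X :: "nat \<Rightarrow> 'a" and a assume X: "X \<longlonglongrightarrow> a"
  have [measurable]: "g \<in> borel_measurable borel" using g by simp
  have "(\<lambda>n. LINT x|lborel. iexp (- (X n \<bullet> x)) * g x) \<longlonglongrightarrow> (LINT x|lborel. iexp (- (a \<bullet> x)) * g x)"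
  proof (rule integral_dominated_convergence[where w="\<lambda>x. cmod (g x)"])
    show "integrable lborel (\<lambda>x. cmod (g x))" using g by simp
    show "AE x in lborel. (\<lambda>n. iexp (- (X n \<bullet> x)) * g x) \<longlonglongrightarrow> iexp (- (a \<bullet> x)) * g x"
      by (intro AE_I2 tendsto_intros X)
  qed (auto simp: norm_mult)
  then show "(\<lambda>n. fourier_integral g (X n)) \<longlonglongrightarrow> fourier_integral g a"
    unfolding fourier_integral_def by (intro tendsto_intros)
qed

lemma continuous_on_point_eval:
  fixes \<phi> :: "'a::euclidean_space l2"
  assumes "DIM('a) \<le> 3"
  shows "continuous_on UNIV (point_eval \<phi>)"
  unfolding point_eval_def
  by (rule continuous_on_compose2[OF continuous_on_fourier_integral[OF integrable_weight_rep[OF assms]]])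
    (auto intro: continuous_intros)

lemma point_eval_add:
  fixes \<phi> \<psi> :: "'a::euclidean_space l2"
  assumes d: "DIM('a) \<le> 3"
  shows "point_eval (\<phi> + \<psi>) x = point_eval \<phi> x + point_eval \<psi> x"
proof -
  have "(LINT \<xi>|lborel. iexp (- (- x \<bullet> \<xi>)) * (of_real (weight \<xi>) * rep_l2 (\<phi> + \<psi>) \<xi>))
    = (LINT \<xi>|lborel. iexp (- (- x \<bullet> \<xi>)) * (of_real (weight \<xi>) * rep_l2 \<phi> \<xi>) + iexp (- (- x \<bullet> \<xi>)) * (of_real (weight \<xi>) * rep_l2 \<psi> \<xi>))"
  proof (rule integral_cong_AE)
    show "AE \<xi> in lborel. iexp (- (- x \<bullet> \<xi>)) * (of_real (weight \<xi>) * rep_l2 (\<phi> + \<psi>) \<xi>)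
        = iexp (- (- x \<bullet> \<xi>)) * (of_real (weight \<xi>) * rep_l2 \<phi> \<xi>) + iexp (- (- x \<bullet> \<xi>)) * (of_real (weight \<xi>) * rep_l2 \<psi> \<xi>)"
      using rep_l2_add[of \<phi> \<psi>] by eventually_elim (simp add: algebra_simps)
  qed measurable
  also have "\<dots> = (LINT \<xi>|lborel. iexp (- (- x \<bullet> \<xi>)) * (of_real (weight \<xi>) * rep_l2 \<phi> \<xi>))
     + (LINT \<xi>|lborel. iexp (- (- x \<bullet> \<xi>)) * (of_real (weight \<xi>) * rep_l2 \<psi> \<xi>))"
    by (intro Bochner_Integration.integral_add integrable_iexp_mult integrable_weight_rep d)
  finally show ?thesis by (simp add: point_eval_def fourier_integral_def distrib_left)
qed

lemma point_eval_cscale: "point_eval (cscale c \<phi>) x = c * point_eval \<phi> x"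
proof -
  have "(LINT \<xi>|lborel. iexp (- (- x \<bullet> \<xi>)) * (of_real (weight \<xi>) * rep_l2 (cscale c \<phi>) \<xi>))
    = (LINT \<xi>|lborel. c * (iexp (- (- x \<bullet> \<xi>)) * (of_real (weight \<xi>) * rep_l2 \<phi> \<xi>)))"
  proof (rule integral_cong_AE)
    show "AE \<xi> in lborel. iexp (- (- x \<bullet> \<xi>)) * (of_real (weight \<xi>) * rep_l2 (cscale c \<phi>) \<xi>)
        = c * (iexp (- (- x \<bullet> \<xi>)) * (of_real (weight \<xi>) * rep_l2 \<phi> \<xi>))"
      using rep_l2_cscale[of c \<phi>] by eventually_elim (simp add: mult_ac)
  qed measurable
  then show ?thesis by (simp add: point_eval_def fourier_integral_def mult.left_commute)
qed

text \<open>The set where the functions differ is open and null, hence empty. This gives the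
  uniqueness behind the description operator in \<open>continuous_rep\<close>.\<close>

lemma continuous_AE_eq_imp_eq:
  fixes f g :: "'a::euclidean_space \<Rightarrow> complex"
  assumes "continuous_on UNIV f" "continuous_on UNIV g" "AE x in lborel. f x = g x"
  shows "f = g"
proof -
  have "open {x. f x \<noteq> g x}" using assms(1,2) by (rule open_Collect_neq)
  moreover have "negligible {x. f x \<noteq> g x}"
  proof -
    have "{x. f x \<noteq> g x} \<in> null_sets lborel"
      using assms(3) AE_iff_null_sets[of "{x. f x \<noteq> g x}" lborel] \<open>open {x. f x \<noteq> g x}\<close> by simp
    then show ?thesis using null_sets_completionI negligible_iff_null_sets by blast
  qed
  ultimately have "{x. f x \<noteq> g x} = {}" using open_not_negligible by blast
  then show ?thesis by auto
qed

lemma continuous_rep_lift_h2: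
  fixes \<phi> :: "'a::euclidean_space l2"
  assumes d: "DIM('a) \<le> 3"
  shows "continuous_rep (lift_h2 \<phi>) = point_eval \<phi>"
proof -
  have ae: "AE x in lborel. point_eval \<phi> x = rep_l2 (lift_h2 \<phi>) x"
    using rep_ifourier[OF integrable_weight_rep[OF d] square_integrable_symbol[OF bounded_symbol_weight], of \<phi>]
    by (auto simp: lift_h2_def multiplier_def point_eval_def elim!: eventually_mono)
  show ?thesis
    unfolding continuous_rep_def
  proof (rule the_equality)
    show "continuous_on UNIV (point_eval \<phi>) \<and> (AE x in lborel. point_eval \<phi> x = rep_l2 (lift_h2 \<phi>) x)"
      using continuous_on_point_eval[OF d] ae by blast
    fix g assume g: "continuous_on UNIV g \<and> (AE x in lborel. g x = rep_l2 (lift_h2 \<phi>) x)"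
    then have "AE x in lborel. g x = point_eval \<phi> x" using ae by (auto elim: eventually_elim2)
    then show "g = point_eval \<phi>"
      using g continuous_on_point_eval[OF d] by (intro continuous_AE_eq_imp_eq) auto
  qed
qed

lemma integral_cmod_mult_le:
  assumes "square_integrable u" "square_integrable v"
  shows "(LINT x|lborel. cmod (u x) * cmod (v x)) \<le> norm (abs_l2 u) * norm (abs_l2 v)"
proof -
  have sq: "square_integrable (\<lambda>x. complex_of_real (cmod (u x)))" if "square_integrable u" for u :: "'a \<Rightarrow> complex"
  proof -
    have [measurable]: "u \<in> borel_measurable borel" using that by (rule square_integrable_measurable)
    have "(\<lambda>x. complex_of_real (cmod (u x))) \<in> borel_measurable borel" by measurable
    then show ?thesis using that by (simp add: square_integrable_def)
  qed
  have n: "norm (abs_l2 (\<lambda>x. complex_of_real (cmod (u x)))) = norm (abs_l2 u)" if "square_integrable u" for u :: "'a \<Rightarrow> complex"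
  proof -
    have "(norm (abs_l2 (\<lambda>x. complex_of_real (cmod (u x)))))\<^sup>2 = (norm (abs_l2 u))\<^sup>2"
      using that by (simp add: norm_abs_l2 sq)
    then show ?thesis by simp
  qed
  have "complex_of_real (LINT x|lborel. cmod (u x) * cmod (v x))
      = cinner (abs_l2 (\<lambda>x. of_real (cmod (u x)))) (abs_l2 (\<lambda>x. of_real (cmod (v x))))"
    using assms by (simp add: cinner_abs sq flip: of_real_mult)
  then have "cmod (complex_of_real (LINT x|lborel. cmod (u x) * cmod (v x))) \<le> norm (abs_l2 u) * norm (abs_l2 v)"
    using cmod_cinner_le[of "abs_l2 (\<lambda>x. of_real (cmod (u x)))" "abs_l2 (\<lambda>x. of_real (cmod (v x)))"] assms by (simp add: n)
  then show ?thesis by simp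
qed

section \<open>Uniform bounds for point evaluations\<close>

definition eval_bound :: "'a::euclidean_space itself \<Rightarrow> real" where
  "eval_bound _ = (1 / sqrt (2 * pi)) ^ DIM('a) * norm (abs_l2 (\<lambda>\<xi>::'a. complex_of_real (weight \<xi>)))"

lemma norm_point_eval_le:
  fixes \<phi> :: "'a::euclidean_space l2"
  assumes d: "DIM('a) \<le> 3"
  shows "cmod (point_eval \<phi> x) \<le> eval_bound TYPE('a) * norm \<phi>"
proof -
  have "cmod (point_eval \<phi> x) \<le> (1 / sqrt (2 * pi)) ^ DIM('a) * (LINT \<xi>|lborel. cmod (of_real (weight \<xi>)) * cmod (rep_l2 \<phi> \<xi>))"
    unfolding point_eval_def norm_mult[symmetric] by (rule norm_fourier_integral_le)
  also have "\<dots> \<le> (1 / sqrt (2 * pi)) ^ DIM('a) * (norm (abs_l2 (\<lambda>\<xi>::'a. complex_of_real (weight \<xi>))) * norm (abs_l2 (rep_l2 \<phi>)))"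
    by (intro mult_left_mono integral_cmod_mult_le square_integrable_weight d) auto
  finally show ?thesis by (simp add: eval_bound_def mult.assoc)
qed

text \<open>Frequencies are split at radius \<open>n\<close>. Beyond it the weight has small
  \<open>L2\<close> norm, a tail of a square-integrable function, and contributes the term with
  \<open>\<delta>\<close>; inside, the weighted function is paired with the indicator of a ball, and
  its norm is that of \<open>lift_h2 \<phi>\<close>.\<close>

lemma norm_point_eval_interpolate:
  assumes d: "DIM('a::euclidean_space) \<le> 3" and \<delta>: "\<delta> > 0"
  shows "\<exists>C\<ge>0. \<forall>(\<phi>::'a l2) x. cmod (point_eval \<phi> x) \<le> \<delta> * norm \<phi> + C * norm (lift_h2 \<phi>)"
proof -
  define \<kappa> where "\<kappa> = (1 / sqrt (2 * pi)) ^ DIM('a)"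
  have \<kappa>: "\<kappa> > 0" by (simp add: \<kappa>_def)
  define v where "v n \<xi> = complex_of_real (indicator (cball (0::'a) (real n)) \<xi>)" for n \<xi>
  define u where "u n \<xi> = complex_of_real (weight \<xi>) * (1 - v n \<xi>)" for n and \<xi> :: 'a
  have [measurable]: "v n \<in> borel_measurable borel" for n
  proof -
    have [measurable]: "cball (0::'a) (real n) \<in> sets borel" by simp
    show ?thesis unfolding v_def by measurable
  qed
  have uw: "cmod (u n \<xi>) \<le> 1 * cmod (complex_of_real (weight \<xi>))" for n \<xi>
    by (auto simp: u_def v_def indicator_def norm_mult)
  have su: "square_integrable (u n)" for n
    by (rule square_integrable_dominated[OF square_integrable_weight[OF d] _ uw]) (simp add: u_def)
  have sv: "square_integrable (v n)" for n
    unfolding square_integrable_def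
  proof
    have "(\<lambda>x. (cmod (v n x))\<^sup>2) = (indicator (cball (0::'a) (real n)) :: 'a \<Rightarrow> real)" by (auto simp: v_def indicator_def)
    then show "integrable lborel (\<lambda>x. (cmod (v n x))\<^sup>2)"
      using emeasure_bounded_finite[OF bounded_cball, of "0::'a" "real n"] by simp
  qed simp
  have "(\<lambda>n. abs_l2 (u n)) \<longlonglongrightarrow> abs_l2 (\<lambda>_. 0)"
  proof (rule l2_dominated_convergence(2)[where H="\<lambda>\<xi>. cmod (complex_of_real (weight \<xi>))"])
    show "AE \<xi> in lborel. (\<lambda>n. u n \<xi>) \<longlonglongrightarrow> 0"
    proof (intro AE_I2 tendsto_eventually)
      fix \<xi> :: 'a
      show "\<forall>\<^sub>F n in sequentially. u n \<xi> = 0"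
        using eventually_ge_at_top[of "nat \<lceil>norm \<xi>\<rceil>"]
        by eventually_elim (auto simp: u_def v_def indicator_def nat_le_iff ceiling_le_iff)
    qed
    show "integrable lborel (\<lambda>\<xi>::'a. (cmod (complex_of_real (weight \<xi>)))\<^sup>2)"
      using square_integrable_weight[OF d] by (simp add: square_integrable_def)
  qed (use su uw in auto)
  then have "(\<lambda>n. \<kappa> * norm (abs_l2 (u n))) \<longlonglongrightarrow> \<kappa> * 0"
    by (intro tendsto_intros tendsto_norm_zero) (simp add: abs_l2_zero)
  then have "\<forall>\<^sub>F n in sequentially. \<kappa> * norm (abs_l2 (u n)) < \<delta>"
    using \<delta> by (simp add: order_tendstoD(2))
  then obtain n where n: "\<kappa> * norm (abs_l2 (u n)) < \<delta>" by (auto simp: eventually_sequentially)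
  have "cmod (point_eval \<phi> x) \<le> \<delta> * norm \<phi> + (\<kappa> * norm (abs_l2 (v n))) * norm (lift_h2 \<phi>)" for \<phi> :: "'a l2" and x
  proof -
    define g where "g \<xi> = of_real (weight \<xi>) * rep_l2 \<phi> \<xi>" for \<xi>
    have sg: "square_integrable g" unfolding g_def by (intro square_integrable_symbol bounded_symbol_weight)
    have ng: "norm (abs_l2 g) = norm (lift_h2 \<phi>)"
      by (simp add: lift_h2_def multiplier_def g_def[abs_def])
    have int: "integrable lborel (\<lambda>\<xi>. cmod (p \<xi>) * cmod (q \<xi>))" if "square_integrable p" "square_integrable q" for p q :: "'a \<Rightarrow> complex"
      using integrable_norm[OF square_integrable_times[OF that]] by (simp add: norm_mult)
    have "cmod (point_eval \<phi> x) \<le> \<kappa> * (LINT \<xi>|lborel. cmod (g \<xi>))"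
      unfolding point_eval_def g_def \<kappa>_def by (rule norm_fourier_integral_le)
    \<comment> \<open>Outside the ball the weight is attached to \<open>u n\<close>, inside it stays
      in \<open>g\<close>. The two pieces live on disjoint sets, so the moduli add exactly.\<close>
    also have "(LINT \<xi>|lborel. cmod (g \<xi>)) = (LINT \<xi>|lborel. cmod (u n \<xi>) * cmod (rep_l2 \<phi> \<xi>) + cmod (v n \<xi>) * cmod (g \<xi>))"
      by (rule Bochner_Integration.integral_cong) (auto simp: u_def v_def g_def indicator_def norm_mult)
    also have "\<dots> = (LINT \<xi>|lborel. cmod (u n \<xi>) * cmod (rep_l2 \<phi> \<xi>)) + (LINT \<xi>|lborel. cmod (v n \<xi>) * cmod (g \<xi>))"
      by (intro Bochner_Integration.integral_add int su sv sg square_integrable_rep)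
    also have "\<dots> \<le> norm (abs_l2 (u n)) * norm (abs_l2 (rep_l2 \<phi>)) + norm (abs_l2 (v n)) * norm (abs_l2 g)"
      by (intro add_mono integral_cmod_mult_le su sv sg square_integrable_rep)
    finally have "cmod (point_eval \<phi> x) \<le> (\<kappa> * norm (abs_l2 (u n))) * norm \<phi> + (\<kappa> * norm (abs_l2 (v n))) * norm (lift_h2 \<phi>)"
      using \<kappa> by (simp add: ng distrib_left mult.assoc)
    also have "\<dots> \<le> \<delta> * norm \<phi> + (\<kappa> * norm (abs_l2 (v n))) * norm (lift_h2 \<phi>)"
      using n by (intro add_right_mono mult_right_mono) auto
    finally show ?thesis .
  qed
  then show ?thesis using \<kappa> by (intro exI[of _ "\<kappa> * norm (abs_l2 (v n))"]) simp
qed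

section \<open>Integrals against signed measures\<close>

text \<open>Whatever the set function \<open>\<mu>\<close> is, its two parts are finite Borel measures, because
  \<^const>\<open>measure_of\<close> yields the zero measure if the given values do not define a measure.\<close>

lemma sigma_sets_borel: "sigma_sets UNIV (sets borel) = sets borel"
  using sets.sigma_sets_eq[of borel] by simp

lemma sets_pos_part [simp, measurable_cong]: "sets (pos_part \<mu>) = sets borel"
  by (simp add: pos_part_def sigma_sets_borel)

lemma sets_neg_part [simp, measurable_cong]: "sets (neg_part \<mu>) = sets borel"
  by (simp add: neg_part_def sigma_sets_borel)

lemma finite_pos_part: "finite_measure (pos_part \<mu>)"
  by (rule finite_measureI) (simp add: pos_part_def emeasure_measure_of_conv)

lemma finite_neg_part: "finite_measure (neg_part \<mu>)"
  by (rule finite_measureI) (simp add: neg_part_def emeasure_measure_of_conv)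

lemma finite_measure_bounded_integral:
  fixes f :: "'a::euclidean_space \<Rightarrow> complex"
  assumes \<rho>: "finite_measure \<rho>" "sets \<rho> = sets borel" and f: "f \<in> borel_measurable borel" "\<And>x. cmod (f x) \<le> C"
  shows "integrable \<rho> f" "cmod (LINT x|\<rho>. f x) \<le> C * measure \<rho> UNIV"
proof -
  interpret finite_measure \<rho> by fact
  have sp: "space \<rho> = UNIV" using sets_eq_imp_space_eq[OF \<rho>(2)] by simp
  have fm: "f \<in> borel_measurable \<rho>" using f(1) measurable_cong_sets[OF \<rho>(2) refl] by blast
  show i: "integrable \<rho> f" by (rule integrable_const_bound[where B=C]) (use f(2) fm in auto)
  have "cmod (LINT x|\<rho>. f x) \<le> (LINT x|\<rho>. cmod (f x))" by (rule integral_norm_bound)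
  also have "\<dots> \<le> (LINT x|\<rho>. C)" by (rule integral_mono) (use i f(2) in auto)
  finally show "cmod (LINT x|\<rho>. f x) \<le> C * measure \<rho> UNIV" by (simp add: sp mult.commute)
qed

lemma signed_integral_bound:
  fixes f :: "'a::euclidean_space \<Rightarrow> complex"
  assumes "f \<in> borel_measurable borel" "\<And>x. cmod (f x) \<le> C"
  shows "cmod (signed_integral \<mu> f) \<le> C * total_variation \<mu>"
proof -
  have "cmod (signed_integral \<mu> f) \<le> cmod (LINT x|pos_part \<mu>. f x) + cmod (LINT x|neg_part \<mu>. f x)"
    unfolding signed_integral_def by (rule norm_triangle_ineq4)
  also have "\<dots> \<le> C * measure (pos_part \<mu>) UNIV + C * measure (neg_part \<mu>) UNIV"
    by (intro add_mono finite_measure_bounded_integral finite_pos_part finite_neg_part assms) simp_all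
  finally show ?thesis by (simp add: total_variation_def distrib_left)
qed

lemma signed_integral_integrable:
  fixes f :: "'a::euclidean_space \<Rightarrow> complex"
  assumes "f \<in> borel_measurable borel" "\<And>x. cmod (f x) \<le> C"
  shows "integrable (pos_part \<mu>) f" "integrable (neg_part \<mu>) f"
  by (rule finite_measure_bounded_integral[OF finite_pos_part _ assms], simp)
    (rule finite_measure_bounded_integral[OF finite_neg_part _ assms], simp)

definition measure_form :: "('a::euclidean_space set \<Rightarrow> real) \<Rightarrow> 'a l2 \<Rightarrow> 'a l2 \<Rightarrow> complex" where
  "measure_form \<mu> \<phi> \<psi> = signed_integral \<mu> (\<lambda>x. point_eval \<phi> x * cnj (point_eval \<psi> x))"

lemma eval_bound_nonneg: "0 \<le> eval_bound T"
  by (simp add: eval_bound_def)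

lemma point_eval_measurable [measurable]: "point_eval \<phi> \<in> borel_measurable borel"
  unfolding point_eval_def by (rule measurable_compose[OF _ fourier_integral_measurable]) auto

lemma point_eval_prod_bound:
  fixes \<phi> :: "'a::euclidean_space l2"
  assumes d: "DIM('a) \<le> 3"
  shows "cmod (point_eval \<phi> x * cnj (point_eval \<psi> x)) \<le> (eval_bound TYPE('a))\<^sup>2 * norm \<phi> * norm \<psi>"
proof -
  have "cmod (point_eval \<phi> x) * cmod (point_eval \<psi> x) \<le> (eval_bound TYPE('a) * norm \<phi>) * (eval_bound TYPE('a) * norm \<psi>)"
    by (intro mult_mono norm_point_eval_le d) (auto simp: eval_bound_nonneg)
  then show ?thesis by (simp add: norm_mult power2_eq_square mult_ac)
qed

lemma point_eval_prod_integrable: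
  fixes \<phi> :: "'a::euclidean_space l2"
  assumes d: "DIM('a) \<le> 3"
  shows "integrable (pos_part \<mu>) (\<lambda>x. point_eval \<phi> x * cnj (point_eval \<psi> x))"
    "integrable (neg_part \<mu>) (\<lambda>x. point_eval \<phi> x * cnj (point_eval \<psi> x))"
  by (rule signed_integral_integrable[OF _ point_eval_prod_bound[OF d]]; measurable)+

lemma norm_measure_form_le:
  fixes \<phi> :: "'a::euclidean_space l2"
  assumes d: "DIM('a) \<le> 3"
  shows "cmod (measure_form \<mu> \<phi> \<psi>) \<le> (eval_bound TYPE('a))\<^sup>2 * norm \<phi> * norm \<psi> * total_variation \<mu>"
  unfolding measure_form_def by (rule signed_integral_bound[OF _ point_eval_prod_bound[OF d]]) measurable

lemma measure_form_add_left:
  fixes \<phi> :: "'a::euclidean_space l2"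
  assumes d: "DIM('a) \<le> 3"
  shows "measure_form \<mu> (\<phi> + \<phi>') \<psi> = measure_form \<mu> \<phi> \<psi> + measure_form \<mu> \<phi>' \<psi>"
  by (simp add: measure_form_def signed_integral_def point_eval_add[OF d] distrib_right point_eval_prod_integrable[OF d])

lemma measure_form_add_right:
  fixes \<phi> :: "'a::euclidean_space l2"
  assumes d: "DIM('a) \<le> 3"
  shows "measure_form \<mu> \<psi> (\<phi> + \<phi>') = measure_form \<mu> \<psi> \<phi> + measure_form \<mu> \<psi> \<phi>'"
  by (simp add: measure_form_def signed_integral_def point_eval_add[OF d] distrib_left point_eval_prod_integrable[OF d])

lemma measure_form_cscale_left: "measure_form \<mu> (cscale c \<phi>) \<psi> = c * measure_form \<mu> \<phi> \<psi>"
  by (simp add: measure_form_def signed_integral_def point_eval_cscale mult.assoc right_diff_distrib)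

lemma measure_form_cscale_right: "measure_form \<mu> \<phi> (cscale c \<psi>) = cnj c * measure_form \<mu> \<phi> \<psi>"
  by (simp add: measure_form_def signed_integral_def point_eval_cscale mult.left_commute[of _ "cnj c"] right_diff_distrib)

text \<open>Because the diagonal values are real, the imaginary part of the shifted form on the
  diagonal comes from \<open>z\<close> alone; the coercivity argument depends on this.\<close>

lemma measure_form_real: "measure_form \<mu> \<phi> \<phi> = of_real (Re (measure_form \<mu> \<phi> \<phi>))"
proof -
  have "measure_form \<mu> \<phi> \<phi> = signed_integral \<mu> (\<lambda>x. complex_of_real ((cmod (point_eval \<phi> x))\<^sup>2))"
    unfolding measure_form_def by (simp only: complex_norm_square)
  then show ?thesis by (simp add: signed_integral_def del: of_real_power)
qed

lemma measure_form_bound: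
  assumes "\<And>x. cmod (point_eval \<phi> x) \<le> r"
  shows "cmod (measure_form \<mu> \<phi> \<phi>) \<le> r\<^sup>2 * total_variation \<mu>"
  unfolding measure_form_def
proof (rule signed_integral_bound)
  have "r \<ge> 0" using assms[of undefined] norm_ge_zero order_trans by blast
  then show "cmod (point_eval \<phi> x * cnj (point_eval \<phi> x)) \<le> r\<^sup>2" for x
    using assms[of x] by (simp add: norm_mult power2_eq_square mult_mono)
qed measurable

section \<open>Hilbert-Schmidt bounds for measure forms\<close>

definition weighted_rep :: "'a::euclidean_space l2 \<Rightarrow> 'a \<Rightarrow> complex" where
  "weighted_rep \<phi> \<xi> = of_real (weight \<xi>) * rep_l2 \<phi> \<xi>"

text \<open>The constant is the square of the normalising factor of \<open>fourier_integral\<close>,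
  one factor for each of the two point evaluations.\<close>

definition kernel_form :: "('a::euclidean_space \<Rightarrow> complex) \<Rightarrow> 'a l2 \<Rightarrow> 'a l2 \<Rightarrow> complex" where
  "kernel_form D \<phi> \<psi> = of_real (((1 / sqrt (2 * pi)) ^ DIM('a))\<^sup>2) *
     (LINT \<xi>|lborel. weighted_rep \<phi> \<xi> * (LINT \<eta>|lborel. D (\<xi> - \<eta>) * cnj (weighted_rep \<psi> \<eta>)))"

lemma weighted_rep_measurable [measurable]: "weighted_rep \<phi> \<in> borel_measurable borel"
  unfolding weighted_rep_def by measurable

lemma integrable_weighted_rep:
  fixes \<phi> :: "'a::euclidean_space l2"
  assumes "DIM('a) \<le> 3"
  shows "integrable lborel (weighted_rep \<phi>)"
  unfolding weighted_rep_def by (rule integrable_weight_rep[OF assms])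

lemma point_eval_eq: "point_eval \<phi> x = of_real ((1 / sqrt (2 * pi)) ^ DIM('a)) *
    (LINT \<xi>|lborel. iexp (x \<bullet> \<xi>) * weighted_rep \<phi> (\<xi>::'a::euclidean_space))"
  by (simp add: point_eval_def fourier_integral_def weighted_rep_def)

lemma cnj_point_eval_eq: "cnj (point_eval \<phi> x) = of_real ((1 / sqrt (2 * pi)) ^ DIM('a)) *
    (LINT \<xi>|lborel. iexp (- (x \<bullet> \<xi>)) * cnj (weighted_rep \<phi> (\<xi>::'a::euclidean_space)))"
proof -
  have "cnj (LINT \<xi>|lborel. iexp (x \<bullet> \<xi>) * weighted_rep \<phi> \<xi>) = (LINT \<xi>|lborel. iexp (- (x \<bullet> \<xi>)) * cnj (weighted_rep \<phi> \<xi>))"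
    unfolding Bochner_Integration.integral_cnj[symmetric] by (simp add: exp_cnj)
  then show ?thesis by (simp add: point_eval_eq)
qed

text \<open>The point evaluations are opened one at a time, each by one use of
  \<open>kernel_Fubini\<close> with a unimodular exponential as kernel. In the first step the other
  evaluation \<open>c\<close> is the function integrable over \<open>\<rho>\<close>; in the second
  it is the exponential left over from the first.\<close>

lemma finite_measure_form_eq_kernel_form:
  fixes \<phi> \<psi> :: "'a::euclidean_space l2"
  assumes d: "DIM('a) \<le> 3" and \<rho>: "finite_measure \<rho>" and s [measurable_cong]: "sets \<rho> = sets borel"
  shows "(LINT x|\<rho>. point_eval \<phi> x * cnj (point_eval \<psi> x)) = kernel_form (\<lambda>\<zeta>. LINT x|\<rho>. iexp (\<zeta> \<bullet> x)) \<phi> \<psi>"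
proof -
  interpret finite_measure \<rho> by fact
  define \<kappa> where "\<kappa> = complex_of_real ((1 / sqrt (2 * pi)) ^ DIM('a))"
  define c where "c x = cnj (point_eval \<psi> x)" for x
  have [measurable]: "c \<in> borel_measurable borel" unfolding c_def by measurable
  have ci: "integrable \<rho> c"
    by (rule finite_measure_bounded_integral(1)[OF \<rho> s]) (use norm_point_eval_le[OF d, of \<psi>] in \<open>auto simp: c_def\<close>)
  have ei: "integrable \<rho> (\<lambda>x. iexp (x \<bullet> \<xi>))" for \<xi>
    by (rule finite_measure_bounded_integral(1)[OF \<rho> s, where C=1]) auto
  have "borel_measurable (lborel \<Otimes>\<^sub>M \<rho>) = (borel_measurable (borel \<Otimes>\<^sub>M borel) :: ('a \<times> 'a \<Rightarrow> complex) set)"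
    by (intro measurable_cong_sets sets_pair_measure_cong) (auto simp: s)
  note km = iexp_measurable_pair[folded this]
  have 1: "(LINT x|\<rho>. (LINT \<xi>|lborel. iexp (x \<bullet> \<xi>) * weighted_rep \<phi> \<xi>) * c x)
      = (LINT \<xi>|lborel. weighted_rep \<phi> \<xi> * (LINT x|\<rho>. iexp (x \<bullet> \<xi>) * c x))"
    by (rule kernel_Fubini(3)[OF sigma_finite_lborel sigma_finite_measure_axioms integrable_weighted_rep[OF d] ci, where C=1])
      (use km in auto)
  have 2: "(LINT x|\<rho>. iexp (x \<bullet> \<xi>) * c x) = \<kappa> * (LINT \<eta>|lborel. (LINT x|\<rho>. iexp ((\<xi> - \<eta>) \<bullet> x)) * cnj (weighted_rep \<psi> \<eta>))" for \<xi>
  proof -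
    have "(LINT x|\<rho>. iexp (x \<bullet> \<xi>) * c x) = \<kappa> * (LINT x|\<rho>. (LINT \<eta>|lborel. iexp (- (x \<bullet> \<eta>)) * cnj (weighted_rep \<psi> \<eta>)) * iexp (x \<bullet> \<xi>))"
      unfolding c_def cnj_point_eval_eq \<kappa>_def[symmetric]
      by (simp add: mult.left_commute[of _ \<kappa>] mult.commute[of "iexp _"])
    also have "(LINT x|\<rho>. (LINT \<eta>|lborel. iexp (- (x \<bullet> \<eta>)) * cnj (weighted_rep \<psi> \<eta>)) * iexp (x \<bullet> \<xi>))
       = (LINT \<eta>|lborel. cnj (weighted_rep \<psi> \<eta>) * (LINT x|\<rho>. iexp (- (x \<bullet> \<eta>)) * iexp (x \<bullet> \<xi>)))"
      by (rule kernel_Fubini(3)[OF sigma_finite_lborel sigma_finite_measure_axioms _ ei, where C=1])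
        (use integrable_weighted_rep[OF d, of \<psi>] km in auto)
    also have "\<dots> = (LINT \<eta>|lborel. (LINT x|\<rho>. iexp ((\<xi> - \<eta>) \<bullet> x)) * cnj (weighted_rep \<psi> \<eta>))"
      by (simp add: exp_add[symmetric] inner_diff_left inner_commute algebra_simps)
    finally show ?thesis .
  qed
  have "(LINT x|\<rho>. point_eval \<phi> x * cnj (point_eval \<psi> x)) = \<kappa> * (LINT x|\<rho>. (LINT \<xi>|lborel. iexp (x \<bullet> \<xi>) * weighted_rep \<phi> \<xi>) * c x)"
    by (simp add: point_eval_eq[of \<phi>] \<kappa>_def c_def mult.assoc)
  also have "\<dots> = kernel_form (\<lambda>\<zeta>. LINT x|\<rho>. iexp (\<zeta> \<bullet> x)) \<phi> \<psi>"
    unfolding 1 2 by (simp add: kernel_form_def \<kappa>_def power2_eq_square mult.left_commute[of "weighted_rep _ _"])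
  finally show ?thesis .
qed

definition signed_char :: "('a::euclidean_space set \<Rightarrow> real) \<Rightarrow> 'a \<Rightarrow> complex" where
  "signed_char \<mu> \<zeta> = signed_integral \<mu> (\<lambda>x. iexp (\<zeta> \<bullet> x))"

lemma finite_measure_char_measurable:
  fixes \<rho> :: "'a::euclidean_space measure"
  assumes \<rho>: "finite_measure \<rho>" and s [measurable_cong]: "sets \<rho> = sets borel"
  shows "(\<lambda>\<zeta>. LINT x|\<rho>. iexp (\<zeta> \<bullet> x)) \<in> borel_measurable borel"
proof -
  interpret finite_measure \<rho> by fact
  show ?thesis by measurable
qed

lemma norm_signed_char_le: "cmod (signed_char \<mu> \<zeta>) \<le> total_variation \<mu>"
  unfolding signed_char_def using signed_integral_bound[of "\<lambda>x. iexp (\<zeta> \<bullet> x)" 1 \<mu>] by simp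

lemma signed_char_measurable [measurable]: "signed_char \<mu> \<in> borel_measurable borel"
  unfolding signed_char_def signed_integral_def
  by (intro borel_measurable_diff finite_measure_char_measurable finite_pos_part finite_neg_part) simp_all

lemma integrable_kernel_row:
  fixes \<psi> :: "'a::euclidean_space l2"
  assumes d: "DIM('a) \<le> 3" and [measurable]: "D \<in> borel_measurable borel" and M: "\<And>\<zeta>. cmod (D \<zeta>) \<le> M"
  shows "integrable lborel (\<lambda>\<eta>. D (\<xi> - \<eta>) * cnj (weighted_rep \<psi> \<eta>))"
    and "cmod (LINT \<eta>|lborel. D (\<xi> - \<eta>) * cnj (weighted_rep \<psi> \<eta>)) \<le> M * (LINT \<eta>|lborel. cmod (weighted_rep \<psi> \<eta>))"
proof -
  have M0: "M \<ge> 0" using M[of undefined] norm_ge_zero order_trans by blast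
  have i: "integrable lborel (\<lambda>\<eta>. M * cmod (weighted_rep \<psi> \<eta>))"
    using integrable_weighted_rep[OF d, of \<psi>] by simp
  have le: "cmod (D (\<xi> - \<eta>) * cnj (weighted_rep \<psi> \<eta>)) \<le> M * cmod (weighted_rep \<psi> \<eta>)" for \<eta>
    using M by (simp add: norm_mult mult_right_mono)
  show i2: "integrable lborel (\<lambda>\<eta>. D (\<xi> - \<eta>) * cnj (weighted_rep \<psi> \<eta>))"
    by (rule Bochner_Integration.integrable_bound[OF i]) (use le M0 in \<open>auto simp: abs_mult\<close>)
  have "cmod (LINT \<eta>|lborel. D (\<xi> - \<eta>) * cnj (weighted_rep \<psi> \<eta>)) \<le> (LINT \<eta>|lborel. cmod (D (\<xi> - \<eta>) * cnj (weighted_rep \<psi> \<eta>)))"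
    by (rule integral_norm_bound)
  also have "\<dots> \<le> (LINT \<eta>|lborel. M * cmod (weighted_rep \<psi> \<eta>))"
    by (rule integral_mono[OF integrable_norm[OF i2] i le])
  finally show "cmod (LINT \<eta>|lborel. D (\<xi> - \<eta>) * cnj (weighted_rep \<psi> \<eta>)) \<le> M * (LINT \<eta>|lborel. cmod (weighted_rep \<psi> \<eta>))"
    by simp
qed

lemma integrable_kernel_form:
  fixes \<psi> :: "'a::euclidean_space l2"
  assumes d: "DIM('a) \<le> 3" and [measurable]: "D \<in> borel_measurable borel" and M: "\<And>\<zeta>. cmod (D \<zeta>) \<le> M"
  shows "integrable lborel (\<lambda>\<xi>. weighted_rep \<phi> \<xi> * (LINT \<eta>|lborel. D (\<xi> - \<eta>) * cnj (weighted_rep \<psi> \<eta>)))"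
proof (rule Bochner_Integration.integrable_bound)
  let ?C = "M * (LINT \<eta>|lborel. cmod (weighted_rep \<psi> \<eta>))"
  show "integrable lborel (\<lambda>\<xi>. ?C * cmod (weighted_rep \<phi> \<xi>))"
    using integrable_weighted_rep[OF d, of \<phi>] by simp
  have "cmod (weighted_rep \<phi> \<xi>) * cmod (LINT \<eta>|lborel. D (\<xi> - \<eta>) * cnj (weighted_rep \<psi> \<eta>)) \<le> cmod (weighted_rep \<phi> \<xi>) * ?C" for \<xi>
    by (intro mult_left_mono integrable_kernel_row(2) d M) auto
  then show "AE \<xi> in lborel. norm (weighted_rep \<phi> \<xi> * (LINT \<eta>|lborel. D (\<xi> - \<eta>) * cnj (weighted_rep \<psi> \<eta>)))
      \<le> norm (?C * cmod (weighted_rep \<phi> \<xi>))"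
    by (auto simp: norm_mult mult.commute intro: order_trans[OF _ abs_ge_self])
qed measurable

lemma kernel_form_diff:
  fixes \<psi> :: "'a::euclidean_space l2"
  assumes d: "DIM('a) \<le> 3" and D: "D \<in> borel_measurable borel" "\<And>\<zeta>. cmod (D \<zeta>) \<le> M"
    and D': "D' \<in> borel_measurable borel" "\<And>\<zeta>. cmod (D' \<zeta>) \<le> M'"
  shows "kernel_form (\<lambda>\<zeta>. D \<zeta> - D' \<zeta>) \<phi> \<psi> = kernel_form D \<phi> \<psi> - kernel_form D' \<phi> \<psi>"
  unfolding kernel_form_def
  by (simp add: left_diff_distrib integrable_kernel_row(1)[OF d D] integrable_kernel_row(1)[OF d D']
      integrable_kernel_form[OF d D] integrable_kernel_form[OF d D'] right_diff_distrib)

lemma measure_form_eq_kernel_form: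
  fixes \<phi> \<psi> :: "'a::euclidean_space l2"
  assumes d: "DIM('a) \<le> 3"
  shows "measure_form \<mu> \<phi> \<psi> = kernel_form (signed_char \<mu>) \<phi> \<psi>"
proof -
  have b: "cmod (LINT x|\<rho>. iexp (\<zeta> \<bullet> x)) \<le> 1 * measure \<rho> UNIV" if "finite_measure \<rho>" "sets \<rho> = sets borel"
    for \<rho> :: "'a measure" and \<zeta>
    by (rule finite_measure_bounded_integral(2)[OF that]) auto
  show ?thesis
    unfolding measure_form_def signed_integral_def signed_char_def
    by (subst kernel_form_diff[OF d finite_measure_char_measurable b finite_measure_char_measurable b])
      (simp_all add: finite_pos_part finite_neg_part finite_measure_form_eq_kernel_form[OF d])
qed

definition kernel_row_norm :: "('a::euclidean_space \<Rightarrow> complex) \<Rightarrow> 'a \<Rightarrow> real" where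
  "kernel_row_norm D \<xi> = norm (abs_l2 (\<lambda>\<eta>. of_real (weight \<eta>) * D (\<xi> - \<eta>)))"

text \<open>Up to a constant the Hilbert-Schmidt norm of the operator with kernel
  \<open>weight \<xi> * weight \<eta> * D (\<xi> - \<eta>)\<close>\<close>

definition kernel_norm :: "('a::euclidean_space \<Rightarrow> complex) \<Rightarrow> real" where
  "kernel_norm D = ((1 / sqrt (2 * pi)) ^ DIM('a))\<^sup>2 * norm (abs_l2 (\<lambda>\<xi>. complex_of_real (weight \<xi>) * of_real (kernel_row_norm D \<xi>)))"

lemma kernel_row_norm:
  fixes D :: "'a::euclidean_space \<Rightarrow> complex"
  assumes d: "DIM('a) \<le> 3" and [measurable]: "D \<in> borel_measurable borel" and M: "\<And>\<zeta>. cmod (D \<zeta>) \<le> M"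
  shows "square_integrable (\<lambda>\<eta>. of_real (weight \<eta>) * D (\<xi> - \<eta>))"
    and "kernel_row_norm D \<in> borel_measurable borel"
    and "kernel_row_norm D \<xi> \<le> M * norm (abs_l2 (\<lambda>\<xi>::'a. complex_of_real (weight \<xi>)))"
    and "square_integrable (\<lambda>\<xi>. complex_of_real (weight \<xi>) * of_real (kernel_row_norm D \<xi>))"
proof -
  have sw: "square_integrable (\<lambda>\<xi>::'a. complex_of_real (weight \<xi>))" by (rule square_integrable_weight[OF d])
  show sq: "square_integrable (\<lambda>\<eta>. of_real (weight \<eta>) * D (\<xi> - \<eta>))" for \<xi>
    using square_integrable_bounded_mult[OF sw, of "\<lambda>\<eta>. D (\<xi> - \<eta>)" M] M by (simp add: mult.commute)
  have M0: "M \<ge> 0" using M[of undefined] norm_ge_zero order_trans by blast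
  have e: "kernel_row_norm D \<xi> = sqrt (LINT \<eta>|lborel. (cmod (of_real (weight \<eta>) * D (\<xi> - \<eta>)))\<^sup>2)" for \<xi>
    unfolding kernel_row_norm_def norm_abs_l2[OF sq, symmetric] by simp
  show m [measurable]: "kernel_row_norm D \<in> borel_measurable borel"
    unfolding e[abs_def] by measurable
  have bd: "kernel_row_norm D \<xi> \<le> M * norm (abs_l2 (\<lambda>\<xi>::'a. complex_of_real (weight \<xi>)))" for \<xi>
  proof (rule power2_le_imp_le)
    have "(kernel_row_norm D \<xi>)\<^sup>2 = (LINT \<eta>|lborel. (cmod (of_real (weight \<eta>) * D (\<xi> - \<eta>)))\<^sup>2)"
      unfolding kernel_row_norm_def by (rule norm_abs_l2[OF sq])
    also have "\<dots> \<le> (LINT \<eta>|lborel. M\<^sup>2 * (cmod (complex_of_real (weight (\<eta>::'a))))\<^sup>2)"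
    proof (rule integral_mono')
      show "integrable lborel (\<lambda>\<eta>::'a. M\<^sup>2 * (cmod (complex_of_real (weight \<eta>)))\<^sup>2)"
        using sw by (simp add: square_integrable_def)
      show "(cmod (of_real (weight \<eta>) * D (\<xi> - \<eta>)))\<^sup>2 \<le> M\<^sup>2 * (cmod (complex_of_real (weight \<eta>)))\<^sup>2" for \<eta>
        using mult_right_mono[OF power_mono[OF M[of "\<xi> - \<eta>"], of 2], of "(weight \<eta>)\<^sup>2"]
        by (simp add: norm_mult power_mult_distrib mult.commute)
    qed simp
    also have "\<dots> = (M * norm (abs_l2 (\<lambda>\<xi>::'a. complex_of_real (weight \<xi>))))\<^sup>2"
      unfolding power_mult_distrib norm_abs_l2[OF sw] by simp
    finally show "(kernel_row_norm D \<xi>)\<^sup>2 \<le> (M * norm (abs_l2 (\<lambda>\<xi>::'a. complex_of_real (weight \<xi>))))\<^sup>2" .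
  qed (simp add: M0)
  then show "kernel_row_norm D \<xi> \<le> M * norm (abs_l2 (\<lambda>\<xi>::'a. complex_of_real (weight \<xi>)))" .
  have "square_integrable (\<lambda>\<xi>. of_real (kernel_row_norm D \<xi>) * complex_of_real (weight \<xi>))"
    by (rule square_integrable_bounded_mult[OF sw, where C="M * norm (abs_l2 (\<lambda>\<xi>::'a. complex_of_real (weight \<xi>)))"])
      (measurable, use bd in \<open>simp add: kernel_row_norm_def\<close>)
  then show "square_integrable (\<lambda>\<xi>. complex_of_real (weight \<xi>) * of_real (kernel_row_norm D \<xi>))"
    by (simp add: mult.commute)
qed

text \<open>Cauchy-Schwarz is used twice: in \<open>\<eta>\<close> for each fixed row, which
  produces \<open>kernel_row_norm\<close>, and then in \<open>\<xi>\<close> for the function of row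
  norms.\<close>

lemma norm_kernel_form_le:
  fixes \<phi> \<psi> :: "'a::euclidean_space l2"
  assumes d: "DIM('a) \<le> 3" and D [measurable]: "D \<in> borel_measurable borel" and M: "\<And>\<zeta>. cmod (D \<zeta>) \<le> M"
  shows "cmod (kernel_form D \<phi> \<psi>) \<le> kernel_norm D * norm \<phi> * norm \<psi>"
proof -
  note R = kernel_row_norm[OF d D M]
  define J where "J \<xi> = (LINT \<eta>|lborel. D (\<xi> - \<eta>) * cnj (weighted_rep \<psi> \<eta>))" for \<xi>
  have [measurable]: "J \<in> borel_measurable borel" unfolding J_def by measurable
  have J: "cmod (J \<xi>) \<le> kernel_row_norm D \<xi> * norm \<psi>" for \<xi>
  proof -
    have "cmod (J \<xi>) \<le> (LINT \<eta>|lborel. cmod (D (\<xi> - \<eta>) * cnj (weighted_rep \<psi> \<eta>)))"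
      unfolding J_def by (rule integral_norm_bound)
    also have "\<dots> = (LINT \<eta>|lborel. cmod (of_real (weight \<eta>) * D (\<xi> - \<eta>)) * cmod (rep_l2 \<psi> \<eta>))"
      by (simp add: weighted_rep_def norm_mult mult_ac)
    also have "\<dots> \<le> kernel_row_norm D \<xi> * norm (abs_l2 (rep_l2 \<psi>))"
      unfolding kernel_row_norm_def by (intro integral_cmod_mult_le R) simp
    finally show ?thesis by simp
  qed
  have "cmod (LINT \<xi>|lborel. weighted_rep \<phi> \<xi> * J \<xi>) \<le> (LINT \<xi>|lborel. cmod (weighted_rep \<phi> \<xi> * J \<xi>))"
    by (rule integral_norm_bound)
  also have "\<dots> \<le> (LINT \<xi>|lborel. norm \<psi> * (cmod (complex_of_real (weight \<xi>) * of_real (kernel_row_norm D \<xi>)) * cmod (rep_l2 \<phi> \<xi>)))"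
  proof (rule integral_mono')
    have "integrable lborel (\<lambda>\<xi>. cmod ((complex_of_real (weight \<xi>) * of_real (kernel_row_norm D \<xi>)) * rep_l2 \<phi> \<xi>))"
      by (intro integrable_norm square_integrable_times R) simp
    then show "integrable lborel (\<lambda>\<xi>. norm \<psi> * (cmod (complex_of_real (weight \<xi>) * of_real (kernel_row_norm D \<xi>)) * cmod (rep_l2 \<phi> \<xi>)))"
      by (intro integrable_mult_right) (simp only: norm_mult)
    fix \<xi>
    have k0: "0 \<le> kernel_row_norm D \<xi>" by (simp add: kernel_row_norm_def)
    have "cmod (weighted_rep \<phi> \<xi>) * cmod (J \<xi>) \<le> cmod (weighted_rep \<phi> \<xi>) * (kernel_row_norm D \<xi> * norm \<psi>)"
      by (intro mult_left_mono J) simp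
    then show "cmod (weighted_rep \<phi> \<xi> * J \<xi>) \<le> norm \<psi> * (cmod (complex_of_real (weight \<xi>) * of_real (kernel_row_norm D \<xi>)) * cmod (rep_l2 \<phi> \<xi>))"
      using k0 by (simp add: norm_mult weighted_rep_def mult_ac)
  qed simp
  also have "\<dots> \<le> norm \<psi> * (norm (abs_l2 (\<lambda>\<xi>. complex_of_real (weight \<xi>) * of_real (kernel_row_norm D \<xi>))) * norm (abs_l2 (rep_l2 \<phi>)))"
    unfolding integral_mult_right_zero by (intro mult_left_mono integral_cmod_mult_le R) simp_all
  finally have "cmod (LINT \<xi>|lborel. weighted_rep \<phi> \<xi> * J \<xi>)
     \<le> norm (abs_l2 (\<lambda>\<xi>. complex_of_real (weight \<xi>) * of_real (kernel_row_norm D \<xi>))) * norm \<phi> * norm \<psi>"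
    by (simp add: mult_ac)
  then have "((1 / sqrt (2 * pi)) ^ DIM('a))\<^sup>2 * cmod (LINT \<xi>|lborel. weighted_rep \<phi> \<xi> * J \<xi>)
     \<le> ((1 / sqrt (2 * pi)) ^ DIM('a))\<^sup>2 * (norm (abs_l2 (\<lambda>\<xi>. complex_of_real (weight \<xi>) * of_real (kernel_row_norm D \<xi>))) * norm \<phi> * norm \<psi>)"
    by (intro mult_left_mono) simp_all
  then show ?thesis
    unfolding kernel_form_def kernel_norm_def J_def[symmetric] norm_mult norm_of_real by (simp add: mult.assoc)
qed

text \<open>Dominated convergence is iterated: each row tends to 0 with majorant \<open>M\<close>
  times the weight, and the row norms, bounded by \<open>M * W\<close>, then tend to 0 in the outer
  variable with majorant \<open>M * W\<close> times the weight.\<close>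

lemma kernel_norm_tendsto_0:
  fixes D :: "nat \<Rightarrow> 'a::euclidean_space \<Rightarrow> complex"
  assumes d: "DIM('a) \<le> 3" and D: "\<And>n. D n \<in> borel_measurable borel" and M: "\<And>n \<zeta>. cmod (D n \<zeta>) \<le> M"
    and lim: "\<And>\<zeta>. (\<lambda>n. D n \<zeta>) \<longlonglongrightarrow> 0"
  shows "(\<lambda>n. kernel_norm (D n)) \<longlonglongrightarrow> 0"
proof -
  note R = kernel_row_norm[OF d D M]
  note [measurable] = D R(2)
  have sw: "square_integrable (\<lambda>\<xi>::'a. complex_of_real (weight \<xi>))" by (rule square_integrable_weight[OF d])
  then have iw: "integrable lborel (\<lambda>\<xi>::'a. (C * cmod (complex_of_real (weight \<xi>)))\<^sup>2)" for C
    by (simp add: square_integrable_def power_mult_distrib)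
  define W where "W = norm (abs_l2 (\<lambda>\<xi>::'a. complex_of_real (weight \<xi>)))"
  have row: "(\<lambda>n. kernel_row_norm (D n) \<xi>) \<longlonglongrightarrow> 0" for \<xi>
  proof -
    have "(\<lambda>n. abs_l2 (\<lambda>\<eta>. of_real (weight \<eta>) * D n (\<xi> - \<eta>))) \<longlonglongrightarrow> abs_l2 (\<lambda>_. 0)"
    proof (rule l2_dominated_convergence(2)[where H="\<lambda>\<eta>. M * cmod (complex_of_real (weight \<eta>))", OF R(1)])
      show "AE \<eta> in lborel. (\<lambda>n. of_real (weight \<eta>) * D n (\<xi> - \<eta>)) \<longlonglongrightarrow> 0"
        using lim by (intro AE_I2 tendsto_mult_right_zero)
      show "AE \<eta> in lborel. cmod (of_real (weight \<eta>) * D n (\<xi> - \<eta>)) \<le> M * cmod (complex_of_real (weight \<eta>))" for n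
        by (intro AE_I2) (simp add: norm_mult mult.commute[of "weight _"] mult_right_mono M)
    qed (use iw in auto)
    then show ?thesis unfolding kernel_row_norm_def by (intro tendsto_norm_zero) (simp add: abs_l2_zero)
  qed
  have "(\<lambda>n. abs_l2 (\<lambda>\<xi>. complex_of_real (weight \<xi>) * of_real (kernel_row_norm (D n) \<xi>))) \<longlonglongrightarrow> abs_l2 (\<lambda>_. 0)"
  proof (rule l2_dominated_convergence(2)[where H="\<lambda>\<xi>. (M * W) * cmod (complex_of_real (weight \<xi>))", OF R(4)])
    show "AE \<xi> in lborel. (\<lambda>n. complex_of_real (weight \<xi>) * of_real (kernel_row_norm (D n) \<xi>)) \<longlonglongrightarrow> 0"
      using tendsto_of_real[OF row] by (intro AE_I2 tendsto_mult_right_zero) simp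
    show "AE \<xi> in lborel. cmod (complex_of_real (weight \<xi>) * of_real (kernel_row_norm (D n) \<xi>)) \<le> (M * W) * cmod (complex_of_real (weight \<xi>))" for n
    proof (intro AE_I2)
      fix \<xi>
      have "0 \<le> kernel_row_norm (D n) \<xi>" by (simp add: kernel_row_norm_def)
      then show "cmod (complex_of_real (weight \<xi>) * of_real (kernel_row_norm (D n) \<xi>)) \<le> (M * W) * cmod (complex_of_real (weight \<xi>))"
        using mult_right_mono[OF R(3)[of n \<xi>], of "weight \<xi>"] by (simp add: norm_mult W_def mult.commute)
    qed
  qed (use iw in auto)
  then have "(\<lambda>n. norm (abs_l2 (\<lambda>\<xi>. complex_of_real (weight \<xi>) * of_real (kernel_row_norm (D n) \<xi>)))) \<longlonglongrightarrow> 0"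
    by (intro tendsto_norm_zero) (simp add: abs_l2_zero)
  then show ?thesis unfolding kernel_norm_def by (intro tendsto_mult_right_zero)
qed

text \<open>Weak convergence is formulated with real test functions, so the exponential is split
  into cosine and sine.\<close>

lemma signed_char_tendsto:
  assumes "weakly_converges \<mu> m"
  shows "(\<lambda>n. signed_char (\<mu> n) \<zeta>) \<longlonglongrightarrow> signed_char m \<zeta>"
proof -
  have m: "(\<lambda>x. iexp (\<zeta> \<bullet> x)) \<in> borel_measurable borel" by measurable
  note I = signed_integral_integrable[OF m, of 1, simplified]
  have re: "Re (signed_char \<nu> \<zeta>) = signed_integral \<nu> (\<lambda>x. cos (\<zeta> \<bullet> x))" for \<nu>
    unfolding signed_char_def signed_integral_def using I[of \<nu>] by (simp add: integral_Re[symmetric] Re_exp del: integral_Re)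
  have im: "Im (signed_char \<nu> \<zeta>) = signed_integral \<nu> (\<lambda>x. sin (\<zeta> \<bullet> x))" for \<nu>
    unfolding signed_char_def signed_integral_def using I[of \<nu>] by (simp add: integral_Im[symmetric] Im_exp del: integral_Im)
  have w: "(\<lambda>n. signed_integral (\<mu> n) f) \<longlonglongrightarrow> signed_integral m f" if "continuous_on UNIV f" "bounded (range f)" for f :: "_ \<Rightarrow> real"
    using assms that unfolding weakly_converges_def by blast
  show ?thesis
    unfolding tendsto_complex_iff re im
    by (intro conjI w continuous_intros) (auto simp: bounded_iff intro!: exI[of _ 1])
qed

section \<open>Resolvents\<close>

text \<open>The form of the operator minus \<open>z\<close>, pulled back along
  \<open>lift_h2\<close>. Its domain is all of \<open>L2\<close>, the same for every measure, and it
  is bounded there.\<close>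

definition shifted_form :: "real \<Rightarrow> ('a::euclidean_space set \<Rightarrow> real) \<Rightarrow> complex \<Rightarrow> 'a l2 \<Rightarrow> 'a l2 \<Rightarrow> complex" where
  "shifted_form \<epsilon> \<mu> z \<phi> \<psi> = cinner (multiplier (\<lambda>\<xi>. of_real (form_symbol \<epsilon> \<xi>)) \<phi>) \<psi>
     + measure_form \<mu> \<phi> \<psi> - z * cinner (lift_h2 \<phi>) (lift_h2 \<psi>)"

lemma energy_form_eq_shifted_form:
  fixes \<phi> \<psi> :: "'a::euclidean_space l2"
  assumes "DIM('a) \<le> 3"
  shows "energy_form \<epsilon> \<mu> (lift_h2 \<phi>) (lift_h2 \<psi>) = shifted_form \<epsilon> \<mu> z \<phi> \<psi> + z * cinner (lift_h2 \<phi>) (lift_h2 \<psi>)"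
  by (simp add: energy_form_lift_h2 shifted_form_def measure_form_def continuous_rep_lift_h2[OF assms])

lemma shifted_form_add_left:
  fixes \<phi> :: "'a::euclidean_space l2"
  assumes "DIM('a) \<le> 3"
  shows "shifted_form \<epsilon> \<mu> z (\<phi> + \<phi>') \<psi> = shifted_form \<epsilon> \<mu> z \<phi> \<psi> + shifted_form \<epsilon> \<mu> z \<phi>' \<psi>"
  by (simp add: shifted_form_def multiplier_add[OF bounded_symbol_form] cinner_add_left measure_form_add_left[OF assms]
      lift_h2_add algebra_simps)

lemma shifted_form_add_right:
  fixes \<phi> :: "'a::euclidean_space l2"
  assumes "DIM('a) \<le> 3"
  shows "shifted_form \<epsilon> \<mu> z \<psi> (\<phi> + \<phi>') = shifted_form \<epsilon> \<mu> z \<psi> \<phi> + shifted_form \<epsilon> \<mu> z \<psi> \<phi>'"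
  by (simp add: shifted_form_def cinner_add_right measure_form_add_right[OF assms] lift_h2_add algebra_simps)

lemma shifted_form_cscale_left: "shifted_form \<epsilon> \<mu> z (cscale c \<phi>) \<psi> = c * shifted_form \<epsilon> \<mu> z \<phi> \<psi>"
  by (simp add: shifted_form_def multiplier_cscale[OF bounded_symbol_form] cinner_cscale_left measure_form_cscale_left
      lift_h2_cscale algebra_simps)

lemma shifted_form_cscale_right: "shifted_form \<epsilon> \<mu> z \<phi> (cscale c \<psi>) = cnj c * shifted_form \<epsilon> \<mu> z \<phi> \<psi>"
  by (simp add: shifted_form_def cinner_cscale_right measure_form_cscale_right lift_h2_cscale algebra_simps)

lemma shifted_form_diff_left:
  fixes \<phi> :: "'a::euclidean_space l2"
  assumes "DIM('a) \<le> 3"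
  shows "shifted_form \<epsilon> \<mu> z (\<phi> - \<phi>') \<psi> = shifted_form \<epsilon> \<mu> z \<phi> \<psi> - shifted_form \<epsilon> \<mu> z \<phi>' \<psi>"
  by (simp add: minus_l2_def shifted_form_add_left[OF assms] shifted_form_cscale_left)

lemma norm_shifted_form_le:
  fixes \<phi> \<psi> :: "'a::euclidean_space l2"
  assumes d: "DIM('a) \<le> 3"
  shows "cmod (shifted_form \<epsilon> \<mu> z \<phi> \<psi>)
    \<le> (\<epsilon>\<^sup>2 + 1 + (eval_bound TYPE('a))\<^sup>2 * total_variation \<mu> + cmod z) * (norm \<phi> * norm \<psi>)"
proof -
  have "cmod (cinner (multiplier (\<lambda>\<xi>. of_real (form_symbol \<epsilon> \<xi>)) \<phi>) \<psi>) \<le> (\<epsilon>\<^sup>2 + 1) * norm \<phi> * norm \<psi>"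
    by (rule order_trans[OF cmod_cinner_le], intro mult_right_mono norm_multiplier_le) (auto simp: form_symbol_bounds)
  moreover have "cmod (cinner (lift_h2 \<phi>) (lift_h2 \<psi>)) \<le> norm \<phi> * norm \<psi>"
    by (rule order_trans[OF cmod_cinner_le], intro mult_mono norm_lift_h2_le) auto
  then have "cmod (z * cinner (lift_h2 \<phi>) (lift_h2 \<psi>)) \<le> cmod z * (norm \<phi> * norm \<psi>)"
    by (simp add: norm_mult mult_left_mono)
  moreover note norm_measure_form_le[OF d, of \<mu> \<phi> \<psi>]
  moreover have "cmod (shifted_form \<epsilon> \<mu> z \<phi> \<psi>) \<le> cmod (cinner (multiplier (\<lambda>\<xi>. of_real (form_symbol \<epsilon> \<xi>)) \<phi>) \<psi>)
      + cmod (measure_form \<mu> \<phi> \<psi>) + cmod (z * cinner (lift_h2 \<phi>) (lift_h2 \<psi>))"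
    unfolding shifted_form_def using norm_triangle_ineq4 norm_triangle_ineq by (meson add_right_mono order_trans)
  ultimately show ?thesis by (simp add: algebra_simps)
qed

text \<open>With \<open>t = (norm \<xi>)^2\<close> the right-hand side is
  \<open>(\<epsilon>^2 t^2 + t + 1) / (1 + t)^2\<close>. The numerator dominates
  \<open>c (1 + t^2)\<close> and the denominator is at most \<open>2 (1 + t^2)\<close>.\<close>

lemma form_symbol_lower_bound:
  assumes "\<epsilon> > 0"
  shows "min (\<epsilon>\<^sup>2) 1 / 2 \<le> form_symbol \<epsilon> \<xi> + (weight \<xi>)\<^sup>2"
proof -
  define t where "t = (norm \<xi>)\<^sup>2"
  define c where "c = min (\<epsilon>\<^sup>2) 1"
  have t: "t \<ge> 0" and c: "0 \<le> c" "c \<le> \<epsilon>\<^sup>2" "c \<le> 1" by (simp_all add: t_def c_def)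
  have p: "(1 + t)\<^sup>2 > 0" using t by simp
  have "c / 2 * (1 + t)\<^sup>2 \<le> c / 2 * (2 + 2 * t\<^sup>2)"
    using c sum_squares_bound[of 1 t] by (intro mult_left_mono) (auto simp: power2_sum)
  also have "\<dots> = c * 1 + c * t\<^sup>2" by (simp add: algebra_simps)
  also have "\<dots> \<le> 1 * 1 + \<epsilon>\<^sup>2 * t\<^sup>2" using c by (intro add_mono mult_right_mono) auto
  also have "\<dots> \<le> \<epsilon>\<^sup>2 * t\<^sup>2 + t + 1" using t by simp
  finally have "c / 2 \<le> (\<epsilon>\<^sup>2 * t\<^sup>2 + t + 1) / (1 + t)\<^sup>2" using p by (simp add: le_divide_eq)
  also have "\<dots> = form_symbol \<epsilon> \<xi> + (weight \<xi>)\<^sup>2"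
    by (simp add: form_symbol_def weight_def t_def[symmetric] power_divide add_divide_distrib)
  finally show ?thesis by (simp add: c_def)
qed

text \<open>A Garding inequality: integrating the bound on the symbol loses the term with the
  squared weight, and that integral is precisely the squared norm of
  \<open>lift_h2 \<phi>\<close>.\<close>

lemma Re_cinner_form_symbol_ge:
  assumes \<epsilon>: "\<epsilon> > 0"
  shows "cinner (multiplier (\<lambda>\<xi>. of_real (form_symbol \<epsilon> \<xi>)) \<phi>) \<phi> = of_real (LINT \<xi>|lborel. form_symbol \<epsilon> \<xi> * (cmod (rep_l2 \<phi> \<xi>))\<^sup>2)"
    and "min (\<epsilon>\<^sup>2) 1 / 2 * (norm \<phi>)\<^sup>2 - (norm (lift_h2 \<phi>))\<^sup>2 \<le> (LINT \<xi>|lborel. form_symbol \<epsilon> \<xi> * (cmod (rep_l2 \<phi> \<xi>))\<^sup>2)"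
proof -
  have "cinner (multiplier (\<lambda>\<xi>. of_real (form_symbol \<epsilon> \<xi>)) \<phi>) \<phi>
      = (LINT \<xi>|lborel. complex_of_real (form_symbol \<epsilon> \<xi> * (cmod (rep_l2 \<phi> \<xi>))\<^sup>2))"
    unfolding cinner_multiplier[OF bounded_symbol_form] of_real_mult complex_norm_square mult.assoc ..
  then show "cinner (multiplier (\<lambda>\<xi>. of_real (form_symbol \<epsilon> \<xi>)) \<phi>) \<phi> = of_real (LINT \<xi>|lborel. form_symbol \<epsilon> \<xi> * (cmod (rep_l2 \<phi> \<xi>))\<^sup>2)"
    by (simp only: integral_complex_of_real)
  have i: "integrable lborel (\<lambda>\<xi>. (cmod (rep_l2 \<phi> \<xi>))\<^sup>2)"
    using square_integrable_rep[of \<phi>] by (simp add: square_integrable_def)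
  have iw: "integrable lborel (\<lambda>\<xi>. (weight \<xi>)\<^sup>2 * (cmod (rep_l2 \<phi> \<xi>))\<^sup>2)"
    using square_integrable_symbol[OF bounded_symbol_weight, of \<phi>] by (simp add: square_integrable_def norm_mult power_mult_distrib)
  have iq: "integrable lborel (\<lambda>\<xi>. form_symbol \<epsilon> \<xi> * (cmod (rep_l2 \<phi> \<xi>))\<^sup>2)"
  proof (rule Bochner_Integration.integrable_bound)
    show "integrable lborel (\<lambda>\<xi>. (\<epsilon>\<^sup>2 + 1) * (cmod (rep_l2 \<phi> \<xi>))\<^sup>2)" using i by simp
    show "AE \<xi> in lborel. norm (form_symbol \<epsilon> \<xi> * (cmod (rep_l2 \<phi> \<xi>))\<^sup>2) \<le> norm ((\<epsilon>\<^sup>2 + 1) * (cmod (rep_l2 \<phi> \<xi>))\<^sup>2)"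
      by (intro AE_I2) (simp add: abs_mult form_symbol_bounds mult_right_mono)
  qed measurable
  have n: "(norm (lift_h2 \<phi>))\<^sup>2 = (LINT \<xi>|lborel. (weight \<xi>)\<^sup>2 * (cmod (rep_l2 \<phi> \<xi>))\<^sup>2)"
    using norm_abs_l2[OF square_integrable_symbol[OF bounded_symbol_weight], of \<phi>]
    by (simp add: lift_h2_def multiplier_def norm_mult power_mult_distrib)
  have "min (\<epsilon>\<^sup>2) 1 / 2 * (norm \<phi>)\<^sup>2 = (LINT \<xi>|lborel. min (\<epsilon>\<^sup>2) 1 / 2 * (cmod (rep_l2 \<phi> \<xi>))\<^sup>2)"
    by (simp add: norm_l2_rep)
  also have "\<dots> \<le> (LINT \<xi>|lborel. form_symbol \<epsilon> \<xi> * (cmod (rep_l2 \<phi> \<xi>))\<^sup>2 + (weight \<xi>)\<^sup>2 * (cmod (rep_l2 \<phi> \<xi>))\<^sup>2)"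
  proof (rule integral_mono)
    show "min (\<epsilon>\<^sup>2) 1 / 2 * (cmod (rep_l2 \<phi> \<xi>))\<^sup>2
        \<le> form_symbol \<epsilon> \<xi> * (cmod (rep_l2 \<phi> \<xi>))\<^sup>2 + (weight \<xi>)\<^sup>2 * (cmod (rep_l2 \<phi> \<xi>))\<^sup>2" for \<xi>
      using mult_right_mono[OF form_symbol_lower_bound[OF \<epsilon>, of \<xi>], of "(cmod (rep_l2 \<phi> \<xi>))\<^sup>2"] by (simp add: distrib_right)
    show "integrable lborel (\<lambda>\<xi>. min (\<epsilon>\<^sup>2) 1 / 2 * (cmod (rep_l2 \<phi> \<xi>))\<^sup>2)" by (intro integrable_mult_right i)
  qed (intro Bochner_Integration.integrable_add iq iw)
  also have "\<dots> = (LINT \<xi>|lborel. form_symbol \<epsilon> \<xi> * (cmod (rep_l2 \<phi> \<xi>))\<^sup>2) + (norm (lift_h2 \<phi>))\<^sup>2"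
    by (simp add: n iq iw)
  finally show "min (\<epsilon>\<^sup>2) 1 / 2 * (norm \<phi>)\<^sup>2 - (norm (lift_h2 \<phi>))\<^sup>2 \<le> (LINT \<xi>|lborel. form_symbol \<epsilon> \<xi> * (cmod (rep_l2 \<phi> \<xi>))\<^sup>2)"
    by simp
qed

text \<open>Multiplying the form by \<open>1 + iK\<close> with \<open>K\<close> of the sign of \<open>Im z\<close> turns the imaginary part of \<open>-z\<close>
  into an arbitrarily large multiple of \<open>\<parallel>u\<parallel>\<^sup>2\<close>, which compensates the lower bound of the form.\<close>

lemma shifted_form_coercive:
  assumes d: "DIM('a::euclidean_space) \<le> 3" and \<epsilon>: "\<epsilon> > 0" and z: "Im z \<noteq> 0"
  shows "\<exists>c>0. \<exists>K. \<forall>\<mu> (\<phi>::'a l2). total_variation \<mu> \<le> M \<longrightarrow>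
    c * (norm \<phi>)\<^sup>2 \<le> Re ((1 + \<i> * of_real K) * shifted_form \<epsilon> \<mu> z \<phi> \<phi>)"
proof -
  define M' where "M' = max M 1"
  have M': "M' > 0" "M \<le> M'" by (auto simp: M'_def)
  \<comment> \<open>Half of the constant in the Garding inequality; the other half is spent on the
    measure term.\<close>
  define c where "c = min (\<epsilon>\<^sup>2) 1 / 4"
  have c: "c > 0" using \<epsilon> by (simp add: c_def)
  \<comment> \<open>Chosen so that the high-frequency part of the measure term, at most
    \<open>2 M' \<delta>^2\<close> times the squared norm of \<open>\<phi>\<close>, uses up exactly
    the second \<open>c\<close>.\<close>
  define \<delta> where "\<delta> = sqrt (c / (2 * M'))"
  have \<delta>: "\<delta> > 0" "2 * M' * \<delta>\<^sup>2 = c" using c M' by (auto simp: \<delta>_def)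
  obtain C where C: "C \<ge> 0" "\<And>(\<phi>::'a l2) x. cmod (point_eval \<phi> x) \<le> \<delta> * norm \<phi> + C * norm (lift_h2 \<phi>)"
    using norm_point_eval_interpolate[OF d \<delta>(1)] by blast
  \<comment> \<open>\<open>K * Im z\<close> has to outweigh three multiples of the squared norm of
    \<open>lift_h2 \<phi>\<close>: \<open>\<bar>Re z\<bar>\<close> from the shift, 1 from the
    Garding inequality, and \<open>2 M' C^2\<close> from the low-frequency part of the measure
    term.\<close>
  define K where "K = (\<bar>Re z\<bar> + 1 + 2 * M' * C\<^sup>2) / Im z"
  have K: "K * Im z = \<bar>Re z\<bar> + 1 + 2 * M' * C\<^sup>2" using z by (simp add: K_def)
  have "c * (norm \<phi>)\<^sup>2 \<le> Re ((1 + \<i> * of_real K) * shifted_form \<epsilon> \<mu> z \<phi> \<phi>)" if tv: "total_variation \<mu> \<le> M"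
    for \<mu> and \<phi> :: "'a l2"
  proof -
    define a where "a = norm \<phi>"
    define l where "l = norm (lift_h2 \<phi>)"
    define Q where "Q = (LINT \<xi>|lborel. form_symbol \<epsilon> \<xi> * (cmod (rep_l2 \<phi> \<xi>))\<^sup>2)"
    define S where "S = Re (measure_form \<mu> \<phi> \<phi>)"
    have e: "shifted_form \<epsilon> \<mu> z \<phi> \<phi> = of_real Q + of_real S - z * of_real (l\<^sup>2)"
      unfolding shifted_form_def Re_cinner_form_symbol_ge(1)[OF \<epsilon>] cinner_self Q_def S_def l_def
      using measure_form_real[of \<mu> \<phi>] by simp
    have re: "Re ((1 + \<i> * of_real K) * shifted_form \<epsilon> \<mu> z \<phi> \<phi>) = Q + S - Re z * l\<^sup>2 + K * Im z * l\<^sup>2"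
      unfolding e by (simp add: algebra_simps del: of_real_power)
    have "cmod (measure_form \<mu> \<phi> \<phi>) \<le> (\<delta> * a + C * l)\<^sup>2 * total_variation \<mu>"
      unfolding a_def l_def by (rule measure_form_bound[OF C(2)])
    also have "\<dots> \<le> (\<delta> * a + C * l)\<^sup>2 * M'" using tv M' by (intro mult_left_mono) auto
    also have "\<dots> \<le> (2 * (\<delta> * a)\<^sup>2 + 2 * (C * l)\<^sup>2) * M'"
      using sum_squares_bound[of "\<delta> * a" "C * l"] M' by (intro mult_right_mono) (auto simp: power2_sum)
    also have "\<dots> = (2 * M' * \<delta>\<^sup>2) * a\<^sup>2 + 2 * M' * C\<^sup>2 * l\<^sup>2" by (simp add: power_mult_distrib algebra_simps)
    finally have S: "S \<ge> - (c * a\<^sup>2 + 2 * M' * C\<^sup>2 * l\<^sup>2)"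
      using abs_Re_le_cmod[of "measure_form \<mu> \<phi> \<phi>"] unfolding S_def \<delta>(2) by linarith
    have Q: "2 * c * a\<^sup>2 - l\<^sup>2 \<le> Q"
      using Re_cinner_form_symbol_ge(2)[OF \<epsilon>, of \<phi>] by (simp add: Q_def a_def l_def c_def)
    have z': "- Re z * l\<^sup>2 + K * Im z * l\<^sup>2 \<ge> (1 + 2 * M' * C\<^sup>2) * l\<^sup>2"
    proof -
      have "(1 + 2 * M' * C\<^sup>2) * l\<^sup>2 \<le> (- Re z + K * Im z) * l\<^sup>2" unfolding K by (intro mult_right_mono) auto
      then show ?thesis by (simp add: distrib_right left_diff_distrib)
    qed
    show ?thesis unfolding re a_def[symmetric] using S Q z' by (simp add: algebra_simps)
  qed
  then show ?thesis using c by blast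
qed

text \<open>The coordinate of the resolvent in \<open>L2\<close>: the solution of the resolvent
  equation with right-hand side \<open>f\<close> is \<open>lift_h2\<close> of it.\<close>

definition form_solution :: "real \<Rightarrow> ('a::euclidean_space set \<Rightarrow> real) \<Rightarrow> complex \<Rightarrow> 'a l2 \<Rightarrow> 'a l2" where
  "form_solution \<epsilon> \<mu> z f = (THE \<phi>. \<forall>\<psi>. shifted_form \<epsilon> \<mu> z \<phi> \<psi> = cinner f (lift_h2 \<psi>))"

section \<open>The resolvent equation for one coercive form\<close>

context
  fixes \<epsilon> :: real and \<mu> :: "'a::euclidean_space set \<Rightarrow> real" and z :: complex and c K :: real
  assumes d: "DIM('a) \<le> 3" and c: "c > 0"
    and coercive: "\<And>\<phi>. c * (norm \<phi>)\<^sup>2 \<le> Re ((1 + \<i> * of_real K) * shifted_form \<epsilon> \<mu> z \<phi> \<phi>)"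
begin

text \<open>The a priori estimate in its only form: it yields uniqueness with \<open>C = 0\<close>,
  the bound on the solution with \<open>C = norm f\<close>, and later the bound on the difference of
  two solutions.\<close>

lemma coercive_norm_le:
  assumes C: "0 \<le> C" and le: "cmod (shifted_form \<epsilon> \<mu> z \<phi> \<phi>) \<le> C * norm \<phi>"
  shows "norm \<phi> \<le> cmod (1 + \<i> * of_real K) / c * C"
proof (cases "norm \<phi> = 0")
  case True
  then show ?thesis using c C by simp
next
  case False
  have "c * (norm \<phi>)\<^sup>2 \<le> cmod ((1 + \<i> * of_real K) * shifted_form \<epsilon> \<mu> z \<phi> \<phi>)"
    using coercive[of \<phi>] complex_Re_le_cmod order_trans by blast
  also have "\<dots> \<le> cmod (1 + \<i> * of_real K) * (C * norm \<phi>)"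
    unfolding norm_mult by (intro mult_left_mono le) auto
  finally have "c * norm \<phi> \<le> cmod (1 + \<i> * of_real K) * C" using False by (simp add: power2_eq_square)
  then show ?thesis using c by (simp add: field_simps)
qed

text \<open>Lax-Milgram is applied to the real part of the rotated form. The rotation
  \<open>\<theta>\<close> multiplies both sides of the equation and is nonzero, so it can be
  cancelled at the end.\<close>

lemma form_solution_ex1: "\<exists>!\<phi>. \<forall>\<psi>. shifted_form \<epsilon> \<mu> z \<phi> \<psi> = cinner f (lift_h2 \<psi>)"
proof (rule ex_ex1I)
  define \<theta> where "\<theta> = 1 + \<i> * complex_of_real K"
  have \<theta>: "\<theta> \<noteq> 0" by (simp add: \<theta>_def complex_eq_iff)
  define B where "B \<phi> \<psi> = Re (\<theta> * shifted_form \<epsilon> \<mu> z \<phi> \<psi>)" for \<phi> \<psi>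
  define L where "L \<psi> = Re (\<theta> * cinner f (lift_h2 \<psi>))" for \<psi>
  have Re_scale: "Re (complex_of_real r * w) = r * Re w" for r w by simp
  have B: "bounded_bilinear B"
  proof
    show "\<exists>C. \<forall>\<phi> \<psi>. norm (B \<phi> \<psi>) \<le> norm \<phi> * norm \<psi> * C"
    proof (intro exI allI)
      fix \<phi> \<psi>
      let ?C = "\<epsilon>\<^sup>2 + 1 + (eval_bound TYPE('a))\<^sup>2 * total_variation \<mu> + cmod z"
      have "norm (B \<phi> \<psi>) \<le> cmod \<theta> * cmod (shifted_form \<epsilon> \<mu> z \<phi> \<psi>)"
        unfolding B_def norm_mult[symmetric] real_norm_def by (rule abs_Re_le_cmod)
      also have "\<dots> \<le> cmod \<theta> * (?C * (norm \<phi> * norm \<psi>))"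
        by (intro mult_left_mono norm_shifted_form_le d) simp
      finally show "norm (B \<phi> \<psi>) \<le> norm \<phi> * norm \<psi> * (cmod \<theta> * ?C)" by (simp add: mult_ac)
    qed
  qed (simp_all add: B_def shifted_form_add_left[OF d] shifted_form_add_right[OF d] distrib_left scaleR_l2_def
      shifted_form_cscale_left shifted_form_cscale_right mult.left_commute[of _ "complex_of_real _"]
      Re_scale del: times_complex.simps)
  have L: "bounded_linear L"
  proof (rule bounded_linear_intro[where K="cmod \<theta> * norm f"])
    fix \<psi> \<psi>' r
    show "L (\<psi> + \<psi>') = L \<psi> + L \<psi>'" by (simp add: L_def lift_h2_add cinner_add_right distrib_left)
    show "L (r *\<^sub>R \<psi>) = r *\<^sub>R L \<psi>"
      by (simp add: L_def scaleR_l2_def lift_h2_cscale cinner_cscale_right algebra_simps)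
    have "norm (L \<psi>) \<le> cmod \<theta> * cmod (cinner f (lift_h2 \<psi>))"
      unfolding L_def norm_mult[symmetric] real_norm_def by (rule abs_Re_le_cmod)
    also have "\<dots> \<le> cmod \<theta> * (norm f * norm \<psi>)"
      by (intro mult_left_mono order_trans[OF cmod_cinner_le] norm_lift_h2_le) auto
    finally show "norm (L \<psi>) \<le> norm \<psi> * (cmod \<theta> * norm f)" by (simp add: mult_ac)
  qed
  obtain \<phi> where \<phi>: "\<And>\<psi>. B \<phi> \<psi> = L \<psi>"
    using lax_milgram[OF B c _ L] coercive unfolding B_def \<theta>_def by blast
  have "shifted_form \<epsilon> \<mu> z \<phi> \<psi> = cinner f (lift_h2 \<psi>)" for \<psi>
  proof -
    define T where "T = \<theta> * (shifted_form \<epsilon> \<mu> z \<phi> \<psi> - cinner f (lift_h2 \<psi>))"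
    have "Re T = 0" using \<phi>[of \<psi>] by (simp add: T_def B_def L_def right_diff_distrib)
    \<comment> \<open>The real equation also holds for \<open>i \<psi>\<close>. The form is
      conjugate-linear in that argument, so this multiplies \<open>T\<close> by \<open>- i\<close>
      and captures its imaginary part.\<close>
    moreover have "Re (- \<i> * T) = 0"
    proof -
      have "- \<i> * T = \<theta> * (shifted_form \<epsilon> \<mu> z \<phi> (cscale \<i> \<psi>) - cinner f (lift_h2 (cscale \<i> \<psi>)))"
        by (simp add: T_def shifted_form_cscale_right lift_h2_cscale cinner_cscale_right algebra_simps)
      then show ?thesis using \<phi>[of "cscale \<i> \<psi>"] by (simp only: B_def L_def right_diff_distrib minus_complex.simps)
    qed
    ultimately have "T = 0" by (simp add: complex_eq_iff)
    then show ?thesis using \<theta> by (simp add: T_def)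
  qed
  then show "\<exists>\<phi>. \<forall>\<psi>. shifted_form \<epsilon> \<mu> z \<phi> \<psi> = cinner f (lift_h2 \<psi>)" by blast
next
  fix \<phi> \<phi>'
  assume "\<forall>\<psi>. shifted_form \<epsilon> \<mu> z \<phi> \<psi> = cinner f (lift_h2 \<psi>)" "\<forall>\<psi>. shifted_form \<epsilon> \<mu> z \<phi>' \<psi> = cinner f (lift_h2 \<psi>)"
  then have "shifted_form \<epsilon> \<mu> z (\<phi> - \<phi>') (\<phi> - \<phi>') = 0" by (simp add: shifted_form_diff_left[OF d])
  then have "norm (\<phi> - \<phi>') \<le> 0" using coercive_norm_le[of 0 "\<phi> - \<phi>'"] by simp
  then show "\<phi> = \<phi>'" by simp
qed

lemma form_solution: "shifted_form \<epsilon> \<mu> z (form_solution \<epsilon> \<mu> z f) \<psi> = cinner f (lift_h2 \<psi>)"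
  using theI'[OF form_solution_ex1[of f]] unfolding form_solution_def by blast

lemma form_solution_eqI:
  "(\<And>\<psi>. shifted_form \<epsilon> \<mu> z \<phi> \<psi> = cinner f (lift_h2 \<psi>)) \<Longrightarrow> form_solution \<epsilon> \<mu> z f = \<phi>"
  unfolding form_solution_def by (rule the1_equality[OF form_solution_ex1]) blast

lemma norm_form_solution_le: "norm (form_solution \<epsilon> \<mu> z f) \<le> cmod (1 + \<i> * of_real K) / c * norm f"
proof (rule coercive_norm_le)
  show "cmod (shifted_form \<epsilon> \<mu> z (form_solution \<epsilon> \<mu> z f) (form_solution \<epsilon> \<mu> z f)) \<le> norm f * norm (form_solution \<epsilon> \<mu> z f)"
    unfolding form_solution
    by (rule order_trans[OF cmod_cinner_le]) (simp add: mult_left_mono norm_lift_h2_le)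
qed simp

text \<open>The form domain is the range of \<open>lift_h2\<close>, so the weak equation defining
  the operator, once the shift by \<open>z\<close> is subtracted, is the equation for
  \<open>form_solution\<close>. Existence and uniqueness in the resolvent set are both read off from
  this equivalence.\<close>

lemma perturbed_operator_iff:
  "(u, v) \<in> perturbed_operator \<epsilon> \<mu> \<and> v - cscale z u = f \<longleftrightarrow>
    u = lift_h2 (form_solution \<epsilon> \<mu> z f) \<and> v = f + cscale z u"
proof
  assume *: "(u, v) \<in> perturbed_operator \<epsilon> \<mu> \<and> v - cscale z u = f"
  then have u: "u \<in> sobolev 2" and E: "\<And>h. h \<in> sobolev 2 \<Longrightarrow> energy_form \<epsilon> \<mu> u h = cinner v h"
    and v: "v = f + cscale z u"
    by (auto simp: perturbed_operator_def form_operator_def)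
  obtain \<phi> where \<phi>: "u = lift_h2 \<phi>" using sobolev_2_imp_lift_h2[OF u] by blast
  have "shifted_form \<epsilon> \<mu> z \<phi> \<psi> = cinner f (lift_h2 \<psi>)" for \<psi>
    using E[OF lift_h2_in_sobolev[of \<psi>]]
    by (simp add: \<phi> v energy_form_eq_shifted_form[OF d, of _ _ _ _ z] cinner_add_left cinner_cscale_left)
  then have "form_solution \<epsilon> \<mu> z f = \<phi>" by (rule form_solution_eqI)
  then show "u = lift_h2 (form_solution \<epsilon> \<mu> z f) \<and> v = f + cscale z u" using \<phi> v by simp
next
  assume *: "u = lift_h2 (form_solution \<epsilon> \<mu> z f) \<and> v = f + cscale z u"
  have "energy_form \<epsilon> \<mu> u h = cinner v h" if h: "h \<in> sobolev 2" for h
  proof -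
    obtain \<psi> where "h = lift_h2 \<psi>" using sobolev_2_imp_lift_h2[OF h] by blast
    then show ?thesis
      using * by (simp add: energy_form_eq_shifted_form[OF d, of _ _ _ _ z] form_solution cinner_add_left cinner_cscale_left)
  qed
  then show "(u, v) \<in> perturbed_operator \<epsilon> \<mu> \<and> v - cscale z u = f"
    using * lift_h2_in_sobolev by (auto simp: perturbed_operator_def form_operator_def)
qed

lemma resolvent_perturbed_operator:
  "resolvent (perturbed_operator \<epsilon> \<mu>) z f = lift_h2 (form_solution \<epsilon> \<mu> z f)"
  unfolding resolvent_def perturbed_operator_iff by simp

lemma bounded_linear_resolvent: "bounded_linear (resolvent (perturbed_operator \<epsilon> \<mu>) z)"
  unfolding resolvent_perturbed_operator[abs_def]
proof (rule bounded_linear_intro[where K="cmod (1 + \<i> * of_real K) / c"])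
  fix f g :: "'a l2" and r :: real
  have "form_solution \<epsilon> \<mu> z (f + g) = form_solution \<epsilon> \<mu> z f + form_solution \<epsilon> \<mu> z g"
    by (rule form_solution_eqI) (simp add: shifted_form_add_left[OF d] form_solution cinner_add_left)
  then show "lift_h2 (form_solution \<epsilon> \<mu> z (f + g)) = lift_h2 (form_solution \<epsilon> \<mu> z f) + lift_h2 (form_solution \<epsilon> \<mu> z g)"
    by (simp add: lift_h2_add)
  have "form_solution \<epsilon> \<mu> z (r *\<^sub>R f) = r *\<^sub>R form_solution \<epsilon> \<mu> z f"
    by (rule form_solution_eqI) (simp add: scaleR_l2_def shifted_form_cscale_left form_solution cinner_cscale_left)
  then show "lift_h2 (form_solution \<epsilon> \<mu> z (r *\<^sub>R f)) = r *\<^sub>R lift_h2 (form_solution \<epsilon> \<mu> z f)"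
    by (simp add: scaleR_l2_def lift_h2_cscale)
  show "norm (lift_h2 (form_solution \<epsilon> \<mu> z f)) \<le> norm f * (cmod (1 + \<i> * of_real K) / c)"
    using order_trans[OF norm_lift_h2_le norm_form_solution_le[of f]] by (simp add: mult.commute)
qed

lemma in_resolvent_set: "z \<in> resolvent_set (perturbed_operator \<epsilon> \<mu>)"
  unfolding resolvent_set_def
proof (intro CollectI conjI allI)
  fix f :: "'a l2"
  show "\<exists>!p. p \<in> perturbed_operator \<epsilon> \<mu> \<and> snd p - cscale z (fst p) = f"
  proof (rule ex1I)
    let ?u = "lift_h2 (form_solution \<epsilon> \<mu> z f)"
    show "(?u, f + cscale z ?u) \<in> perturbed_operator \<epsilon> \<mu> \<and> snd (?u, f + cscale z ?u) - cscale z (fst (?u, f + cscale z ?u)) = f"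
      using perturbed_operator_iff[of ?u "f + cscale z ?u" f] by simp
    show "p = (?u, f + cscale z ?u)" if "p \<in> perturbed_operator \<epsilon> \<mu> \<and> snd p - cscale z (fst p) = f" for p
      using perturbed_operator_iff[of "fst p" "snd p" f] that by (simp add: prod_eq_iff)
  qed
qed (rule bounded_linear_resolvent)

end

text \<open>The second resolvent identity in form language: the difference \<open>\<omega>\<close>
  of the solutions is inserted into its own equation, where only the difference of the measures
  survives. Coercivity enters once for \<open>\<omega>\<close> and once for \<open>\<phi>\<close>,
  hence the square; \<open>c\<close> and \<open>K\<close> are shared by the two measures.\<close>

lemma norm_resolvent_diff_le:
  fixes \<mu> m :: "'a::euclidean_space set \<Rightarrow> real"
  assumes d: "DIM('a) \<le> 3" and c: "c > 0"
    and cm: "\<And>\<phi>. c * (norm \<phi>)\<^sup>2 \<le> Re ((1 + \<i> * of_real K) * shifted_form \<epsilon> m z \<phi> \<phi>)"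
    and c\<mu>: "\<And>\<phi>. c * (norm \<phi>)\<^sup>2 \<le> Re ((1 + \<i> * of_real K) * shifted_form \<epsilon> \<mu> z \<phi> \<phi>)"
  shows "norm (resolvent (perturbed_operator \<epsilon> \<mu>) z f - resolvent (perturbed_operator \<epsilon> m) z f)
    \<le> (cmod (1 + \<i> * of_real K) / c)\<^sup>2 * kernel_norm (\<lambda>\<zeta>. signed_char m \<zeta> - signed_char \<mu> \<zeta>) * norm f"
proof -
  define D where "D = (\<lambda>\<zeta>. signed_char m \<zeta> - signed_char \<mu> \<zeta>)"
  define \<theta> where "\<theta> = cmod (1 + \<i> * of_real K) / c"
  have \<theta>: "\<theta> \<ge> 0" using c by (simp add: \<theta>_def)
  define \<phi> where "\<phi> = form_solution \<epsilon> m z f"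
  define \<phi>' where "\<phi>' = form_solution \<epsilon> \<mu> z f"
  define \<omega> where "\<omega> = \<phi>' - \<phi>"
  have [measurable]: "D \<in> borel_measurable borel" unfolding D_def by measurable
  have DM: "cmod (D \<zeta>) \<le> total_variation m + total_variation \<mu>" for \<zeta>
    unfolding D_def by (rule order_trans[OF norm_triangle_ineq4]) (intro add_mono norm_signed_char_le)
  \<comment> \<open>Both solutions produce \<open>cinner f (lift_h2 \<omega>)\<close> in their own
    equation, so the form for \<open>\<mu>\<close> at \<open>\<phi>'\<close> is exchanged for the
    form for \<open>m\<close> at \<open>\<phi>\<close>.\<close>
  have "shifted_form \<epsilon> \<mu> z \<omega> \<omega> = shifted_form \<epsilon> m z \<phi> \<omega> - shifted_form \<epsilon> \<mu> z \<phi> \<omega>"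
    unfolding \<omega>_def shifted_form_diff_left[OF d] \<phi>_def \<phi>'_def
    by (simp add: form_solution[OF d c cm] form_solution[OF d c c\<mu>])
  also have "\<dots> = measure_form m \<phi> \<omega> - measure_form \<mu> \<phi> \<omega>" by (simp add: shifted_form_def)
  also have "\<dots> = kernel_form D \<phi> \<omega>"
    unfolding D_def measure_form_eq_kernel_form[OF d]
    by (rule kernel_form_diff[OF d signed_char_measurable norm_signed_char_le signed_char_measurable norm_signed_char_le, symmetric])
  finally have "cmod (shifted_form \<epsilon> \<mu> z \<omega> \<omega>) \<le> (kernel_norm D * norm \<phi>) * norm \<omega>"
    using norm_kernel_form_le[OF d _ DM, where \<phi>=\<phi> and \<psi>=\<omega>] by simp
  moreover have k: "kernel_norm D \<ge> 0" by (simp add: kernel_norm_def)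
  ultimately have "norm \<omega> \<le> \<theta> * (kernel_norm D * norm \<phi>)"
    unfolding \<theta>_def by (intro coercive_norm_le[OF d c c\<mu>]) auto
  also have "\<dots> \<le> \<theta> * (kernel_norm D * (\<theta> * norm f))"
    using norm_form_solution_le[OF d c cm, of f] k \<theta> by (intro mult_left_mono) (auto simp: \<phi>_def \<theta>_def)
  finally have "norm (lift_h2 \<omega>) \<le> \<theta>\<^sup>2 * kernel_norm D * norm f"
    using norm_lift_h2_le[of \<omega>] by (simp add: power2_eq_square mult_ac)
  then show ?thesis
    by (simp add: resolvent_perturbed_operator[OF d c cm] resolvent_perturbed_operator[OF d c c\<mu>] \<omega>_def \<phi>_def \<phi>'_def
        lift_h2_diff D_def \<theta>_def)
qed

lemma norm_resolvent_converges_perturbed_operator: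
  fixes \<mu> :: "nat \<Rightarrow> 'a::euclidean_space set \<Rightarrow> real"
  assumes d: "DIM('a) \<le> 3" and \<epsilon>: "\<epsilon> > 0" and w: "weakly_converges \<mu> m"
    and bdd: "bdd_above (range (\<lambda>n. total_variation (\<mu> n)))"
  shows "norm_resolvent_converges (\<lambda>n. perturbed_operator \<epsilon> (\<mu> n)) (perturbed_operator \<epsilon> m)"
  unfolding norm_resolvent_converges_def
proof (intro allI impI)
  fix z :: complex assume z: "Im z \<noteq> 0"
  obtain M0 where M0: "\<And>n. total_variation (\<mu> n) \<le> M0" using bdd by (auto simp: bdd_above_def)
  \<comment> \<open>The limit measure is included in the bound so that one pair \<open>c\<close>,
    \<open>K\<close> serves \<open>m\<close> and every \<open>\<mu> n\<close>.\<close>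
  define M where "M = max M0 (total_variation m)"
  have M: "total_variation (\<mu> n) \<le> M" "total_variation m \<le> M" for n
    using M0[of n] by (auto simp: M_def)
  obtain c K where c: "c > 0" and co: "\<And>\<nu> (\<phi>::'a l2). total_variation \<nu> \<le> M \<Longrightarrow>
      c * (norm \<phi>)\<^sup>2 \<le> Re ((1 + \<i> * of_real K) * shifted_form \<epsilon> \<nu> z \<phi> \<phi>)"
    using shifted_form_coercive[OF d \<epsilon> z, of M] by blast
  note cn = co[OF M(1)] and cm = co[OF M(2)]
  define D where "D n = (\<lambda>\<zeta>. signed_char m \<zeta> - signed_char (\<mu> n) \<zeta>)" for n
  define R where "R n = (\<lambda>f. resolvent (perturbed_operator \<epsilon> (\<mu> n)) z f - resolvent (perturbed_operator \<epsilon> m) z f)" for n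
  let ?C = "(cmod (1 + \<i> * of_real K) / c)\<^sup>2"
  have "(\<lambda>n. kernel_norm (D n)) \<longlonglongrightarrow> 0"
  proof (rule kernel_norm_tendsto_0[OF d])
    show "cmod (D n \<zeta>) \<le> M + M" for n \<zeta>
      unfolding D_def by (rule order_trans[OF norm_triangle_ineq4]) (intro add_mono order_trans[OF norm_signed_char_le M(1)] order_trans[OF norm_signed_char_le M(2)])
    show "(\<lambda>n. D n \<zeta>) \<longlonglongrightarrow> 0" for \<zeta>
      using tendsto_diff[OF tendsto_const signed_char_tendsto[OF w], of "signed_char m \<zeta>" \<zeta>] by (simp add: D_def)
  qed (simp add: D_def)
  then have lim: "(\<lambda>n. ?C * kernel_norm (D n)) \<longlonglongrightarrow> 0" by (rule tendsto_mult_right_zero)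
  have "onorm (R n) \<le> ?C * kernel_norm (D n)" for n
    by (rule onorm_bound) (auto simp: R_def D_def kernel_norm_def intro!: norm_resolvent_diff_le[OF d c cm cn, unfolded kernel_norm_def])
  moreover have "0 \<le> onorm (R n)" for n
    unfolding R_def by (intro onorm_pos_le bounded_linear_sub bounded_linear_resolvent[OF d c cn] bounded_linear_resolvent[OF d c cm])
  ultimately have "(\<lambda>n. onorm (R n)) \<longlonglongrightarrow> 0"
    by (intro tendsto_sandwich[OF _ _ tendsto_const lim]) auto
  then show "(\<forall>n. z \<in> resolvent_set (perturbed_operator \<epsilon> (\<mu> n))) \<and> z \<in> resolvent_set (perturbed_operator \<epsilon> m) \<and>
      (\<lambda>n. onorm (\<lambda>f. resolvent (perturbed_operator \<epsilon> (\<mu> n)) z f - resolvent (perturbed_operator \<epsilon> m) z f)) \<longlonglongrightarrow> 0"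
    using in_resolvent_set[OF d c cn] in_resolvent_set[OF d c cm] by (simp add: R_def)
qed

theorem theorem3:
  fixes \<epsilon> :: real
    and m :: "(real ^ 'n) set \<Rightarrow> real"
    and \<mu> :: "nat \<Rightarrow> (real ^ 'n) set \<Rightarrow> real"
  assumes "CARD('n) \<in> {1, 2, 3}"
    and "\<epsilon> > 0"
    and "finite_signed_measure m"
    and "\<And>n. finite_signed_measure (\<mu> n)"
    and "weakly_converges \<mu> m"
    and "bdd_above (range (\<lambda>n. total_variation (\<mu> n)))"
  shows "norm_resolvent_converges (\<lambda>n. perturbed_operator \<epsilon> (\<mu> n)) (perturbed_operator \<epsilon> m)"
proof (rule norm_resolvent_converges_perturbed_operator)
  show "DIM(real ^ 'n) \<le> 3" using assms(1) by auto
qed fact+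

end
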